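(* Let $m,n,r\in\mathbb{N}$, $\nu_j\in(0,1]$ and $\lambda_j>0$ for $j=1,\dots,m$, $\beta\in(0,1]$ and $c>0$. The solution to the problem $$\begin{cases}\displaystyle\sum_{j=1}^m\lambda_j\dfrac{{}^C\partial^{\nu_j^r}}{\partial t^{\nu_j^r}}\mathfrak{w}^{\beta,r}_{\nu_1,\dots,\nu_m}(\mathbf{x},t)=-c^2(-\Delta)^\beta\mathfrak{w}^{\beta,r}_{\nu_1,\dots,\nu_m}(\mathbf{x},t), & \mathbf{x}\in\mathbb{R}^n,\ t>0,\\ \mathfrak{w}^{\beta,r}_{\nu_1,\dots,\nu_m}(\mathbf{x},0)=\delta(\mathbf{x}),\end{cases}$$ where ${}^C\partial^{\nu}/\partial t^{\nu}$ is the Dzerbayshan-Caputo fractional derivative, is given by the probability density of the process $$\mathfrak{W}_n(t)=\mathbf{S}_n^{2\beta}\bigl(c^2\mathfrak{L}_r^{\nu_1,\dots,\nu_m}(t)\bigr),\qquad t>0,$$ where $\mathbf{S}_n^{2\beta}$ is the isotropic $n$-dimensional stable process with $\mathbb{E}e^{i\boldsymbol{\xi}\cdot\mathbf{S}_n^{2\beta}(t)}=e^{-t\|\boldsymbol{\xi}\|^{2\beta}}$, independent of the process $$\mathfrak{L}_r^{\nu_1,\dots,\nu_m}(t)=\inf\bigl\{s>0:\mathfrak{H}_r^{\nu_1,\dots,\nu_m}(s)\ge t\bigr\},\qquad t>0,$$ with $$\mathfrak{H}_r^{\nu_1,\dots,\nu_m}(t)=\sum_{j=1}^m\lambda_j^{1/\nu_j}\;{}_1H^{\nu_j}\bigl({}_2H^{\nu_j}\bigl({}_3H^{\nu_j}\bigl(\cdots{}_rH^{\nu_j}(t)\cdots\bigr)\bigr)\bigr),\qquad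 t>0,$$ the ${}_kH^{\nu_j}$, $k=1,\dots,r$, $j=1,\dots,m$, being independent stable subordinators, ${}_kH^{\nu_j}$ of order $\nu_j$. For $\beta=1$ the process $\mathfrak{W}_n$ becomes the subordinated Brownian motion $\mathbf{B}_n\bigl(c^2\mathfrak{L}_r^{\nu_1,\dots,\nu_m}(t)\bigr)$, $t>0$.
   Context: $\nu_j^r$ denotes the $r$-th power of $\nu_j$. A stable subordinator $H^\nu(t)$, $t>0$, of order $\nu\in(0,1]$ is the nonnegative process with stationary independent increments and $\mathbb{E}e^{-\mu H^\nu(t)}=e^{-t\mu^\nu}$ for $\mu>0$ (so $H^1(t)=t$). $\mathbf{B}_n=\mathbf{S}_n^{2}$ is the $n$-dimensional Brownian motion with $\mathbb{E}e^{i\boldsymbol{\xi}\cdot\mathbf{B}_n(t)}=e^{-t\|\boldsymbol{\xi}\|^2}$. $\|\cdot\|$ is the Euclidean norm and $\delta$ is the Dirac delta. For $\nu\in(0,1)$ the Dzerbayshan-Caputo derivative is $\frac{{}^C\partial^\nu}{\partial t^\nu}f(t)=\frac{1}{\Gamma(1-\nu)}\int_0^t\frac{f'(s)}{(t-s)^{\nu}}\,ds$; for $\nu=1$ it is the ordinary derivative. Its Laplace transform is $\mu^\nu\widetilde f(\mu)-\mu^{\nu-1}f(0)$, where $\widetilde f(\mu)=\int_0^\infty e^{-\mu t}f(t)\,dt$. The operator $-(-\Delta)^\beta$ is defined by the Fourier multiplier $-\|\boldsymbol{\xi}\|^{2\beta}$, with $\widehat u(\boldsymbol{\xi})=\int_{\mathbb{R}^n}e^{i\boldsymbol{\xi}\cdot\mathbf{x}}u(\mathbf{x})\,d\mathbf{x}$.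 "Solution" is understood through the Fourier transform in $\mathbf{x}$ and Laplace transform in $t$ of the problem, using these rules.
   Formalization: The scale of the j-th summand is λ_j^{1/ν_j^r} instead of λ_j^{1/ν_j}; as printed the claim fails for r≥2 (e.g. r=2, ν=1/2, λ=4, m=n=c=β=1), the two agree if r=1, λ_j=1 or ν_j=1. Subordinators and S are taken with càdlàg paths. *)

theory Defs
  imports "HOL-Probability.Probability"
begin

(* Time runs over [0, oo); the values of a process at negative times are never used.  Path
   properties are required for every \<omega> (rather than almost every \<omega>), so that compositions
   of processes are measurable without completing M. *)
definition levy_process ::
  "'a measure \<Rightarrow> (real \<Rightarrow> 'a \<Rightarrow> 'b::euclidean_space) \<Rightarrow> bool" where
  "levy_process M X \<longleftrightarrow>
     (\<forall>t\<ge>0. X t \<in> borel_measurable M) \<and>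
     (\<forall>\<omega>\<in>space M. X 0 \<omega> = 0) \<and>
     (\<forall>\<omega>\<in>space M. \<forall>t\<ge>0. continuous (at_right t) (\<lambda>s. X s \<omega>)) \<and>
     (\<forall>\<omega>\<in>space M. \<forall>t>0. \<exists>l. ((\<lambda>s. X s \<omega>) \<longlongrightarrow> l) (at_left t)) \<and>
     (\<forall>s\<ge>0. \<forall>t\<ge>0. distr M borel (\<lambda>\<omega>. X (s + t) \<omega> - X s \<omega>) = distr M borel (X t)) \<and>
     (\<forall>(k::nat) (\<tau>::nat \<Rightarrow> real). 0 \<le> \<tau> 0 \<and> (\<forall>i<k. \<tau> i \<le> \<tau> (Suc i)) \<longrightarrow>
        prob_space.indep_vars M (\<lambda>_. borel) (\<lambda>i \<omega>. X (\<tau> (Suc i)) \<omega> - X (\<tau> i) \<omega>) {..<k})"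

(* Nonnegativity follows from monotonicity of the paths and X 0 = 0. *)
definition stable_subordinator ::
  "'a measure \<Rightarrow> real \<Rightarrow> (real \<Rightarrow> 'a \<Rightarrow> real) \<Rightarrow> bool" where
  "stable_subordinator M \<nu> X \<longleftrightarrow>
     levy_process M X \<and>
     (\<forall>\<omega>\<in>space M. mono_on {0..} (\<lambda>t. X t \<omega>)) \<and>
     (\<forall>t>0. \<forall>\<mu>>0. (\<integral>\<omega>. exp (- \<mu> * X t \<omega>) \<partial>M) = exp (- t * \<mu> powr \<nu>))"

definition isotropic_stable_process ::
  "'a measure \<Rightarrow> real \<Rightarrow> (real \<Rightarrow> 'a \<Rightarrow> real ^ 'n) \<Rightarrow> bool" where
  "isotropic_stable_process M \<alpha> S \<longleftrightarrow>
     levy_process M S \<and>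
     (\<forall>t>0. \<forall>\<xi>. (\<integral>\<omega>. iexp (\<xi> \<bullet> S t \<omega>) \<partial>M) = of_real (exp (- t * norm \<xi> powr \<alpha>)))"

(* The normalisation has generator \<Delta>: each coordinate has variance 2t. *)
definition brownian_motion ::
  "'a measure \<Rightarrow> (real \<Rightarrow> 'a \<Rightarrow> real ^ 'n) \<Rightarrow> bool" where
  "brownian_motion M B \<longleftrightarrow>
     levy_process M B \<and>
     (\<forall>t>0. \<forall>\<xi>. (\<integral>\<omega>. iexp (\<xi> \<bullet> B t \<omega>) \<partial>M) = of_real (exp (- t * (norm \<xi>)\<^sup>2)))"

definition sample_path :: "real set \<Rightarrow> (real \<Rightarrow> 'a \<Rightarrow> 'b) \<Rightarrow> 'a \<Rightarrow> real \<Rightarrow> 'b" where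
  "sample_path T X \<omega> = (\<lambda>t\<in>T. X t \<omega>)"

(* The library's indep_var needs both variables to have the same value type, hence the detour
   through the generated sigma-algebras. *)
definition process_events ::
  "'a measure \<Rightarrow> real set \<Rightarrow> (real \<Rightarrow> 'a \<Rightarrow> 'b::topological_space) \<Rightarrow> 'a set set" where
  "process_events M T X =
     sets (vimage_algebra (space M) (sample_path T X) (PiM T (\<lambda>_. borel)))"

definition independent_processes ::
  "'a measure \<Rightarrow> (real \<Rightarrow> 'a \<Rightarrow> 'b::topological_space) \<Rightarrow>
     (real \<Rightarrow> 'a \<Rightarrow> 'c::topological_space) \<Rightarrow> bool" where
  "independent_processes M X Y \<longleftrightarrow>
     prob_space.indep_set M (process_events M {0<..} X) (process_events M {0<..} Y)"

(* X\<^sub>1 (X\<^sub>2 ( ... X\<^sub>r (t) ... )), with X\<^sub>r innermost. *)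
primrec iterated_process ::
  "(nat \<Rightarrow> real \<Rightarrow> 'a \<Rightarrow> real) \<Rightarrow> nat \<Rightarrow> real \<Rightarrow> 'a \<Rightarrow> real" where
  "iterated_process X 0 t \<omega> = t"
| "iterated_process X (Suc r) t \<omega> = iterated_process X r (X (Suc r) t \<omega>) \<omega>"

(* H k j is the k-th subordinator in the j-th summand, a j the scale of that summand.  If the
   H k j are independent stable subordinators of order \<nu> j, the j-th summand has Laplace
   exponent (a j * \<mu>)^(\<nu> j ^ r); a Laplace exponent \<Sum>j. \<lambda> j * \<mu>^(\<nu> j ^ r) therefore requires
   a j = \<lambda> j^(1 / \<nu> j ^ r). *)
definition mixed_subordinator ::
  "(nat \<Rightarrow> real) \<Rightarrow> nat \<Rightarrow> nat \<Rightarrow> (nat \<Rightarrow> nat \<Rightarrow> real \<Rightarrow> 'a \<Rightarrow> real)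
     \<Rightarrow> real \<Rightarrow> 'a \<Rightarrow> real" where
  "mixed_subordinator a m r H t \<omega> =
     (\<Sum>j=1..m. a j * iterated_process (\<lambda>k. H k j) r t \<omega>)"

(* For the subordinators considered here the infimum is over a nonempty set for almost every
   \<omega>; on the exceptional null event the value 0 keeps the process nonnegative. *)
definition inverse_process :: "(real \<Rightarrow> 'a \<Rightarrow> real) \<Rightarrow> real \<Rightarrow> 'a \<Rightarrow> real" where
  "inverse_process Y t \<omega> =
     (if \<exists>s>0. Y s \<omega> \<ge> t then Inf {s. s > 0 \<and> Y s \<omega> \<ge> t} else 0)"

definition density_of_process ::
  "'a measure \<Rightarrow> (real \<Rightarrow> 'a \<Rightarrow> real ^ 'n) \<Rightarrow> (real ^ 'n \<Rightarrow> real \<Rightarrow> real) \<Rightarrow> bool" where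
  "density_of_process M X p \<longleftrightarrow>
     (\<forall>t>0. (\<forall>x. 0 \<le> p x t) \<and> distributed M lborel (X t) (\<lambda>x. ennreal (p x t)))"

definition fourier :: "(real ^ 'n \<Rightarrow> real) \<Rightarrow> real ^ 'n \<Rightarrow> complex" where
  "fourier u \<xi> = (\<integral>x. iexp (\<xi> \<bullet> x) * of_real (u x) \<partial>lborel)"

definition fourier_delta :: "real ^ 'n \<Rightarrow> complex" where
  "fourier_delta \<xi> = (\<integral>x. iexp (\<xi> \<bullet> x) \<partial>return borel 0)"

(* Fourier transform in x of a function w on R^n x (0, oo) with initial datum the Dirac
   delta at time 0. *)
definition fourier_delta_initial ::
  "(real ^ 'n \<Rightarrow> real \<Rightarrow> real) \<Rightarrow> real ^ 'n \<Rightarrow> real \<Rightarrow> complex" where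
  "fourier_delta_initial w \<xi> t = (if t = 0 then fourier_delta \<xi> else fourier (\<lambda>x. w x t) \<xi>)"

definition laplace :: "(real \<Rightarrow> complex) \<Rightarrow> real \<Rightarrow> complex" where
  "laplace f \<mu> = (LINT t:{0<..}|lborel. of_real (exp (- \<mu> * t)) * f t)"

(* Laplace transform of the Dzerbayshan-Caputo derivative of order \<nu> \<in> (0,1] of f. *)
definition laplace_caputo :: "real \<Rightarrow> (real \<Rightarrow> complex) \<Rightarrow> real \<Rightarrow> complex" where
  "laplace_caputo \<nu> f \<mu> =
     of_real (\<mu> powr \<nu>) * laplace f \<mu> - of_real (\<mu> powr (\<nu> - 1)) * f 0"

(* Fourier multiplier of - (- \<Delta>)^\<beta>. *)
definition frac_laplacian_symbol :: "real \<Rightarrow> real ^ 'n \<Rightarrow> real" where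
  "frac_laplacian_symbol \<beta> \<xi> = - (norm \<xi> powr (2 * \<beta>))"

(* w solves  sum_j lam_j D_t^(ord_j) w = - c^2 (- \<Delta>)^\<beta> w,  w(x, 0) = delta(x),
   understood through the Fourier transform in x and the Laplace transform in t.  The initial
   condition is attained in the sense that each Fourier mode is continuous up to t = 0. *)
definition solves_fractional_problem ::
  "nat \<Rightarrow> (nat \<Rightarrow> real) \<Rightarrow> (nat \<Rightarrow> real) \<Rightarrow> real \<Rightarrow> real \<Rightarrow>
     (real ^ 'n \<Rightarrow> real \<Rightarrow> real) \<Rightarrow> bool" where
  "solves_fractional_problem m lam ord \<beta> c w \<longleftrightarrow>
     (\<forall>t>0. integrable lborel (\<lambda>x. w x t)) \<and>
     (\<forall>\<xi>. continuous_on {0..} (fourier_delta_initial w \<xi>)) \<and>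
     (\<forall>\<xi>. \<forall>\<mu>>0.
        set_integrable lborel {0<..}
          (\<lambda>t. of_real (exp (- \<mu> * t)) * fourier_delta_initial w \<xi> t) \<and>
        (\<Sum>j=1..m. of_real (lam j) * laplace_caputo (ord j) (fourier_delta_initial w \<xi>) \<mu>)
          = of_real (c\<^sup>2 * frac_laplacian_symbol \<beta> \<xi>)
              * laplace (fourier_delta_initial w \<xi>) \<mu>)"

end

theory Submission
  imports Defs
begin

text \<open>
  Conditioning on the time change gives
  $E\,e^{i \xi \cdot W(t)} = E\,e^{-\kappa L(t)}$ with $\kappa = c^2 \|\xi\|^{2\beta}$. Since
  $s < L(t)$ holds if and only if $Y(s) < t$, up to one value of $s$, where $Y$ is the mixed
  subordinator with Laplace exponent $\Psi(\mu) = \sum_j \lambda_j \mu^{\nu_j^r}$, one has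
  $1 - e^{-\kappa L(t)} = \int_0^\infty \kappa e^{-\kappa s} 1_{Y(s) < t}\,ds$, and Tonelli's theorem
  yields the Laplace transform $\Psi / (\mu (\kappa + \Psi))$ of $t \mapsto E\,e^{-\kappa L(t)}$. This is
  the only solution of the transformed equation, so uniqueness reduces to Lerch's theorem in $t$
  and injectivity of the Fourier transform in $x$. The law of $W(t)$ has a density because on
  $\{c^2 L(t) > d\}$ its characteristic function is bounded by $e^{-d \|\xi\|^{2\beta}}$, which
  is integrable, and $L(t) > 0$ almost surely. Compositions with random times are handled by
  approximating the time from the right on a grid.
\<close>

section \<open>Fourier transforms of finite measures\<close>

text \<open>The characteristic function of W(t) need not be integrable: for a single order below 1
  it decays only like a constant times \<open>norm \<xi> powr (- 2 * \<beta>)\<close>. Discarding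
  the paths with small L(t) restores rapid decay but leaves a mass below 1, which is why the Fourier
  part treats finite measures and not only probability laws. Strict monotonicity of Y matters
  because a flat stretch of Y is a jump of L. It makes the Fourier modes continuous in t, which both
  the notion of solution and Lerch's theorem ask for. The integral formula is written for 1 -
  exp(-\<kappa> L) so that every integrand is nonnegative and the integrations over t, s and the
  sample space can be interchanged freely. Grid points lie strictly to the right of the random time
  for two reasons: paths are right-continuous, and independence of S and L is given at positive
  times only, so time 0 must never be a grid value.\<close>

text \<open>The known characteristic function of the standard normal law, rescaled: substituting
  \<open>\<sigma> * t\<close> turns the frequency \<open>y\<close> into \<open>y / \<sigma>\<close>.
  One factor \<open>sqrt (2 * pi)\<close> undoes the normalisation of the standard density, another
  creates that of \<open>normal_density 0 \<sigma>\<close>; together they give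
  \<open>2 * pi\<close>.\<close>

lemma normal_density_fourier:
  fixes y \<sigma> :: real
  assumes "\<sigma> > 0"
  shows "(\<integral>t. iexp (t * y) * of_real (exp (- (\<sigma>\<^sup>2 * t\<^sup>2) / 2)) \<partial>lborel)
           = of_real (2 * pi * normal_density 0 \<sigma> y)"
    and "integrable lborel (\<lambda>t. iexp (t * y) * of_real (exp (- (\<sigma>\<^sup>2 * t\<^sup>2) / 2)) :: complex)"
proof -
  let ?g = "\<lambda>x. iexp (y / \<sigma> * x) * of_real (std_normal_density x) :: complex"
  have int_std: "integrable lborel std_normal_density"
    by simp
  have int_g: "integrable lborel ?g"
    by (rule Bochner_Integration.integrable_bound[OF int_std]) (auto simp: norm_mult)
  have int_gs: "integrable lborel (\<lambda>t. ?g (0 + \<sigma> * t))"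
    using int_g assms by (subst lborel_integrable_real_affine_iff) auto
  have eq: "iexp (t * y) * of_real (exp (- (\<sigma>\<^sup>2 * t\<^sup>2) / 2)) = of_real (sqrt (2 * pi)) * ?g (0 + \<sigma> * t)" for t
    using assms by (simp add: normal_density_def power_mult_distrib mult_ac)
  show "integrable lborel (\<lambda>t. iexp (t * y) * of_real (exp (- (\<sigma>\<^sup>2 * t\<^sup>2) / 2)) :: complex)"
    unfolding eq by (intro integrable_mult_right int_gs)
  have "complex_of_real (exp (- (y / \<sigma>)\<^sup>2 / 2)) = char std_normal_distribution (y / \<sigma>)"
    by (simp add: char_std_normal_distribution)
  also have "\<dots> = (\<integral>x. ?g x \<partial>lborel)"
    unfolding char_def by (subst integral_density) (auto simp: scaleR_conv_of_real mult_ac)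
  also have "\<dots> = of_real \<sigma> * (\<integral>t. ?g (0 + \<sigma> * t) \<partial>lborel)"
    using assms by (subst lborel_integral_real_affine[where c=\<sigma> and t=0]) (auto simp: scaleR_conv_of_real)
  finally have *: "(\<integral>t. ?g (0 + \<sigma> * t) \<partial>lborel) = of_real (exp (- (y / \<sigma>)\<^sup>2 / 2)) / of_real \<sigma>"
    using assms by (simp add: field_simps)
  have "(\<integral>t. iexp (t * y) * of_real (exp (- (\<sigma>\<^sup>2 * t\<^sup>2) / 2)) \<partial>lborel)
      = of_real (sqrt (2 * pi)) * (\<integral>t. ?g (0 + \<sigma> * t) \<partial>lborel)"
    unfolding eq by simp
  also have "\<dots> = of_real (sqrt (2 * pi) * (exp (- (y / \<sigma>)\<^sup>2 / 2) / \<sigma>))"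
    unfolding * by simp
  also have "sqrt (2 * pi) * (exp (- (y / \<sigma>)\<^sup>2 / 2) / \<sigma>) = 2 * pi * normal_density 0 \<sigma> y"
    using assms by (simp add: normal_density_def real_sqrt_mult power_divide field_simps)
  finally show "(\<integral>t. iexp (t * y) * of_real (exp (- (\<sigma>\<^sup>2 * t\<^sup>2) / 2)) \<partial>lborel)
           = of_real (2 * pi * normal_density 0 \<sigma> y)" .
qed

text \<open>Fubini in coordinates: \<open>lborel\<close> is the image of the product of
  one-dimensional Lebesgue measures under the map from coordinates to vectors, so integrals of
  products factor over \<open>Basis\<close>.\<close>

lemma
  fixes f :: "'a::euclidean_space \<Rightarrow> real \<Rightarrow> 'b::{real_normed_field, banach, second_countable_topology}"
  assumes f: "\<And>b. b \<in> Basis \<Longrightarrow> integrable lborel (f b)"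
  shows integrable_lborel_prod: "integrable lborel (\<lambda>x. \<Prod>b\<in>Basis. f b (x \<bullet> b))"
    and integral_lborel_prod:
      "(\<integral>x. (\<Prod>b\<in>Basis. f b (x \<bullet> b)) \<partial>lborel) = (\<Prod>b\<in>Basis. \<integral>x. f b x \<partial>lborel)"
proof -
  interpret product_sigma_finite "\<lambda>_::'a. lborel :: real measure"
    by standard
  have [measurable]: "b \<in> Basis \<Longrightarrow> f b \<in> borel_measurable borel" for b
    using borel_measurable_integrable[OF f[of b]] by simp
  have eq: "(\<Prod>b\<in>Basis. f b ((\<Sum>b'\<in>Basis. z b' *\<^sub>R b') \<bullet> b)) = (\<Prod>b\<in>Basis. f b (z b))" for z
    by (intro prod.cong) simp_all
  show "integrable lborel (\<lambda>x. \<Prod>b\<in>Basis. f b (x \<bullet> b))"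
    by (subst lborel_eq, subst integrable_distr_eq)
       (auto simp: eq intro!: product_integrable_prod f)
  show "(\<integral>x. (\<Prod>b\<in>Basis. f b (x \<bullet> b)) \<partial>lborel) = (\<Prod>b\<in>Basis. \<integral>x. f b x \<partial>lborel)"
    by (subst lborel_eq, subst integral_distr)
       (auto simp: eq intro!: product_integral_prod f)
qed

text \<open>The density of the centred normal law with covariance \<open>\<sigma>\<^sup>2\<close>
  times the identity. The product form reduces its integral and its Fourier transform to dimension
  one.\<close>

definition gauss_kernel :: "real \<Rightarrow> 'a::euclidean_space \<Rightarrow> real" where
  "gauss_kernel \<sigma> x = (\<Prod>b\<in>Basis. normal_density 0 \<sigma> (x \<bullet> b))"

lemma gauss_kernel_measurable [measurable]: "gauss_kernel \<sigma> \<in> borel_measurable borel"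
  unfolding gauss_kernel_def by measurable

lemma gauss_kernel_nonneg [simp]: "0 \<le> gauss_kernel \<sigma> x"
  unfolding gauss_kernel_def by (intro prod_nonneg) auto

lemma
  fixes \<sigma> :: real
  assumes "\<sigma> > 0"
  shows integrable_gauss_kernel: "integrable lborel (gauss_kernel \<sigma> :: 'a::euclidean_space \<Rightarrow> real)"
    and integral_gauss_kernel: "(\<integral>x. gauss_kernel \<sigma> (x::'a) \<partial>lborel) = 1"
proof -
  show "integrable lborel (gauss_kernel \<sigma> :: 'a \<Rightarrow> real)"
    unfolding gauss_kernel_def using assms by (intro integrable_lborel_prod) auto
  show "(\<integral>x. gauss_kernel \<sigma> (x::'a) \<partial>lborel) = 1"
    unfolding gauss_kernel_def using assms by (subst integral_lborel_prod) auto
qed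

lemma gauss_kernel_minus [simp]: "gauss_kernel \<sigma> (- x) = gauss_kernel \<sigma> x"
  unfolding gauss_kernel_def normal_density_def by simp

text \<open>The Jacobian identity behind writing a kernel of width \<open>\<sigma>\<close> as a
  standard Gaussian displacement multiplied by \<open>\<sigma>\<close>.\<close>

lemma gauss_kernel_scale:
  fixes x :: "'a::euclidean_space"
  assumes "\<sigma> > 0"
  shows "\<sigma> ^ DIM('a) * gauss_kernel \<sigma> (\<sigma> *\<^sub>R x) = gauss_kernel 1 x"
proof -
  have "\<sigma> * normal_density 0 \<sigma> (\<sigma> * t) = normal_density 0 1 t" for t
    using assms by (simp add: normal_density_def real_sqrt_mult power_mult_distrib)
  then have "(\<Prod>b\<in>(Basis::'a set). \<sigma> * normal_density 0 \<sigma> (\<sigma> * (x \<bullet> b))) = gauss_kernel 1 x"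
    unfolding gauss_kernel_def by simp
  then show ?thesis
    by (simp add: gauss_kernel_def prod.distrib)
qed

lemma
  fixes x :: "'a::euclidean_space"
  assumes "\<sigma> > 0"
  shows gauss_kernel_fourier:
      "(\<integral>\<xi>. iexp (\<xi> \<bullet> x) * of_real (exp (- (\<sigma>\<^sup>2 * (norm \<xi>)\<^sup>2) / 2)) \<partial>lborel)
         = of_real ((2 * pi) ^ DIM('a) * gauss_kernel \<sigma> x)"
    and integrable_gauss_fourier:
      "integrable lborel (\<lambda>\<xi>. iexp (\<xi> \<bullet> x) * of_real (exp (- (\<sigma>\<^sup>2 * (norm \<xi>)\<^sup>2) / 2)) :: complex)"
proof -
  let ?f = "\<lambda>b t. iexp (t * (x \<bullet> b)) * of_real (exp (- (\<sigma>\<^sup>2 * t\<^sup>2) / 2)) :: complex"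
  have eq: "iexp (\<xi> \<bullet> x) * of_real (exp (- (\<sigma>\<^sup>2 * (norm \<xi>)\<^sup>2) / 2)) = (\<Prod>b\<in>Basis. ?f b (\<xi> \<bullet> b))" for \<xi> :: 'a
  proof -
    have "(norm \<xi>)\<^sup>2 = (\<Sum>b\<in>Basis. (\<xi> \<bullet> b)\<^sup>2)"
      unfolding power2_norm_eq_inner by (subst euclidean_inner) (simp add: power2_eq_square)
    then have "- (\<sigma>\<^sup>2 * (norm \<xi>)\<^sup>2) / 2 = (\<Sum>b\<in>Basis. - (\<sigma>\<^sup>2 * (\<xi> \<bullet> b)\<^sup>2) / 2)"
      by (simp add: sum_distrib_left sum_negf sum_divide_distrib)
    then have "exp (- (\<sigma>\<^sup>2 * (norm \<xi>)\<^sup>2) / 2) = (\<Prod>b\<in>Basis. exp (- (\<sigma>\<^sup>2 * (\<xi> \<bullet> b)\<^sup>2) / 2))"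
      by (simp only: exp_sum finite_Basis)
    moreover have "iexp (\<xi> \<bullet> x) = (\<Prod>b\<in>Basis. iexp ((\<xi> \<bullet> b) * (x \<bullet> b)))"
      by (simp add: euclidean_inner[of \<xi> x] sum_distrib_left exp_sum)
    ultimately show ?thesis
      by (simp only: prod.distrib of_real_prod)
  qed
  show "integrable lborel (\<lambda>\<xi>. iexp (\<xi> \<bullet> x) * of_real (exp (- (\<sigma>\<^sup>2 * (norm \<xi>)\<^sup>2) / 2)) :: complex)"
    unfolding eq by (intro integrable_lborel_prod normal_density_fourier assms)
  show "(\<integral>\<xi>. iexp (\<xi> \<bullet> x) * of_real (exp (- (\<sigma>\<^sup>2 * (norm \<xi>)\<^sup>2) / 2)) \<partial>lborel)
         = of_real ((2 * pi) ^ DIM('a) * gauss_kernel \<sigma> x)"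
  proof -
    have "(\<integral>\<xi>. (\<Prod>b\<in>Basis. ?f b (\<xi> \<bullet> b)) \<partial>lborel) = (\<Prod>b\<in>Basis. \<integral>t. ?f b t \<partial>lborel)"
      by (rule integral_lborel_prod) (rule normal_density_fourier[OF assms])
    also have "\<dots> = of_real (\<Prod>b\<in>(Basis :: 'a set). 2 * pi * normal_density 0 \<sigma> (x \<bullet> b))"
      by (simp only: normal_density_fourier[OF assms] of_real_prod)
    finally show ?thesis
      unfolding eq by (simp add: gauss_kernel_def prod.distrib)
  qed
qed

section \<open>Gaussian smoothing of finite measures\<close>

definition fourier_measure :: "'a::euclidean_space measure \<Rightarrow> 'a \<Rightarrow> complex" where
  "fourier_measure N \<xi> = (\<integral>x. iexp (\<xi> \<bullet> x) \<partial>N)"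

lemma fourier_measure_measurable:
  assumes "finite_measure N" and [measurable_cong]: "sets N = sets (borel :: 'a::euclidean_space measure)"
  shows "fourier_measure N \<in> borel_measurable borel"
proof -
  interpret finite_measure N by fact
  show ?thesis unfolding fourier_measure_def by measurable
qed

text \<open>Fourier inversion for the convolution of \<open>N\<close> with a Gaussian. The Gaussian
  factor makes the double integral absolutely convergent, so Fubini applies whether or not the
  transform of \<open>N\<close> is integrable. The smoothed density is thereby an explicit
  functional of \<open>fourier_measure N\<close>.\<close>

lemma gauss_smoothing:
  fixes N :: "'a::euclidean_space measure"
  assumes N: "finite_measure N" and sets_N [measurable_cong]: "sets N = sets borel"
    and \<sigma>: "\<sigma> > 0"
  shows "of_real ((2 * pi) ^ DIM('a) * (\<integral>y. gauss_kernel \<sigma> (y - x) \<partial>N))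
           = (\<integral>\<xi>. iexp (- (\<xi> \<bullet> x)) * of_real (exp (- (\<sigma>\<^sup>2 * (norm \<xi>)\<^sup>2) / 2)) * fourier_measure N \<xi> \<partial>lborel)"
proof -
  interpret finite_measure N by fact
  interpret pair_sigma_finite N lborel ..
  let ?f = "\<lambda>y \<xi>. iexp (\<xi> \<bullet> (y - x)) * of_real (exp (- (\<sigma>\<^sup>2 * (norm \<xi>)\<^sup>2) / 2)) :: complex"
  have [measurable]: "case_prod ?f \<in> borel_measurable (N \<Otimes>\<^sub>M lborel)"
    by measurable
  have int: "integrable (N \<Otimes>\<^sub>M lborel) (case_prod ?f)"
    by (rule Fubini_integrable)
       (auto simp: norm_mult integrable_gauss_fourier[OF \<sigma>, simplified])
  have "complex_of_real ((2 * pi) ^ DIM('a) * (\<integral>y. gauss_kernel \<sigma> (y - x) \<partial>N))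
      = (\<integral>y. of_real ((2 * pi) ^ DIM('a) * gauss_kernel \<sigma> (y - x)) \<partial>N)"
    by (subst integral_mult_right_zero[symmetric]) (rule integral_complex_of_real[symmetric])
  also have "\<dots> = (\<integral>y. (\<integral>\<xi>. ?f y \<xi> \<partial>lborel) \<partial>N)"
    by (simp only: gauss_kernel_fourier[OF \<sigma>])
  also have "\<dots> = (\<integral>\<xi>. (\<integral>y. ?f y \<xi> \<partial>N) \<partial>lborel)"
    by (rule Fubini_integral[OF int, symmetric])
  also have "\<dots> = (\<integral>\<xi>. iexp (- (\<xi> \<bullet> x)) * of_real (exp (- (\<sigma>\<^sup>2 * (norm \<xi>)\<^sup>2) / 2)) * fourier_measure N \<xi> \<partial>lborel)"
  proof (intro Bochner_Integration.integral_cong refl)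
    fix \<xi>
    have "?f y \<xi> = (iexp (- (\<xi> \<bullet> x)) * of_real (exp (- (\<sigma>\<^sup>2 * (norm \<xi>)\<^sup>2) / 2))) * iexp (\<xi> \<bullet> y)" for y
      by (simp add: inner_diff_right exp_diff exp_minus field_simps)
    then show "(\<integral>y. ?f y \<xi> \<partial>N) = iexp (- (\<xi> \<bullet> x)) * of_real (exp (- (\<sigma>\<^sup>2 * (norm \<xi>)\<^sup>2) / 2)) * fourier_measure N \<xi>"
      unfolding fourier_measure_def by simp
  qed
  finally show ?thesis .
qed

lemma nn_integral_lborel_affine:
  fixes t :: "'a::euclidean_space"
  assumes "c > 0" and [measurable]: "f \<in> borel_measurable borel"
  shows "(\<integral>\<^sup>+x. f x \<partial>lborel) = (\<integral>\<^sup>+x. ennreal (c ^ DIM('a)) * f (t + c *\<^sub>R x) \<partial>lborel)"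
  using assms(1)
  by (subst lborel_affine[of c t])
     (auto simp: nn_integral_density nn_integral_distr)

text \<open>The smoothed density belongs to the image of the product of \<open>N\<close> with a
  standard Gaussian under \<open>(y, z) \<mapsto> y + \<sigma> z\<close>. In this form
  \<open>\<sigma>\<close> sits in the integrand and no longer in the measure, which is what a limit
  theorem wants.\<close>

lemma nn_integral_gauss_smoothing:
  fixes N :: "'a::euclidean_space measure"
  assumes N: "finite_measure N" and sets_N [measurable_cong]: "sets N = sets borel"
    and \<sigma>: "\<sigma> > 0" and [measurable]: "h \<in> borel_measurable borel"
  shows "(\<integral>\<^sup>+p. h (fst p + \<sigma> *\<^sub>R snd p) \<partial>(N \<Otimes>\<^sub>M density lborel (gauss_kernel 1)))
           = (\<integral>\<^sup>+x. h x * ennreal (\<integral>y. gauss_kernel \<sigma> (y - x) \<partial>N) \<partial>lborel)"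
proof -
  interpret finite_measure N by fact
  interpret pair_sigma_finite N lborel ..
  have fin: "finite_measure (density lborel (gauss_kernel 1 :: 'a \<Rightarrow> real))"
  proof (rule finite_measureI)
    have "emeasure (density lborel (gauss_kernel 1 :: 'a \<Rightarrow> real)) UNIV = ennreal 1"
      by (subst emeasure_density)
         (auto simp: nn_integral_eq_integral integrable_gauss_kernel integral_gauss_kernel)
    then show "emeasure (density lborel (gauss_kernel 1 :: 'a \<Rightarrow> real))
       (space (density lborel (gauss_kernel 1))) \<noteq> \<infinity>" by simp
  qed
  interpret G: finite_measure "density lborel (gauss_kernel 1 :: 'a \<Rightarrow> real)" by (rule fin)
  have bound: "gauss_kernel \<sigma> x \<le> normal_density 0 \<sigma> 0 ^ DIM('a)" for x :: 'a
  proof -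
    have "gauss_kernel \<sigma> x \<le> (\<Prod>b\<in>(Basis :: 'a set). normal_density 0 \<sigma> 0)"
      unfolding gauss_kernel_def
      by (intro prod_mono) (auto simp: normal_density_def divide_right_mono)
    then show ?thesis by simp
  qed
  have int: "integrable N (\<lambda>y. gauss_kernel \<sigma> (y - x))" for x
    by (rule integrable_const_bound[where B="normal_density 0 \<sigma> 0 ^ DIM('a)"]) (use bound in auto)
  have "(\<integral>\<^sup>+p. h (fst p + \<sigma> *\<^sub>R snd p) \<partial>(N \<Otimes>\<^sub>M density lborel (gauss_kernel 1)))
      = (\<integral>\<^sup>+y. (\<integral>\<^sup>+z. ennreal (gauss_kernel 1 z) * h (y + \<sigma> *\<^sub>R z) \<partial>lborel) \<partial>N)"
    by (subst G.nn_integral_fst[symmetric]) (auto simp: nn_integral_density)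
  also have "\<dots> = (\<integral>\<^sup>+y. (\<integral>\<^sup>+x. h x * ennreal (gauss_kernel \<sigma> (y - x)) \<partial>lborel) \<partial>N)"
  proof (rule nn_integral_cong)
    fix y :: 'a
    have "(\<integral>\<^sup>+x. h x * ennreal (gauss_kernel \<sigma> (y - x)) \<partial>lborel)
        = (\<integral>\<^sup>+z. ennreal (\<sigma> ^ DIM('a)) * (h (y + \<sigma> *\<^sub>R z) * ennreal (gauss_kernel \<sigma> (\<sigma> *\<^sub>R z))) \<partial>lborel)"
      by (subst nn_integral_lborel_affine[OF \<sigma>, where t=y])
         auto
    also have "\<dots> = (\<integral>\<^sup>+z. ennreal (gauss_kernel 1 z) * h (y + \<sigma> *\<^sub>R z) \<partial>lborel)"
      using \<sigma> by (intro nn_integral_cong) (simp add: gauss_kernel_scale[OF \<sigma>, symmetric] ennreal_mult mult_ac)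
    finally show "(\<integral>\<^sup>+z. ennreal (gauss_kernel 1 z) * h (y + \<sigma> *\<^sub>R z) \<partial>lborel)
        = (\<integral>\<^sup>+x. h x * ennreal (gauss_kernel \<sigma> (y - x)) \<partial>lborel)" by simp
  qed
  also have "\<dots> = (\<integral>\<^sup>+x. (\<integral>\<^sup>+y. h x * ennreal (gauss_kernel \<sigma> (y - x)) \<partial>N) \<partial>lborel)"
    by (rule Fubini'[symmetric]) measurable
  also have "\<dots> = (\<integral>\<^sup>+x. h x * ennreal (\<integral>y. gauss_kernel \<sigma> (y - x) \<partial>N) \<partial>lborel)"
    by (intro nn_integral_cong) (auto simp: nn_integral_cmult nn_integral_eq_integral int)
  finally show ?thesis .
qed

text \<open>Dominated convergence on one fixed product measure, as the displacement
  \<open>(1 / Suc i) *\<^sub>R z\<close> tends to 0. Negative values of \<open>h\<close> are cut to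
  0 by \<open>ennreal\<close>, so the constant 1 dominates.\<close>

lemma gauss_smoothing_tendsto:
  fixes N :: "'a::euclidean_space measure" and h :: "'a \<Rightarrow> real"
  assumes N: "finite_measure N" and sets_N [measurable_cong]: "sets N = sets borel"
    and h: "continuous_on UNIV h" "\<And>x. h x \<le> 1"
  shows "(\<lambda>i. \<integral>\<^sup>+x. ennreal (h x) * ennreal (\<integral>y. gauss_kernel (1 / Suc i) (y - x) \<partial>N) \<partial>lborel)
           \<longlonglongrightarrow> (\<integral>\<^sup>+x. ennreal (h x) \<partial>N)"
proof -
  interpret finite_measure N by fact
  let ?G = "density lborel (gauss_kernel 1 :: 'a \<Rightarrow> real)"
  have G1: "emeasure ?G UNIV = 1"
    by (subst emeasure_density)
       (auto simp: nn_integral_eq_integral integrable_gauss_kernel integral_gauss_kernel)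
  interpret G: prob_space ?G
    by (rule prob_spaceI) (simp add: G1)
  interpret P: pair_sigma_finite N ?G ..
  have [measurable]: "h \<in> borel_measurable borel"
    using h(1) by (rule borel_measurable_continuous_onI)
  have "(\<lambda>i. \<integral>\<^sup>+p. ennreal (h (fst p + (1 / Suc i) *\<^sub>R snd p)) \<partial>(N \<Otimes>\<^sub>M ?G))
      \<longlonglongrightarrow> (\<integral>\<^sup>+p. ennreal (h (fst p)) \<partial>(N \<Otimes>\<^sub>M ?G))"
  proof (rule nn_integral_dominated_convergence[where w="\<lambda>_. 1"])
    have "(\<lambda>i. h (fst p + (1 / Suc i) *\<^sub>R snd p)) \<longlonglongrightarrow> h (fst p)" for p :: "'a \<times> 'a"
    proof -
      have "(\<lambda>i. fst p + (1 / Suc i) *\<^sub>R snd p) \<longlonglongrightarrow> fst p + 0 *\<^sub>R snd p"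
        by (intro tendsto_intros LIMSEQ_Suc[OF lim_1_over_n])
      then show ?thesis
        using h(1) by (intro isCont_tendsto_compose[of "fst p" h]) (auto simp: continuous_on_eq_continuous_at)
    qed
    then show "AE p in N \<Otimes>\<^sub>M ?G. (\<lambda>i. ennreal (h (fst p + (1 / Suc i) *\<^sub>R snd p))) \<longlonglongrightarrow> ennreal (h (fst p))"
      by (intro AE_I2 tendsto_ennrealI)
    have "emeasure (N \<Otimes>\<^sub>M ?G) (space (N \<Otimes>\<^sub>M ?G)) = emeasure N (space N) * emeasure ?G (space ?G)"
      by (subst space_pair_measure) (intro G.emeasure_pair_measure_Times sets.top)
    then show "(\<integral>\<^sup>+p. 1 \<partial>(N \<Otimes>\<^sub>M ?G)) < \<infinity>"
      using G1 by (simp add: less_top[symmetric])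
  qed (auto simp: h(2))
  moreover have "(\<integral>\<^sup>+p. ennreal (h (fst p)) \<partial>(N \<Otimes>\<^sub>M ?G)) = (\<integral>\<^sup>+x. ennreal (h x) \<partial>N)"
    by (subst G.nn_integral_fst[symmetric]) (auto simp: G1)
  ultimately show ?thesis
    by (subst (asm) nn_integral_gauss_smoothing[OF N sets_N]) auto
qed

lemma open_indicator_approx:
  fixes U :: "'a::euclidean_space set"
  assumes "open U"
  obtains h :: "nat \<Rightarrow> 'a \<Rightarrow> real" where
    "\<And>k. continuous_on UNIV (h k)" "\<And>k x. 0 \<le> h k x" "\<And>k x. h k x \<le> indicator U x"
    "\<And>x. (\<lambda>k. h k x) \<longlonglongrightarrow> indicator U x"
\<comment> \<open>\<open>infdist\<close> to the empty set is 0 by convention, so the distance to the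
  complement would give the limit 0 instead of 1 here.\<close>
proof (cases "U = UNIV")
  case True
  then show ?thesis
    by (intro that[of "\<lambda>_ _. 1"]) auto
next
  case False
  show ?thesis
  proof (rule that[of "\<lambda>k x. min 1 (real k * infdist x (- U))"])
    show "min 1 (real k * infdist x (- U)) \<le> indicator U x" for k x
      by (cases "x \<in> U") auto
    show "(\<lambda>k. min 1 (real k * infdist x (- U))) \<longlonglongrightarrow> indicator U x" for x
    proof (cases "x \<in> U")
      case True
      have "closed (- U)" "- U \<noteq> {}"
        using assms False by auto
      then have pos: "infdist x (- U) > 0"
        using True by (metis ComplD in_closed_iff_infdist_zero infdist_nonneg less_eq_real_def)
      obtain n where n: "1 / infdist x (- U) < real n"
        using reals_Archimedean2 by blast
      have "\<forall>\<^sub>F k in sequentially. min 1 (real k * infdist x (- U)) = 1"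
        using eventually_ge_at_top[of n]
      proof eventually_elim
        case (elim k)
        then have "1 / infdist x (- U) < real k" using n by simp
        then show ?case using pos by (simp add: field_simps)
      qed
      then show ?thesis
        using True by (simp add: tendsto_eventually)
    qed simp
  qed (auto intro!: continuous_intros infdist_nonneg mult_nonneg_nonneg)
qed

section \<open>Uniqueness and absolute continuity from the Fourier transform\<close>

text \<open>By \<open>gauss_smoothing\<close> equal transforms force equal smoothed densities at
  every width. Shrinking the width identifies the integrals of continuous functions bounded by 1;
  these approximate indicators of open sets, which form an intersection-stable generator of the
  Borel sets.\<close>

theorem finite_measure_eqI_fourier:
  fixes N1 N2 :: "'a::euclidean_space measure"
  assumes fin: "finite_measure N1" "finite_measure N2"
    and sets: "sets N1 = sets borel" "sets N2 = sets borel"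
    and eq: "\<And>\<xi>. fourier_measure N1 \<xi> = fourier_measure N2 \<xi>"
  shows "N1 = N2"
proof -
  interpret N1: finite_measure N1 by fact
  interpret N2: finite_measure N2 by fact
  note [measurable_cong] = sets
  have kernel_eq: "(\<integral>y. gauss_kernel \<sigma> (y - x) \<partial>N1) = (\<integral>y. gauss_kernel \<sigma> (y - x) \<partial>N2)" if "\<sigma> > 0" for \<sigma> x
  proof -
    have "complex_of_real ((2 * pi) ^ DIM('a) * (\<integral>y. gauss_kernel \<sigma> (y - x) \<partial>N1))
        = of_real ((2 * pi) ^ DIM('a) * (\<integral>y. gauss_kernel \<sigma> (y - x) \<partial>N2))"
      by (simp only: gauss_smoothing[OF fin(1) sets(1) that] gauss_smoothing[OF fin(2) sets(2) that] eq)
    then show ?thesis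
      by (simp only: of_real_eq_iff) simp
  qed
  have cont: "(\<integral>\<^sup>+x. ennreal (h x) \<partial>N1) = (\<integral>\<^sup>+x. ennreal (h x) \<partial>N2)"
    if h: "continuous_on UNIV h" "\<And>x. h x \<le> 1" for h
    by (rule LIMSEQ_unique[OF gauss_smoothing_tendsto[OF fin(1) sets(1) h]])
       (use gauss_smoothing_tendsto[OF fin(2) sets(2) h] kernel_eq in simp)
  have opens: "emeasure N1 U = emeasure N2 U" if U: "open U" for U
  proof -
    obtain h :: "nat \<Rightarrow> 'a \<Rightarrow> real" where h: "\<And>k. continuous_on UNIV (h k)" "\<And>k x. 0 \<le> h k x"
      "\<And>k x. h k x \<le> indicator U x" "\<And>x. (\<lambda>k. h k x) \<longlonglongrightarrow> indicator U x"
      using open_indicator_approx[OF U] by blast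
    have [measurable]: "h k \<in> borel_measurable borel" for k
      by (rule borel_measurable_continuous_onI) (rule h)
    have [measurable]: "U \<in> sets borel" using U by simp
    have h1: "h k x \<le> 1" for k x
      using order_trans[OF h(3)[of k x] indicator_le_1] .
    have lim: "(\<lambda>k. \<integral>\<^sup>+x. ennreal (h k x) \<partial>N) \<longlonglongrightarrow> emeasure N U"
      if "finite_measure N" and [measurable_cong]: "sets N = sets borel" for N
    proof -
      interpret finite_measure N by fact
      have "(\<lambda>k. \<integral>\<^sup>+x. ennreal (h k x) \<partial>N) \<longlonglongrightarrow> (\<integral>\<^sup>+x. ennreal (indicator U x) \<partial>N)"
        by (rule nn_integral_dominated_convergence[where w="\<lambda>_. 1"])
           (auto simp: h1 less_top[symmetric] intro!: tendsto_ennrealI h)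
      then show ?thesis
        by (simp add: ennreal_indicator)
    qed
    show ?thesis
      by (rule LIMSEQ_unique[OF lim[OF fin(1) sets(1)]])
         (use lim[OF fin(2) sets(2)] cont[OF h(1) h1] in simp)
  qed
  show ?thesis
  proof (rule measure_eqI_generator_eq[where \<Omega>=UNIV and E="Collect open" and A="\<lambda>_. UNIV"])
    show "Int_stable (Collect open :: 'a set set)"
      by (auto simp: Int_stable_def)
    show "sets N1 = sigma_sets UNIV (Collect open)" "sets N2 = sigma_sets UNIV (Collect open)"
      by (simp_all add: sets borel_def)
    show "emeasure N1 UNIV \<noteq> \<infinity>"
      using N1.emeasure_finite by simp
  qed (auto simp: opens)
qed

text \<open>Integrability of the transform bounds all smoothed densities by one constant
  \<open>K\<close>, independent of the width. The bound survives the limit as an inequality between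
  \<open>N\<close> and \<open>K\<close> times Lebesgue measure on open sets, and outer regularity
  carries it to null sets.\<close>

theorem absolutely_continuous_fourier:
  fixes N :: "'a::euclidean_space measure"
  assumes fin: "finite_measure N" and sets: "sets N = sets borel"
    and int: "integrable lborel (fourier_measure N)"
  shows "absolutely_continuous lborel N"
proof -
  interpret finite_measure N by fact
  note [measurable_cong] = sets
  define K where "K = (\<integral>\<xi>. norm (fourier_measure N \<xi>) \<partial>lborel) / (2 * pi) ^ DIM('a)"
  have K: "0 \<le> K"
    unfolding K_def by simp
  have kernel_le: "(\<integral>y. gauss_kernel \<sigma> (y - x) \<partial>N) \<le> K" if \<sigma>: "\<sigma> > 0" for \<sigma> x
  proof -
    have [measurable]: "fourier_measure N \<in> borel_measurable borel"
      by (rule fourier_measure_measurable[OF fin sets])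
    have "(2 * pi) ^ DIM('a) * (\<integral>y. gauss_kernel \<sigma> (y - x) \<partial>N)
        \<le> norm (complex_of_real ((2 * pi) ^ DIM('a) * (\<integral>y. gauss_kernel \<sigma> (y - x) \<partial>N)))"
      by (simp only: norm_of_real)
    also have "\<dots> \<le> (\<integral>\<xi>. norm (fourier_measure N \<xi>) \<partial>lborel)"
      unfolding gauss_smoothing[OF fin sets \<sigma>]
    proof (rule order_trans[OF integral_norm_bound], rule integral_mono)
      show "integrable lborel (\<lambda>\<xi>. norm (iexp (- (\<xi> \<bullet> x)) * of_real (exp (- (\<sigma>\<^sup>2 * (norm \<xi>)\<^sup>2) / 2)) * fourier_measure N \<xi>))"
        by (intro integrable_norm Bochner_Integration.integrable_bound[OF int])
           (auto simp: norm_mult intro!: mult_left_le_one_le)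
    qed (use int in \<open>auto simp: norm_mult intro!: mult_left_le_one_le\<close>)
    finally show ?thesis
      by (simp add: K_def field_simps)
  qed
  have opens: "emeasure N U \<le> ennreal K * emeasure lborel U" if U: "open U" for U
  proof -
    obtain h :: "nat \<Rightarrow> 'a \<Rightarrow> real" where h: "\<And>k. continuous_on UNIV (h k)" "\<And>k x. 0 \<le> h k x"
      "\<And>k x. h k x \<le> indicator U x" "\<And>x. (\<lambda>k. h k x) \<longlonglongrightarrow> indicator U x"
      using open_indicator_approx[OF U] by blast
    have [measurable]: "h k \<in> borel_measurable borel" for k
      by (rule borel_measurable_continuous_onI) (rule h)
    have [measurable]: "U \<in> sets borel" using U by simp
    have h1: "h k x \<le> 1" for k x
      using order_trans[OF h(3)[of k x] indicator_le_1] .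
    have "(\<lambda>k. \<integral>\<^sup>+x. ennreal (h k x) \<partial>N) \<longlonglongrightarrow> (\<integral>\<^sup>+x. ennreal (indicator U x) \<partial>N)"
      by (rule nn_integral_dominated_convergence[where w="\<lambda>_. 1"])
         (auto simp: h1 less_top[symmetric] intro!: tendsto_ennrealI h)
    then have lim: "(\<lambda>k. \<integral>\<^sup>+x. ennreal (h k x) \<partial>N) \<longlonglongrightarrow> emeasure N U"
      by (simp add: ennreal_indicator)
    have "(\<integral>\<^sup>+x. ennreal (h k x) \<partial>N) \<le> ennreal K * emeasure lborel U" for k
    proof (rule LIMSEQ_le_const2[OF gauss_smoothing_tendsto[OF fin sets h(1) h1]], intro exI allI impI)
      fix i :: nat
      have "(\<integral>\<^sup>+x. ennreal (h k x) * ennreal (\<integral>y. gauss_kernel (1 / Suc i) (y - x) \<partial>N) \<partial>lborel)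
          \<le> (\<integral>\<^sup>+x. ennreal K * indicator U x \<partial>lborel)"
      proof (intro nn_integral_mono)
        fix x
        have "ennreal (h k x) * ennreal (\<integral>y. gauss_kernel (1 / Suc i) (y - x) \<partial>N) \<le> ennreal (indicator U x) * ennreal K"
          by (intro mult_mono ennreal_leI h kernel_le) auto
        then show "ennreal (h k x) * ennreal (\<integral>y. gauss_kernel (1 / Suc i) (y - x) \<partial>N) \<le> ennreal K * indicator U x"
          by (simp add: ennreal_indicator mult.commute)
      qed
      also have "\<dots> = ennreal K * emeasure lborel U"
        by (simp add: nn_integral_cmult_indicator)
      finally show "(\<integral>\<^sup>+x. ennreal (h k x) * ennreal (\<integral>y. gauss_kernel (1 / Suc i) (y - x) \<partial>N) \<partial>lborel)
          \<le> ennreal K * emeasure lborel U" .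
    qed
    then show ?thesis
      by (intro LIMSEQ_le_const2[OF lim]) auto
  qed
  show ?thesis
    unfolding absolutely_continuous_def
  proof
    fix A :: "'a set" assume A: "A \<in> null_sets lborel"
    then have [measurable]: "A \<in> sets borel" by auto
    have "emeasure N A \<le> ennreal e" if e: "e > 0" for e
    proof -
      \<comment> \<open>Dividing by \<open>K + 1\<close> and not by \<open>K\<close> covers the case
        \<open>K = 0\<close> and still gives \<open>K * (e / (K + 1)) \<le> e\<close>.\<close>
      have "e / (K + 1) > 0" using e K by simp
      then obtain U where U: "open U" "A \<subseteq> U" "emeasure lborel (U - A) < e / (K + 1)"
        using outer_regular_lborel[of A "e / (K + 1)"] by auto
      have [measurable]: "U \<in> sets borel" using U by simp
      have "emeasure lborel U = emeasure lborel (U - A)"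
        using A by (intro emeasure_Diff_null_set[symmetric]) auto
      then have lU: "emeasure lborel U \<le> ennreal (e / (K + 1))"
        using U(3) by simp
      have "emeasure N A \<le> emeasure N U"
        using U by (intro emeasure_mono) (auto simp: sets)
      also have "\<dots> \<le> ennreal K * emeasure lborel U"
        by (rule opens) fact
      also have "\<dots> \<le> ennreal K * ennreal (e / (K + 1))"
        by (intro mult_left_mono lU) simp
      also have "\<dots> = ennreal (K * (e / (K + 1)))"
        using K e by (intro ennreal_mult[symmetric]) auto
      also have "\<dots> \<le> ennreal e"
        using K e by (intro ennreal_leI) (simp add: field_simps)
      finally show ?thesis .
    qed
    then have "emeasure N A \<le> 0"
      by (intro ennreal_le_epsilon[of 0]) (simp only: add_0)
    then have "emeasure N A = 0" by simp
    then show "A \<in> null_sets N"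
      by (auto simp: null_sets_def sets)
  qed
qed

section \<open>Integrability of stable characteristic functions\<close>

text \<open>The \<open>k\<close>-th power of the inequality \<open>y / k \<le> exp (y / k)\<close>
  shows that \<open>exp (- y)\<close> is at most \<open>(k / y) ^ k\<close>; with
  \<open>p * k \<ge> 2\<close> this is at most a multiple of \<open>1 / x\<^sup>2\<close> for
  \<open>\<bar>x\<bar> > 1\<close>. The summand 1 covers \<open>\<bar>x\<bar> \<le> 1\<close>, and
  the factor 2 pays for replacing \<open>x\<^sup>2\<close> by \<open>1 + x\<^sup>2\<close>.\<close>

lemma exp_minus_powr_le:
  fixes x a p :: real
  assumes a: "0 < a" and k: "2 \<le> p * real k" "1 \<le> k"
  shows "exp (- a * \<bar>x\<bar> powr p) \<le> 2 * ((real k / a) ^ k + 1) * inverse (1 + x\<^sup>2)"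
proof (cases "\<bar>x\<bar> \<le> 1")
  case True
  then have x1: "x\<^sup>2 \<le> 1" by (simp add: abs_square_le_1)
  have "exp (- a * \<bar>x\<bar> powr p) \<le> 1"
    using a by simp
  also have "\<dots> \<le> 2 * inverse (1 + x\<^sup>2)"
    using x1 by (simp add: field_simps add_pos_nonneg)
  also have "\<dots> \<le> 2 * inverse (1 + x\<^sup>2) * ((real k / a) ^ k + 1)"
    using mult_left_mono[of 1 "(real k / a) ^ k + 1" "2 * inverse (1 + x\<^sup>2)"] a by simp
  finally show ?thesis by (simp only: mult_ac)
next
  case False
  then have x: "1 < \<bar>x\<bar>" by simp
  define y where "y = a * \<bar>x\<bar> powr p"
  have y: "0 < y" using a x by (simp add: y_def)
  have "x\<^sup>2 = \<bar>x\<bar> powr 2" by simp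
  also have "\<dots> \<le> \<bar>x\<bar> powr (p * real k)"
    using x k by (intro powr_mono) auto
  also have "\<dots> = (\<bar>x\<bar> powr p) ^ k"
    using x by (simp add: powr_powr[symmetric] powr_realpow)
  finally have x2: "x\<^sup>2 \<le> (\<bar>x\<bar> powr p) ^ k" .
  have "(y / real k) ^ k \<le> exp (y / real k) ^ k"
  proof (rule power_mono)
    show "y / real k \<le> exp (y / real k)"
      using exp_ge_add_one_self[of "y / real k"] by linarith
  qed (use y in simp)
  also have "\<dots> = exp y"
    using k by (simp add: exp_of_nat_mult[symmetric])
  finally have "(y / real k) ^ k \<le> exp y" .
  moreover have "(a / real k) ^ k * x\<^sup>2 \<le> (a / real k) ^ k * (\<bar>x\<bar> powr p) ^ k"
    using a x2 by (intro mult_left_mono) auto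
  moreover have "(a / real k) ^ k * (\<bar>x\<bar> powr p) ^ k = (y / real k) ^ k"
    by (simp add: y_def power_mult_distrib power_divide)
  ultimately have le: "(a / real k) ^ k * x\<^sup>2 \<le> exp y" by simp
  have pos: "0 < (a / real k) ^ k * x\<^sup>2"
  proof (rule mult_pos_pos)
    show "0 < (a / real k) ^ k" using a k by simp
    show "0 < x\<^sup>2" using x by auto
  qed
  have "exp (- y) = inverse (exp y)"
    by (simp add: exp_minus)
  also have "\<dots> \<le> inverse ((a / real k) ^ k * x\<^sup>2)"
    by (rule le_imp_inverse_le[OF le pos])
  also have "\<dots> = (real k / a) ^ k * inverse (x\<^sup>2)"
    by (simp only: inverse_mult_distrib power_inverse[symmetric] inverse_divide)
  also have "\<dots> \<le> ((real k / a) ^ k + 1) * (2 * inverse (1 + x\<^sup>2))"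
  proof (rule mult_mono)
    have "1 < x\<^sup>2" using x by (metis abs_square_less_1 linorder_neqE_linordered_idom not_less_iff_gr_or_eq one_less_power power2_abs zero_less_numeral)
    then have "inverse (2 * x\<^sup>2) \<le> inverse (1 + x\<^sup>2)"
      by (intro le_imp_inverse_le) auto
    then show "inverse (x\<^sup>2) \<le> 2 * inverse (1 + x\<^sup>2)"
      unfolding inverse_mult_distrib by simp
  qed (use a in auto)
  finally show ?thesis
    by (simp add: y_def mult_ac del: distrib_left_numeral)
qed

lemma integrable_exp_abs_powr:
  fixes a p :: real
  assumes a: "0 < a" and p: "0 < p"
  shows "integrable lborel (\<lambda>x::real. exp (- a * \<bar>x\<bar> powr p))"
proof -
  obtain k0 :: nat where "2 / p \<le> real k0" using real_arch_simple by blast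
  then have k: "2 \<le> p * real (Suc k0)" "1 \<le> Suc k0"
    using p by (auto simp: field_simps intro: add_increasing)
  have "integrable lborel (\<lambda>x::real. inverse (1 + x\<^sup>2))"
    using integrable_inverse_1_plus_square by (simp add: set_integrable_def)
  then have "integrable lborel (\<lambda>x::real. 2 * ((real (Suc k0) / a) ^ Suc k0 + 1) * inverse (1 + x\<^sup>2))"
    by (rule integrable_mult_right)
  then show ?thesis
  proof (rule Bochner_Integration.integrable_bound)
    show "AE x in lborel. norm (exp (- a * \<bar>x\<bar> powr p)) \<le> norm (2 * ((real (Suc k0) / a) ^ Suc k0 + 1) * inverse (1 + x\<^sup>2))"
    proof (rule AE_I2)
      fix x :: real
      show "norm (exp (- a * \<bar>x\<bar> powr p)) \<le> norm (2 * ((real (Suc k0) / a) ^ Suc k0 + 1) * inverse (1 + x\<^sup>2))"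
        using exp_minus_powr_le[OF a k, of x] by (simp only: real_norm_def abs_exp_cancel)
    qed
  qed simp
qed

text \<open>Since every coordinate is at most the norm, \<open>norm x powr p\<close> is at least the
  average of the powers of the coordinates. Splitting \<open>a\<close> evenly over
  \<open>Basis\<close> therefore bounds the function by a product of one-dimensional integrable
  ones.\<close>

lemma integrable_exp_norm_powr:
  assumes a: "0 < a" and p: "0 < p"
  shows "integrable lborel (\<lambda>x::'a::euclidean_space. exp (- a * norm x powr p))"
proof -
  let ?a = "a / DIM('a)"
  have "integrable lborel (\<lambda>x::'a. \<Prod>b\<in>Basis. exp (- ?a * \<bar>x \<bullet> b\<bar> powr p))"
    using a p by (intro integrable_lborel_prod integrable_exp_abs_powr) auto
  then show ?thesis
  proof (rule Bochner_Integration.integrable_bound)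
    show "AE x::'a in lborel. norm (exp (- a * norm x powr p)) \<le> norm (\<Prod>b\<in>Basis. exp (- ?a * \<bar>x \<bullet> b\<bar> powr p))"
    proof (rule AE_I2)
      fix x :: 'a
      have "(\<Sum>b\<in>Basis. ?a * \<bar>x \<bullet> b\<bar> powr p) \<le> (\<Sum>b\<in>(Basis::'a set). ?a * norm x powr p)"
        using a p by (intro sum_mono mult_left_mono powr_mono2 Basis_le_norm) auto
      also have "\<dots> = a * norm x powr p" by simp
      finally have "exp (- a * norm x powr p) \<le> exp (\<Sum>b\<in>Basis. - (?a * \<bar>x \<bullet> b\<bar> powr p))"
        by (simp add: sum_negf)
      also have "\<dots> = (\<Prod>b\<in>Basis. exp (- ?a * \<bar>x \<bullet> b\<bar> powr p))"
        by (simp add: exp_sum)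
      finally show "norm (exp (- a * norm x powr p)) \<le> norm (\<Prod>b\<in>Basis. exp (- ?a * \<bar>x \<bullet> b\<bar> powr p))"
        by (simp add: prod_nonneg)
    qed
  qed simp
qed

section \<open>Injectivity of the Fourier transform on integrable functions\<close>

lemma integrable_iexp_mult:
  fixes u :: "real ^ 'n \<Rightarrow> real"
  assumes "integrable lborel u"
  shows "integrable lborel (\<lambda>x. iexp (\<xi> \<bullet> x) * of_real (u x) :: complex)"
proof -
  have [measurable]: "u \<in> borel_measurable lborel" using assms by simp
  show ?thesis
    by (rule Bochner_Integration.integrable_bound[OF assms]) (auto simp: norm_mult)
qed

lemma fourier_measure_density:
  fixes f :: "real ^ 'n \<Rightarrow> real"
  assumes [measurable]: "f \<in> borel_measurable borel" and "\<And>x. 0 \<le> f x"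
  shows "fourier_measure (density lborel f) \<xi> = fourier f \<xi>"
  unfolding fourier_measure_def fourier_def
  by (subst integral_density) (auto simp: assms(2) scaleR_conv_of_real mult.commute)

text \<open>Solutions of the problem may change sign, whereas the uniqueness theorem speaks of
  measures. Moving negative parts across the equation gives nonnegative \<open>f\<close> and
  \<open>g\<close> with \<open>f - g = u - w\<close>, to which it applies.\<close>

theorem fourier_inject:
  fixes u w :: "real ^ 'n \<Rightarrow> real"
  assumes int: "integrable lborel u" "integrable lborel w"
    and eq: "\<And>\<xi>. fourier u \<xi> = fourier w \<xi>"
  shows "AE x in lborel. u x = w x"
proof -
  have [measurable]: "u \<in> borel_measurable borel" "w \<in> borel_measurable borel"
    using int by auto
  define f where "f x = max 0 (u x) + max 0 (- w x)" for x
  define g where "g x = max 0 (w x) + max 0 (- u x)" for x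
  have [measurable]: "f \<in> borel_measurable borel" "g \<in> borel_measurable borel"
    unfolding f_def g_def by measurable
  have nonneg: "0 \<le> f x" "0 \<le> g x" for x
    by (auto simp: f_def g_def)
  have diff: "f x - g x = u x - w x" for x
    by (auto simp: f_def g_def max_def)
  have int_f: "integrable lborel f" and int_g: "integrable lborel g"
    unfolding f_def g_def using int by auto
  have finite: "finite_measure (density lborel h)" if "integrable lborel h" "\<And>x. 0 \<le> h x" for h :: "real ^ 'n \<Rightarrow> real"
    using that by (intro finite_measureI) (auto simp: emeasure_density nn_integral_eq_integral)
  have "fourier f \<xi> - fourier g \<xi> = fourier u \<xi> - fourier w \<xi>" for \<xi>
  proof -
    have "fourier f \<xi> - fourier g \<xi> = (\<integral>x. iexp (\<xi> \<bullet> x) * of_real (f x - g x) \<partial>lborel)"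
      unfolding fourier_def using integrable_iexp_mult[OF int_f] integrable_iexp_mult[OF int_g]
      by (subst Bochner_Integration.integral_diff[symmetric]) (auto simp: right_diff_distrib)
    also have "\<dots> = fourier u \<xi> - fourier w \<xi>"
      unfolding fourier_def diff using integrable_iexp_mult[OF int(1)] integrable_iexp_mult[OF int(2)]
      by (subst Bochner_Integration.integral_diff[symmetric]) (auto simp: right_diff_distrib)
    finally show ?thesis .
  qed
  then have "fourier_measure (density lborel f) \<xi> = fourier_measure (density lborel g) \<xi>" for \<xi>
    using eq nonneg by (simp add: fourier_measure_density)
  then have "density lborel f = density lborel g"
    by (intro finite_measure_eqI_fourier finite int_f int_g nonneg) auto
  then have "AE x in lborel. ennreal (f x) = ennreal (g x)"
    by (intro sigma_finite_measure.density_unique[OF sigma_finite_lborel]) auto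
  then show ?thesis
  proof eventually_elim
    case (elim x)
    then have "f x = g x" using nonneg by simp
    then show ?case using diff[of x] by simp
  qed
qed

section \<open>Uniqueness of Laplace transforms\<close>

text \<open>Under x = exp(-s) the values of the transform at 1, 2, 3, ... become moments. Hence the
  integral of \<open>q (exp (- s)) * exp (- s) * f s\<close> vanishes for polynomials
  \<open>q\<close>, and by Weierstrass for continuous \<open>q\<close>. Taking \<open>q\<close> with
  \<open>q (exp (- s)) = max 0 (b - s) * f s\<close> leaves a nonnegative multiple of the square of
  \<open>f\<close>. The cutoff at \<open>b\<close> makes such a \<open>q\<close> continuous at x =
  0, that is, at s = infinity, where \<open>f\<close> is not controlled.\<close>

lemma lerch_real:
  fixes f :: "real \<Rightarrow> real"
  assumes cont: "continuous_on {0..} f"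
    and int: "\<And>\<mu>. \<mu> > 0 \<Longrightarrow> set_integrable lborel {0<..} (\<lambda>t. exp (- \<mu> * t) * f t)"
    and zero: "\<And>\<mu>. \<mu> > 0 \<Longrightarrow> (LINT t:{0<..}|lborel. exp (- \<mu> * t) * f t) = 0"
    and "t \<ge> 0"
  shows "f t = 0"
proof -
  define b where "b = t + 1"
  have b: "t < b" "b > 0" using \<open>t \<ge> 0\<close> by (auto simp: b_def)
  let ?G = "\<lambda>s. exp (- s) * f s"
  have intG: "set_integrable lborel {0<..} ?G"
    using int[of 1] by simp
  have poly: "(LINT s:{0<..}|lborel. p (exp (- s)) * ?G s) = 0 \<and>
      set_integrable lborel {0<..} (\<lambda>s. p (exp (- s)) * ?G s)"
    if p: "real_polynomial_function p" for p :: "real \<Rightarrow> real"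
  proof -
    obtain a n where p_eq: "p = (\<lambda>x. \<Sum>i\<le>n. a i * x ^ i)"
      using p unfolding real_polynomial_function_iff_sum by blast
    \<comment> \<open>The factor \<open>exp (- s)\<close> inside \<open>?G\<close> shifts the power
      \<open>i\<close> to the Laplace parameter \<open>Suc i\<close>, so only positive parameters
      occur.\<close>
    have eq: "p (exp (- s)) * ?G s = (\<Sum>i\<le>n. a i * (exp (- real (Suc i) * s) * f s))" for s
      unfolding p_eq sum_distrib_right
      by (intro sum.cong refl) (simp add: exp_of_nat_mult[symmetric] exp_add[symmetric] algebra_simps flip: exp_minus)
    have int': "set_integrable lborel {0<..} (\<lambda>s. a i * (exp (- real (Suc i) * s) * f s))" for i
      by (intro set_integrable_mult_right int) simp
    have "(LINT s:{0<..}|lborel. \<Sum>i\<le>n. a i * (exp (- real (Suc i) * s) * f s))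
        = (\<Sum>i\<le>n. LINT s:{0<..}|lborel. a i * (exp (- real (Suc i) * s) * f s))"
      using int' unfolding set_integrable_def set_lebesgue_integral_def scaleR_sum_right
      by (intro Bochner_Integration.integral_sum)
    also have "\<dots> = 0"
      by (intro sum.neutral ballI, subst set_integral_mult_right, subst zero) auto
    finally show ?thesis
      unfolding eq using int' unfolding set_integrable_def scaleR_sum_right
      by (intro conjI Bochner_Integration.integrable_sum)
  qed
  \<comment> \<open>Clamping keeps the logarithm away from 0. Wherever it acts,
    \<open>b + ln (?c x)\<close> is 0, so it does not alter the intended test function.\<close>
  let ?c = "\<lambda>x. max x (exp (- b))"
  define q where "q x = max 0 (b + ln (?c x)) * f (- ln (?c x))" for x
  have "continuous_on {0..1} (\<lambda>x. f (- ln (?c x)))"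
  proof (rule continuous_on_compose2[OF cont])
    have "?c x > 0" for x by (simp add: less_max_iff_disj)
    then show "continuous_on {0..1} (\<lambda>x. - ln (?c x))"
      by (auto intro!: continuous_intros simp: less_imp_neq[symmetric])
    show "(\<lambda>x. - ln (?c x)) ` {0..1} \<subseteq> {0..}"
      using b by (auto simp: less_max_iff_disj)
  qed
  moreover have "?c x \<noteq> 0" for x
    using exp_gt_zero[of "- b"] by linarith
  ultimately have q_cont: "continuous_on {0..1} q"
    unfolding q_def by (intro continuous_intros) auto
  have q_exp: "q (exp (- s)) = max 0 (b - s) * f s" if "s > 0" for s
    using that by (auto simp: q_def max_def)
  have q_int: "set_integrable lborel {0<..} (\<lambda>s. q (exp (- s)) * ?G s)"
  proof -
    have "bounded (q ` {0..1})"
      by (intro compact_imp_bounded compact_continuous_image q_cont) auto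
    then obtain B where B: "\<forall>x\<in>{0..1}. \<bar>q x\<bar> \<le> B"
      unfolding bounded_iff by auto
    have meas: "set_borel_measurable lborel {0<..} (\<lambda>s. q (exp (- s)))"
      unfolding set_borel_measurable_def
    proof (subst measurable_lborel2, rule borel_measurable_continuous_on_indicator)
      show "continuous_on {0<..} (\<lambda>s. q (exp (- s)))"
        by (rule continuous_on_compose2[OF q_cont]) (auto intro!: continuous_intros)
    qed simp
    have meas': "(\<lambda>s. indicator {0<..} s *\<^sub>R (q (exp (- s)) * ?G s)) \<in> borel_measurable lborel"
    proof -
      have "(\<lambda>s. (indicator {0<..} s *\<^sub>R q (exp (- s))) * (indicator {0<..} s *\<^sub>R ?G s)) \<in> borel_measurable lborel"
        using meas borel_measurable_integrable[OF intG[unfolded set_integrable_def]]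
        unfolding set_borel_measurable_def by measurable
      also have "(\<lambda>s. (indicator {0<..} s *\<^sub>R q (exp (- s))) * (indicator {0<..} s *\<^sub>R ?G s))
          = (\<lambda>s. indicator {0<..} s *\<^sub>R (q (exp (- s)) * ?G s))"
        by (auto simp: indicator_def)
      finally show ?thesis .
    qed
    have "integrable lborel (\<lambda>s. B * (indicator {0<..} s *\<^sub>R ?G s))"
      using intG unfolding set_integrable_def by (rule integrable_mult_right)
    then show ?thesis
      unfolding set_integrable_def
    proof (rule Bochner_Integration.integrable_bound)
      show "AE s in lborel. norm (indicator {0<..} s *\<^sub>R (q (exp (- s)) * ?G s)) \<le> norm (B * (indicator {0<..} s *\<^sub>R ?G s))"
      proof (rule AE_I2)
        fix s :: real
        have "s > 0 \<Longrightarrow> \<bar>q (exp (- s))\<bar> \<le> \<bar>B\<bar>"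
          using B[rule_format, of "exp (- s)"] by auto
        then show "norm (indicator {0<..} s *\<^sub>R (q (exp (- s)) * ?G s)) \<le> norm (B * (indicator {0<..} s *\<^sub>R ?G s))"
          by (auto simp: indicator_def abs_mult intro!: mult_right_mono)
      qed
    qed (rule meas')
  qed
  have q_zero: "(LINT s:{0<..}|lborel. q (exp (- s)) * ?G s) = 0"
  proof -
    \<comment> \<open>A uniform error of \<open>e / (I + 1)\<close> in the approximation of
      \<open>q\<close> costs at most \<open>e\<close> after integration against
      \<open>?G\<close>.\<close>
    define I where "I = (LINT s:{0<..}|lborel. \<bar>?G s\<bar>)"
    have I: "I \<ge> 0"
      unfolding I_def set_lebesgue_integral_def by (rule Bochner_Integration.integral_nonneg) auto
    have "\<bar>LINT s:{0<..}|lborel. q (exp (- s)) * ?G s\<bar> \<le> 0 + e" if e: "e > 0" for e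
    proof -
      obtain p where p: "real_polynomial_function p" "\<And>x. x \<in> {0..1} \<Longrightarrow> \<bar>q x - p x\<bar> < e / (I + 1)"
        using Stone_Weierstrass_real_polynomial_function[OF compact_Icc q_cont, of "e / (I + 1)"] e I by auto
      have "(LINT s:{0<..}|lborel. q (exp (- s)) * ?G s)
          = (LINT s:{0<..}|lborel. q (exp (- s)) * ?G s) - (LINT s:{0<..}|lborel. p (exp (- s)) * ?G s)"
        using poly[OF p(1)] by simp
      also have "\<dots> = (LINT s:{0<..}|lborel. (q (exp (- s)) - p (exp (- s))) * ?G s)"
        using q_int poly[OF p(1)] by (subst set_integral_diff(2)[symmetric]) (auto simp: left_diff_distrib)
      also have "\<bar>\<dots>\<bar> \<le> (LINT s:{0<..}|lborel. e / (I + 1) * \<bar>?G s\<bar>)"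
        unfolding set_lebesgue_integral_def
      proof (rule order_trans[OF integral_abs_bound], rule integral_mono)
        have "set_integrable lborel {0<..} (\<lambda>s. q (exp (- s)) * ?G s - p (exp (- s)) * ?G s)"
          using q_int poly[OF p(1)] by (intro set_integral_diff) auto
        then show "integrable lborel (\<lambda>s. \<bar>indicat_real {0<..} s *\<^sub>R ((q (exp (- s)) - p (exp (- s))) * ?G s)\<bar>)"
          by (intro integrable_abs) (simp add: set_integrable_def left_diff_distrib)
        have "set_integrable lborel {0<..} (\<lambda>s. e / (I + 1) * \<bar>?G s\<bar>)"
          by (intro set_integrable_mult_right set_integrable_abs intG)
        then show "integrable lborel (\<lambda>s. indicat_real {0<..} s *\<^sub>R (e / (I + 1) * \<bar>?G s\<bar>))"
          by (simp add: set_integrable_def)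
        fix s :: real
        have "\<bar>(q (exp (- s)) - p (exp (- s))) * ?G s\<bar> \<le> e / (I + 1) * \<bar>?G s\<bar>" if "s > 0"
          unfolding abs_mult using p(2)[of "exp (- s)"] that by (intro mult_right_mono) auto
        then show "\<bar>indicat_real {0<..} s *\<^sub>R ((q (exp (- s)) - p (exp (- s))) * ?G s)\<bar>
          \<le> indicat_real {0<..} s *\<^sub>R (e / (I + 1) * \<bar>?G s\<bar>)"
          by (auto simp: indicator_def)
      qed
      also have "\<dots> = e / (I + 1) * I"
        unfolding I_def by (rule set_integral_mult_right)
      also have "\<dots> \<le> e"
        using I e by (simp add: field_simps)
      finally show ?thesis by simp
    qed
    then have "\<bar>LINT s:{0<..}|lborel. q (exp (- s)) * ?G s\<bar> \<le> 0"
      by (rule field_le_epsilon)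
    then show ?thesis by simp
  qed
  have "(\<integral>s. indicator {0<..} s *\<^sub>R (q (exp (- s)) * ?G s) \<partial>lborel) = 0"
    using q_zero by (simp add: set_lebesgue_integral_def)
  moreover have "0 \<le> indicator {0<..} s *\<^sub>R (q (exp (- s)) * ?G s)" for s
  proof -
    have "max 0 (b - s) * f s * ?G s = max 0 (b - s) * exp (- s) * (f s)\<^sup>2"
      by (simp add: power2_eq_square)
    then have "0 \<le> max 0 (b - s) * f s * ?G s"
      by (metis max.cobounded1 exp_ge_zero zero_le_power2 mult_nonneg_nonneg)
    then show ?thesis
      by (auto simp: indicator_def q_exp)
  qed
  ultimately have "AE s in lborel. indicator {0<..} s *\<^sub>R (q (exp (- s)) * ?G s) = 0"
    using q_int unfolding set_integrable_def by (subst (asm) integral_nonneg_eq_0_iff_AE) auto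
  then have AE0: "AE s in lborel. \<not> (0 < s \<and> s < b \<and> f s \<noteq> 0)"
    by eventually_elim (auto simp: indicator_def q_exp split: if_splits)
  \<comment> \<open>Continuity upgrades almost everywhere to everywhere: \<open>Z\<close> is open
    and Lebesgue-null, hence empty.\<close>
  define Z where "Z = {s \<in> {0<..<b}. f s \<in> - {0}}"
  have cont': "continuous_on {0<..<b} f"
    by (rule continuous_on_subset[OF cont]) auto
  have "open Z"
    unfolding Z_def using continuous_open_preimage[OF cont', of "- {0}"] by (simp add: vimage_def Int_def conj_ac open_Compl)
  moreover have "negligible Z"
  proof -
    have "Z \<in> null_sets lborel"
      using AE0 \<open>open Z\<close> by (subst AE_iff_null_sets) (auto simp: Z_def)
    then show ?thesis
      by (simp add: negligible_iff_null_sets null_sets_completionI)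
  qed
  ultimately have "Z = {}"
    using open_not_negligible by blast
  then have zero_open: "f s = 0" if "0 < s" "s < b" for s
    using that by (auto simp: Z_def)
  \<comment> \<open>The integral sees only positive times; the value at 0 is recovered as the limit
    from the right.\<close>
  show "f t = 0"
  proof (cases "t = 0")
    case True
    have "(f \<longlongrightarrow> f 0) (at 0 within {0..})"
      using cont by (auto simp: continuous_on_def)
    then have "(f \<longlongrightarrow> f 0) (at_right 0)"
      by (rule tendsto_mono[rotated]) (auto intro!: at_le)
    moreover have "\<forall>\<^sub>F s in at_right 0. f s = 0"
      using b zero_open by (auto simp: eventually_at_right[OF \<open>b > 0\<close>])
    then have "(f \<longlongrightarrow> 0) (at_right 0)"
      by (rule tendsto_eventually)
    ultimately show ?thesis
      using True tendsto_unique[of "at_right (0::real)" f "f 0" 0] by simp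
  qed (use b zero_open \<open>t \<ge> 0\<close> in auto)
qed

theorem lerch:
  fixes F :: "real \<Rightarrow> complex"
  assumes cont: "continuous_on {0..} F"
    and int: "\<And>\<mu>. \<mu> > 0 \<Longrightarrow> set_integrable lborel {0<..} (\<lambda>t. of_real (exp (- \<mu> * t)) * F t)"
    and zero: "\<And>\<mu>. \<mu> > 0 \<Longrightarrow> laplace F \<mu> = 0"
    and t: "t \<ge> 0"
  shows "F t = 0"
proof (rule complex_eqI)
  have Re_eq: "indicator A s *\<^sub>R (exp (- \<mu> * s) * Re (F s)) = Re (indicator A s *\<^sub>R (of_real (exp (- \<mu> * s)) * F s))"
    and Im_eq: "indicator A s *\<^sub>R (exp (- \<mu> * s) * Im (F s)) = Im (indicator A s *\<^sub>R (of_real (exp (- \<mu> * s)) * F s))"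
    for A :: "real set" and \<mu> s
    by simp_all
  show "Re (F t) = Re 0"
  proof (rule trans[OF lerch_real[of "\<lambda>t. Re (F t)"]])
    show "continuous_on {0..} (\<lambda>t. Re (F t))"
      by (intro continuous_intros cont)
    fix \<mu> :: real assume \<mu>: "\<mu> > 0"
    show "set_integrable lborel {0<..} (\<lambda>t. exp (- \<mu> * t) * Re (F t))"
      using int[OF \<mu>] unfolding set_integrable_def Re_eq by (rule integrable_Re)
    show "(LINT t:{0<..}|lborel. exp (- \<mu> * t) * Re (F t)) = 0"
      using int[OF \<mu>] zero[OF \<mu>] unfolding set_integrable_def set_lebesgue_integral_def laplace_def Re_eq
      by (subst integral_Re) auto
  qed (use t in auto)
  show "Im (F t) = Im 0"
  proof (rule trans[OF lerch_real[of "\<lambda>t. Im (F t)"]])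
    show "continuous_on {0..} (\<lambda>t. Im (F t))"
      by (intro continuous_intros cont)
    fix \<mu> :: real assume \<mu>: "\<mu> > 0"
    show "set_integrable lborel {0<..} (\<lambda>t. exp (- \<mu> * t) * Im (F t))"
      using int[OF \<mu>] unfolding set_integrable_def Im_eq by (rule integrable_Im)
    show "(LINT t:{0<..}|lborel. exp (- \<mu> * t) * Im (F t)) = 0"
      using int[OF \<mu>] zero[OF \<mu>] unfolding set_integrable_def set_lebesgue_integral_def laplace_def Im_eq
      by (subst integral_Im) auto
  qed (use t in auto)
qed

section \<open>Processes at random times\<close>

text \<open>The first multiple of \<open>1 / Suc n\<close> strictly above \<open>x\<close>, for
  \<open>x \<ge> 0\<close>. Evaluating a process there involves countably many deterministic times,
  all positive even when \<open>x = 0\<close>.\<close>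

definition upper_grid :: "nat \<Rightarrow> real \<Rightarrow> real" where
  "upper_grid n x = (real (nat \<lfloor>real (Suc n) * x\<rfloor>) + 1) / real (Suc n)"

lemma upper_grid_bounds:
  assumes "x \<ge> 0"
  shows "x < upper_grid n x" "upper_grid n x \<le> x + 1 / real (Suc n)"
proof -
  let ?y = "real (Suc n) * x"
  have eq: "real (nat \<lfloor>?y\<rfloor>) = of_int \<lfloor>?y\<rfloor>"
    using assms by simp
  have "?y < of_int \<lfloor>?y\<rfloor> + 1" "of_int \<lfloor>?y\<rfloor> \<le> ?y"
    by linarith+
  then show "x < upper_grid n x" "upper_grid n x \<le> x + 1 / real (Suc n)"
    unfolding upper_grid_def eq by (simp_all add: divide_simps distrib_right mult.commute del: of_nat_Suc)
qed

lemma upper_grid_at_right: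
  assumes "x \<ge> 0"
  shows "filterlim (\<lambda>n. upper_grid n x) (at_right x) sequentially"
  unfolding filterlim_at
proof
  have "(\<lambda>n. x + 1 / real (Suc n)) \<longlonglongrightarrow> x + 0"
    by (intro tendsto_intros LIMSEQ_Suc[OF lim_1_over_n])
  then have lim: "(\<lambda>n. x + 1 / real (Suc n)) \<longlonglongrightarrow> x" by simp
  show "(\<lambda>n. upper_grid n x) \<longlonglongrightarrow> x"
    by (rule tendsto_sandwich[OF _ _ tendsto_const lim])
       (simp_all add: upper_grid_bounds[OF assms] less_imp_le del: of_nat_Suc)
  show "\<forall>\<^sub>F n in sequentially. upper_grid n x \<in> {x<..} \<and> upper_grid n x \<noteq> x"
    using upper_grid_bounds[OF assms] by (auto intro!: always_eventually simp: less_imp_neq[symmetric])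
qed

lemma tendsto_upper_grid:
  assumes "x \<ge> 0" "continuous (at_right x) f"
  shows "(\<lambda>n. f (upper_grid n x)) \<longlonglongrightarrow> f x"
proof -
  have "(f \<longlongrightarrow> f x) (at_right x)"
    using assms(2) by (simp add: continuous_within)
  then show ?thesis
    by (rule filterlim_compose[OF _ upper_grid_at_right[OF assms(1)]])
qed

text \<open>Each grid approximation is a countable case distinction between fixed times, hence
  jointly measurable, and right-continuity gives pointwise convergence. \<open>max 0 t\<close>
  extends the map to the whole line, because nothing is known about the process at negative
  times.\<close>

lemma measurable_right_continuous_process:
  fixes X :: "real \<Rightarrow> 'a \<Rightarrow> 'b::metric_space"
  assumes meas: "\<And>t. 0 < t \<Longrightarrow> X t \<in> borel_measurable N"
    and rc: "\<And>\<omega> t. \<omega> \<in> space N \<Longrightarrow> 0 \<le> t \<Longrightarrow> continuous (at_right t) (\<lambda>s. X s \<omega>)"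
  shows "(\<lambda>(t, \<omega>). X (max 0 t) \<omega>) \<in> borel_measurable (borel \<Otimes>\<^sub>M N)"
proof (rule borel_measurable_LIMSEQ_metric)
  fix n
  have [measurable]: "X ((real k + 1) / real (Suc n)) \<in> borel_measurable N" for k
    by (intro meas) simp
  have "(\<lambda>p. X ((real (nat \<lfloor>real (Suc n) * max 0 (fst p)\<rfloor>) + 1) / real (Suc n)) (snd p)) \<in> borel_measurable (borel \<Otimes>\<^sub>M N)"
    by (rule measurable_compose_countable[where g="\<lambda>p. nat \<lfloor>real (Suc n) * max 0 (fst p)\<rfloor>" and f="\<lambda>k p. X ((real k + 1) / real (Suc n)) (snd p)"]) measurable
  then show "(\<lambda>p. X (upper_grid n (max 0 (fst p))) (snd p)) \<in> borel_measurable (borel \<Otimes>\<^sub>M N)"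
    by (simp add: upper_grid_def)
next
  fix p assume "p \<in> space (borel \<Otimes>\<^sub>M N :: (real \<times> 'a) measure)"
  then have "snd p \<in> space N" by (auto simp: space_pair_measure)
  then show "(\<lambda>n. X (upper_grid n (max 0 (fst p))) (snd p)) \<longlonglongrightarrow> (\<lambda>(t, \<omega>). X (max 0 t) \<omega>) p"
    by (cases p) (auto intro!: tendsto_upper_grid rc)
qed

lemma measurable_at_random_time:
  fixes X :: "real \<Rightarrow> 'a \<Rightarrow> 'b::metric_space"
  assumes meas: "\<And>t. 0 < t \<Longrightarrow> X t \<in> borel_measurable N"
    and rc: "\<And>\<omega> t. \<omega> \<in> space N \<Longrightarrow> 0 \<le> t \<Longrightarrow> continuous (at_right t) (\<lambda>s. X s \<omega>)"
    and \<tau>: "\<tau> \<in> borel_measurable N" "\<And>\<omega>. \<omega> \<in> space N \<Longrightarrow> 0 \<le> \<tau> \<omega>"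
  shows "(\<lambda>\<omega>. X (\<tau> \<omega>) \<omega>) \<in> borel_measurable N"
proof -
  have "(\<lambda>\<omega>. (\<lambda>(t, \<omega>). X (max 0 t) \<omega>) (\<tau> \<omega>, \<omega>)) \<in> borel_measurable N"
    using \<tau>(1) by (intro measurable_compose[OF _ measurable_right_continuous_process[OF meas rc]]) auto
  also have "?this \<longleftrightarrow> ?thesis"
    using \<tau>(2) by (intro measurable_cong) (simp add: max_def)
  finally show ?thesis .
qed

text \<open>An identity known at deterministic times on every event defined by \<open>\<tau>\<close>
  passes to the random time itself: on the grid the time is constant on countably many such events,
  and dominated convergence does the rest. The set \<open>A\<close> stays in the conclusion because
  the expectation is later needed on part of the sample space as well.\<close>

lemma (in prob_space) integral_at_random_time:
  fixes X :: "real \<Rightarrow> 'a \<Rightarrow> 'b::metric_space"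
    and g :: "'b \<Rightarrow> 'c::{banach, second_countable_topology}"
  assumes meas: "\<And>t. 0 < t \<Longrightarrow> X t \<in> borel_measurable M"
    and rc: "\<And>\<omega> t. \<omega> \<in> space M \<Longrightarrow> 0 \<le> t \<Longrightarrow> continuous (at_right t) (\<lambda>s. X s \<omega>)"
    and \<tau> [measurable]: "\<tau> \<in> borel_measurable M" and \<tau>0: "\<And>\<omega>. \<omega> \<in> space M \<Longrightarrow> 0 \<le> \<tau> \<omega>"
    and g: "continuous_on UNIV g" "\<And>x. norm (g x) \<le> C"
    and \<phi>: "\<And>t. 0 \<le> t \<Longrightarrow> continuous (at_right t) \<phi>" "\<And>t. 0 < t \<Longrightarrow> norm (\<phi> t) \<le> C"
    and fixed: "\<And>t A. 0 < t \<Longrightarrow> A \<in> sets borel \<Longrightarrow>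
       (\<integral>\<omega>. indicator A (\<tau> \<omega>) *\<^sub>R g (X t \<omega>) \<partial>M) = (\<integral>\<omega>. indicator A (\<tau> \<omega>) *\<^sub>R \<phi> t \<partial>M)"
    and A [measurable]: "A \<in> sets borel"
  shows "(\<integral>\<omega>. indicator A (\<tau> \<omega>) *\<^sub>R g (X (\<tau> \<omega>) \<omega>) \<partial>M) = (\<integral>\<omega>. indicator A (\<tau> \<omega>) *\<^sub>R \<phi> (\<tau> \<omega>) \<partial>M)"
proof -
  have g_meas [measurable]: "g \<in> borel_measurable borel"
    using g(1) by (rule borel_measurable_continuous_onI)
  have X\<tau> [measurable]: "(\<lambda>\<omega>. X (\<tau> \<omega>) \<omega>) \<in> borel_measurable M"
    by (rule measurable_at_random_time[OF meas rc \<tau> \<tau>0])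
  have C: "0 \<le> C" using norm_ge_zero[of "g undefined"] g(2)[of undefined] by linarith
  let ?F = "\<lambda>n \<omega>. indicator A (\<tau> \<omega>) *\<^sub>R g (X (upper_grid n (\<tau> \<omega>)) \<omega>)"
  let ?G = "\<lambda>n \<omega>. indicator A (\<tau> \<omega>) *\<^sub>R \<phi> (upper_grid n (\<tau> \<omega>))"
  have grid_pos: "0 < upper_grid n (\<tau> \<omega>)" if "\<omega> \<in> space M" for n \<omega>
    using upper_grid_bounds(1)[OF \<tau>0[OF that], of n] \<tau>0[OF that] by linarith
  have XF [measurable]: "(\<lambda>\<omega>. X (upper_grid n (\<tau> \<omega>)) \<omega>) \<in> borel_measurable M" for n
  proof (rule measurable_at_random_time[OF meas rc])
    show "(\<lambda>\<omega>. upper_grid n (\<tau> \<omega>)) \<in> borel_measurable M"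
      unfolding upper_grid_def by measurable
  qed (use grid_pos in \<open>auto intro: less_imp_le\<close>)
  have \<phi>G [measurable]: "(\<lambda>\<omega>. \<phi> (upper_grid n (\<tau> \<omega>))) \<in> borel_measurable M" for n
  proof (rule measurable_at_random_time[where X="\<lambda>t _. \<phi> t"])
    show "(\<lambda>\<omega>. upper_grid n (\<tau> \<omega>)) \<in> borel_measurable M"
      unfolding upper_grid_def by measurable
  qed (use grid_pos \<phi> in \<open>auto intro: less_imp_le\<close>)
  have \<phi>\<tau> [measurable]: "(\<lambda>\<omega>. \<phi> (\<tau> \<omega>)) \<in> borel_measurable M"
    by (rule measurable_at_random_time[where X="\<lambda>t _. \<phi> t"]) (use \<tau> \<tau>0 \<phi> in auto)
  have grid_eq: "(\<integral>\<omega>. ?F n \<omega> \<partial>M) = (\<integral>\<omega>. ?G n \<omega> \<partial>M)" for n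
  proof -
    \<comment> \<open>On \<open>B k\<close> the grid time is the constant \<open>t k\<close>.
      Intersecting the corresponding range of \<open>\<tau>\<close> with \<open>A\<close> gives
      \<open>I k\<close>, the set to which \<open>fixed\<close> is applied.\<close>
    define B where "B k = {\<omega> \<in> space M. nat \<lfloor>real (Suc n) * \<tau> \<omega>\<rfloor> = k}" for k
    define I where "I k = A \<inter> {x. nat \<lfloor>real (Suc n) * x\<rfloor> = k}" for k
    define t where "t k = (real k + 1) / real (Suc n)" for k
    have [measurable]: "B k \<in> sets M" for k
      unfolding B_def by measurable
    have [measurable]: "I k \<in> sets borel" for k
      unfolding I_def by measurable
    have disj: "i \<noteq> j \<Longrightarrow> B i \<inter> B j = {}" for i j
      by (auto simp: B_def)
    have UN: "(\<Union>k. B k) = space M"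
      by (auto simp: B_def)
    have int: "set_integrable M (\<Union>k. B k) (?F n)" "set_integrable M (\<Union>k. B k) (?G n)"
      unfolding UN set_integrable_def
      by (rule integrable_const_bound[where B=C];
          use g(2) C \<phi>(2)[OF grid_pos] in \<open>auto simp: indicator_def\<close>)+
    have "(LINT \<omega>:B k|M. ?F n \<omega>) = (LINT \<omega>:B k|M. ?G n \<omega>)" for k
    proof -
      have "(LINT \<omega>:B k|M. ?F n \<omega>) = (\<integral>\<omega>. indicator (I k) (\<tau> \<omega>) *\<^sub>R g (X (t k) \<omega>) \<partial>M)"
        unfolding set_lebesgue_integral_def
        by (intro Bochner_Integration.integral_cong)
           (auto simp: indicator_def B_def I_def upper_grid_def t_def)
      also have "\<dots> = (\<integral>\<omega>. indicator (I k) (\<tau> \<omega>) *\<^sub>R \<phi> (t k) \<partial>M)"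
        by (rule fixed) (simp_all add: t_def)
      also have "\<dots> = (LINT \<omega>:B k|M. ?G n \<omega>)"
        unfolding set_lebesgue_integral_def
        by (intro Bochner_Integration.integral_cong)
           (auto simp: indicator_def B_def I_def upper_grid_def t_def)
      finally show ?thesis .
    qed
    then have "(LINT \<omega>:(\<Union>k. B k)|M. ?F n \<omega>) = (LINT \<omega>:(\<Union>k. B k)|M. ?G n \<omega>)"
      using lebesgue_integral_countable_add[of B M "?F n", OF _ disj int(1)]
        lebesgue_integral_countable_add[of B M "?G n", OF _ disj int(2)] by simp
    moreover have "integrable M (?F n)" "integrable M (?G n)"
      by (rule integrable_const_bound[where B=C];
          use g(2) C \<phi>(2)[OF grid_pos] in \<open>auto simp: indicator_def\<close>)+
    ultimately show ?thesis
      unfolding UN by (simp only: set_integral_space)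
  qed
  have F: "(\<lambda>n. \<integral>\<omega>. ?F n \<omega> \<partial>M) \<longlonglongrightarrow> (\<integral>\<omega>. indicator A (\<tau> \<omega>) *\<^sub>R g (X (\<tau> \<omega>) \<omega>) \<partial>M)"
  proof (rule integral_dominated_convergence[where w="\<lambda>_. C"])
    show "AE \<omega> in M. (\<lambda>n. ?F n \<omega>) \<longlonglongrightarrow> indicator A (\<tau> \<omega>) *\<^sub>R g (X (\<tau> \<omega>) \<omega>)"
    proof (intro AE_I2 tendsto_intros)
      fix \<omega> assume "\<omega> \<in> space M"
      then have "(\<lambda>n. X (upper_grid n (\<tau> \<omega>)) \<omega>) \<longlonglongrightarrow> X (\<tau> \<omega>) \<omega>"
        by (intro tendsto_upper_grid \<tau>0 rc)
      then show "(\<lambda>n. g (X (upper_grid n (\<tau> \<omega>)) \<omega>)) \<longlonglongrightarrow> g (X (\<tau> \<omega>) \<omega>)"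
        using g(1) by (intro isCont_tendsto_compose[of _ g]) (auto simp: continuous_on_eq_continuous_at)
    qed
  qed (use g(2) C in \<open>auto simp: indicator_def\<close>)
  have G: "(\<lambda>n. \<integral>\<omega>. ?G n \<omega> \<partial>M) \<longlonglongrightarrow> (\<integral>\<omega>. indicator A (\<tau> \<omega>) *\<^sub>R \<phi> (\<tau> \<omega>) \<partial>M)"
  proof (rule integral_dominated_convergence[where w="\<lambda>_. C"])
    show "AE \<omega> in M. (\<lambda>n. ?G n \<omega>) \<longlonglongrightarrow> indicator A (\<tau> \<omega>) *\<^sub>R \<phi> (\<tau> \<omega>)"
      by (intro AE_I2 tendsto_intros tendsto_upper_grid \<tau>0 \<phi>)
    show "AE \<omega> in M. norm (?G n \<omega>) \<le> C" for n
      using \<phi>(2)[OF grid_pos] C by (intro AE_I2) (auto simp: indicator_def)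
  qed auto
  show ?thesis
    using LIMSEQ_unique[OF F G[folded grid_eq]] .
qed

section \<open>Time changes and subordinators\<close>

text \<open>The path properties of subordinators that are used pathwise. The class is closed under
  composition and under nonnegative linear combinations, so it contains the paths of the iterated
  and of the mixed subordinator.\<close>

definition time_change :: "(real \<Rightarrow> real) \<Rightarrow> bool" where
  "time_change f \<longleftrightarrow> f 0 = 0 \<and> mono_on {0..} f \<and> (\<forall>t\<ge>0. continuous (at_right t) f)"

lemma time_change_mono: "time_change f \<Longrightarrow> 0 \<le> s \<Longrightarrow> s \<le> t \<Longrightarrow> f s \<le> f t"
  unfolding time_change_def mono_on_def by auto

lemma time_change_nonneg: "time_change f \<Longrightarrow> 0 \<le> t \<Longrightarrow> 0 \<le> f t"
  using time_change_mono[of f 0 t] by (simp add: time_change_def)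

lemma time_change_right_continuous: "time_change f \<Longrightarrow> 0 \<le> t \<Longrightarrow> continuous (at_right t) f"
  by (simp add: time_change_def)

lemma time_change_ident: "time_change (\<lambda>t. t)"
  by (auto simp: time_change_def mono_on_def)

text \<open>Composition needs the closed half-line: a path that is constant to the right of
  \<open>t\<close> sends \<open>{t<..}\<close> to points outside \<open>{g t<..}\<close>, whereas
  \<open>{t..}\<close> is always sent into \<open>{g t..}\<close>.\<close>

lemma continuous_at_right_iff_atLeast:
  fixes f :: "real \<Rightarrow> 'a::topological_space"
  shows "continuous (at_right t) f \<longleftrightarrow> continuous (at t within {t..}) f"
  by (simp add: continuous_within at_within_Ici_at_right)

lemma time_change_compose:
  assumes f: "time_change f" and g: "time_change g"
  shows "time_change (\<lambda>t. f (g t))"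
  unfolding time_change_def
proof (intro conjI allI impI)
  show "f (g 0) = 0"
    using f g by (simp add: time_change_def)
  show "mono_on {0..} (\<lambda>t. f (g t))"
    using time_change_mono[OF f] time_change_mono[OF g] time_change_nonneg[OF g]
    by (auto simp: mono_on_def)
next
  fix t :: real assume t: "t \<ge> 0"
  have "continuous (at t within {t..}) g"
    using time_change_right_continuous[OF g t] by (simp add: continuous_at_right_iff_atLeast)
  moreover have "continuous (at (g t) within g ` {t..}) f"
  proof (rule continuous_within_subset)
    show "continuous (at (g t) within {g t..}) f"
      using time_change_right_continuous[OF f time_change_nonneg[OF g t]]
      by (simp add: continuous_at_right_iff_atLeast)
    show "g ` {t..} \<subseteq> {g t..}"
      using time_change_mono[OF g t] by auto
  qed
  ultimately show "continuous (at_right t) (\<lambda>t. f (g t))"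
    unfolding continuous_at_right_iff_atLeast by (rule continuous_within_compose2)
qed

lemma time_change_sum:
  assumes "\<And>j. j \<in> I \<Longrightarrow> time_change (f j)" "\<And>j. j \<in> I \<Longrightarrow> 0 \<le> a j"
  shows "time_change (\<lambda>t. \<Sum>j\<in>I. a j * f j t)"
  unfolding time_change_def
proof (intro conjI allI impI)
  show "(\<Sum>j\<in>I. a j * f j 0) = 0"
    using assms by (intro sum.neutral) (auto simp: time_change_def)
  show "mono_on {0..} (\<lambda>t. \<Sum>j\<in>I. a j * f j t)"
    unfolding mono_on_def
    by (intro allI impI sum_mono mult_left_mono) (use assms time_change_mono in auto)
  show "continuous (at_right t) (\<lambda>t. \<Sum>j\<in>I. a j * f j t)" if "0 \<le> t" for t
    using that by (intro continuous_sum continuous_mult continuous_const time_change_right_continuous assms)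
qed

lemma time_change_iterated:
  assumes "\<And>k. k \<in> {1..r} \<Longrightarrow> time_change (\<lambda>t. X k t \<omega>)"
  shows "time_change (\<lambda>t. iterated_process X r t \<omega>)"
  using assms
proof (induction r)
  case (Suc r)
  then show ?case
    using time_change_compose[of "\<lambda>t. iterated_process X r t \<omega>" "\<lambda>t. X (Suc r) t \<omega>"] by auto
qed (simp add: time_change_ident)

lemma strict_mono_on_iterated:
  assumes "\<And>k. k \<in> {1..r} \<Longrightarrow> time_change (\<lambda>t. X k t \<omega>)"
    and "\<And>k. k \<in> {1..r} \<Longrightarrow> strict_mono_on {0..} (\<lambda>t. X k t \<omega>)"
  shows "strict_mono_on {0..} (\<lambda>t. iterated_process X r t \<omega>)"
  using assms
proof (induction r)
  case (Suc r)
  have strict: "strict_mono_on {0..} (\<lambda>t. X (Suc r) t \<omega>)" "strict_mono_on {0..} (\<lambda>t. iterated_process X r t \<omega>)"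
    "time_change (\<lambda>t. X (Suc r) t \<omega>)"
    using Suc by auto
  show ?case
    unfolding strict_mono_on_def
  proof (intro allI impI, elim conjE)
    fix s t :: real assume st: "s \<in> {0..}" "t \<in> {0..}" "s < t"
    have "X (Suc r) s \<omega> < X (Suc r) t \<omega>"
      using strict(1) st by (simp add: strict_mono_on_def)
    moreover have "0 \<le> X (Suc r) s \<omega>" "0 \<le> X (Suc r) t \<omega>"
      using time_change_nonneg[OF strict(3)] st by auto
    ultimately show "iterated_process X (Suc r) s \<omega> < iterated_process X (Suc r) t \<omega>"
      using strict(2) by (simp add: strict_mono_on_def)
  qed
qed (simp add: strict_mono_on_def)

text \<open>Stated for an arbitrary \<open>N\<close>, so that it applies to \<open>M\<close> and
  also to the smaller sigma-algebras generated by some of the subordinators. The latter use is what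
  yields independence of compositions.\<close>

lemma measurable_iterated:
  assumes "\<And>k t. k \<in> {1..r} \<Longrightarrow> 0 \<le> t \<Longrightarrow> X k t \<in> borel_measurable N"
    and "\<And>k \<omega>. k \<in> {1..r} \<Longrightarrow> \<omega> \<in> space N \<Longrightarrow> time_change (\<lambda>t. X k t \<omega>)"
    and "0 \<le> t"
  shows "iterated_process X r t \<in> borel_measurable N"
  using assms
proof (induction r arbitrary: t)
  case 0
  then show ?case by (simp add: iterated_process.simps(1)[abs_def])
next
  case (Suc r)
  have "(\<lambda>\<omega>. iterated_process X r (X (Suc r) t \<omega>) \<omega>) \<in> borel_measurable N"
  proof (rule measurable_at_random_time[where X="iterated_process X r" and \<tau>="X (Suc r) t"])
    fix \<omega> and s :: real assume "\<omega> \<in> space N" "0 \<le> s"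
    then show "continuous (at_right s) (\<lambda>s. iterated_process X r s \<omega>)"
      using Suc.prems(2) by (intro time_change_right_continuous time_change_iterated) auto
  next
    fix \<omega> assume "\<omega> \<in> space N"
    then show "0 \<le> X (Suc r) t \<omega>"
      using Suc.prems(2)[of "Suc r"] Suc.prems(3) by (intro time_change_nonneg[of "\<lambda>t. X (Suc r) t \<omega>"]) auto
  qed (use Suc in auto)
  then show ?case by simp
qed

section \<open>Paths of a stable subordinator\<close>

lemma stable_subordinator_time_change:
  assumes "stable_subordinator M \<nu> X" "\<omega> \<in> space M"
  shows "time_change (\<lambda>t. X t \<omega>)"
  using assms by (simp add: stable_subordinator_def levy_process_def time_change_def)

lemma stable_subordinator_measurable:
  assumes "stable_subordinator M \<nu> X" "0 \<le> t"
  shows "X t \<in> borel_measurable M"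
  using assms by (simp add: stable_subordinator_def levy_process_def)

lemma (in prob_space) stable_subordinator_laplace:
  assumes "stable_subordinator M \<nu> X" "0 \<le> t" "0 < \<mu>"
  shows "(\<integral>\<omega>. exp (- \<mu> * X t \<omega>) \<partial>M) = exp (- t * \<mu> powr \<nu>)"
proof (cases "t = 0")
  case True
  have "(\<integral>\<omega>. exp (- \<mu> * X t \<omega>) \<partial>M) = (\<integral>\<omega>. 1 \<partial>M)"
    using assms True by (intro Bochner_Integration.integral_cong)
      (auto simp: stable_subordinator_def levy_process_def)
  then show ?thesis
    using True by (simp add: prob_space)
qed (use assms in \<open>auto simp: stable_subordinator_def\<close>)

text \<open>On the event \<open>X t \<omega> = 0\<close> the variable
  \<open>exp (- \<mu> * X t \<omega>)\<close> is 1, so the probability is at most the Laplace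
  transform at every \<open>\<mu>\<close>, and that tends to 0 as \<open>\<mu>\<close>
  grows.\<close>

lemma (in prob_space) stable_subordinator_pos:
  assumes X: "stable_subordinator M \<nu> X" and t: "0 < t" and \<nu>: "0 < \<nu>"
  shows "prob {\<omega> \<in> space M. X t \<omega> = 0} = 0"
proof (rule ccontr)
  let ?A = "{\<omega> \<in> space M. X t \<omega> = 0}"
  have [measurable]: "X t \<in> borel_measurable M"
    using stable_subordinator_measurable[OF X] t by simp
  have nonneg: "0 \<le> X t \<omega>" if "\<omega> \<in> space M" for \<omega>
    using time_change_nonneg[OF stable_subordinator_time_change[OF X that]] t by simp
  assume "prob ?A \<noteq> 0"
  then have p: "0 < prob ?A" by (simp add: zero_less_measure_iff)
  \<comment> \<open>\<open>y\<close> is the intended value of \<open>\<mu> powr \<nu>\<close>. It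
    makes the bound \<open>exp (- t * y)\<close> equal to \<open>prob ?A * exp (- 1)\<close>,
    smaller than the probability that it should dominate.\<close>
  define y where "y = (1 - ln (prob ?A)) / t"
  have "ln (prob ?A) \<le> 0"
    using p by simp
  then have y: "y > 0"
    using t by (simp add: y_def)
  define \<mu> where "\<mu> = y powr (1 / \<nu>)"
  have \<mu>: "\<mu> > 0" "\<mu> powr \<nu> = y"
    using y \<nu> by (auto simp: \<mu>_def powr_powr)
  have "prob ?A = (\<integral>\<omega>. indicator ?A \<omega> \<partial>M)"
    by simp
  also have "\<dots> \<le> (\<integral>\<omega>. exp (- \<mu> * X t \<omega>) \<partial>M)"
  proof (rule integral_mono)
    show "integrable M (\<lambda>\<omega>. exp (- \<mu> * X t \<omega>))"
      by (rule integrable_const_bound[where B=1]) (use nonneg \<mu> in auto)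
    show "integrable M (indicator ?A :: 'a \<Rightarrow> real)"
      by (rule integrable_real_indicator) (auto simp: less_top[symmetric])
  qed (auto simp: indicator_def)
  also have "\<dots> = exp (- t * y)"
    using stable_subordinator_laplace[OF X _ \<mu>(1)] t \<mu>(2) by simp
  also have "- t * y = ln (prob ?A) + (- 1)"
    using t by (simp add: y_def field_simps)
  also have "exp \<dots> = prob ?A * exp (- 1)"
    unfolding exp_add using p by simp
  also have "\<dots> < prob ?A * 1"
    using p by (intro mult_strict_left_mono) auto
  finally show False by simp
qed

text \<open>An increment between two fixed times has the law of \<open>X\<close> at a positive time
  and is almost surely nonzero. This holds simultaneously for all rational pairs, and by
  monotonicity two rationals between \<open>s\<close> and \<open>t\<close> separate the values
  there.\<close>

lemma (in prob_space) stable_subordinator_strict_mono: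
  assumes X: "stable_subordinator M \<nu> X" and \<nu>: "0 < \<nu>"
  shows "AE \<omega> in M. strict_mono_on {0..} (\<lambda>t. X t \<omega>)"
proof -
  have meas [measurable]: "X t \<in> borel_measurable M" if "0 \<le> t" for t
    using stable_subordinator_measurable[OF X that] .
  have neq: "AE \<omega> in M. X p \<omega> \<noteq> X q \<omega>" if "0 \<le> p" "p < q" for p q
  proof -
    define t where "t = q - p"
    have t: "t > 0" "q = p + t" using that by (auto simp: t_def)
    have [measurable]: "X p \<in> borel_measurable M" "X q \<in> borel_measurable M" "X t \<in> borel_measurable M"
      using that t by (auto intro: meas)
    have "distr M borel (\<lambda>\<omega>. X q \<omega> - X p \<omega>) = distr M borel (X t)"
      using X that t by (simp add: stable_subordinator_def levy_process_def)
    then have "measure (distr M borel (\<lambda>\<omega>. X q \<omega> - X p \<omega>)) {0} = measure (distr M borel (X t)) {0}"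
      by simp
    then have "prob ((\<lambda>\<omega>. X q \<omega> - X p \<omega>) -` {0} \<inter> space M) = prob (X t -` {0} \<inter> space M)"
      by (simp add: measure_distr)
    also have "X t -` {0} \<inter> space M = {\<omega> \<in> space M. X t \<omega> = 0}"
      by auto
    also have "prob \<dots> = 0"
      by (rule stable_subordinator_pos[OF X t(1) \<nu>])
    also have "(\<lambda>\<omega>. X q \<omega> - X p \<omega>) -` {0} \<inter> space M = {\<omega> \<in> space M. X p \<omega> = X q \<omega>}"
      by auto
    finally show ?thesis
      by (subst (asm) prob_eq_0) auto
  qed
  have "AE \<omega> in M. \<forall>p\<in>\<rat>. \<forall>q\<in>\<rat>. 0 \<le> p \<longrightarrow> p < q \<longrightarrow> X p \<omega> \<noteq> X q \<omega>"
    by (intro AE_ball_countable[THEN iffD2] countable_rat ballI)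
       (use neq in auto)
  with AE_space show ?thesis
  proof eventually_elim
    case (elim \<omega>)
    show ?case
      unfolding strict_mono_on_def
    proof (intro allI impI, elim conjE)
      fix s t :: real assume st: "s \<in> {0..}" "t \<in> {0..}" "s < t"
      obtain p where p: "p \<in> \<rat>" "s < p" "p < t" using Rats_dense_in_real[OF st(3)] by blast
      obtain q where q: "q \<in> \<rat>" "p < q" "q < t" using Rats_dense_in_real[OF p(3)] by blast
      have mono: "\<And>u v. 0 \<le> u \<Longrightarrow> u \<le> v \<Longrightarrow> X u \<omega> \<le> X v \<omega>"
        using time_change_mono[OF stable_subordinator_time_change[OF X elim(1)]] .
      have "X s \<omega> \<le> X p \<omega>" "X p \<omega> \<le> X q \<omega>" "X q \<omega> \<le> X t \<omega>" "X p \<omega> \<noteq> X q \<omega>"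
        using st p q elim(2) by (auto intro!: mono)
      then show "X s \<omega> < X t \<omega>" by linarith
    qed
  qed
qed

section \<open>Independent processes and independent random times\<close>

lemma process_events_eq:
  "process_events M T X =
     {sample_path T X -` A \<inter> space M | A. A \<in> sets (PiM T (\<lambda>_. borel))}"
  unfolding process_events_def
  by (rule sets_vimage_algebra2) (auto simp: sample_path_def space_PiM)

lemma process_event_at:
  assumes "t \<in> T" "S \<in> sets borel"
  shows "X t -` S \<inter> space M \<in> process_events M T X"
proof -
  let ?A = "{f \<in> space (PiM T (\<lambda>_. borel)). f t \<in> S}"
  have "?A \<in> sets (PiM T (\<lambda>_. borel))"
    using assms by measurable
  moreover have "X t -` S \<inter> space M = sample_path T X -` ?A \<inter> space M"
    using assms(1) by (auto simp: sample_path_def space_PiM)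
  ultimately show ?thesis
    unfolding process_events_eq by blast
qed

lemma Int_stable_process_events: "Int_stable (process_events M T X)"
  unfolding process_events_def by (auto simp: Int_stable_def)

lemma sigma_sets_process_events: "sigma_sets (space M) (process_events M T X) = process_events M T X"
  unfolding process_events_def
  using sets.sigma_sets_eq[of "vimage_algebra (space M) (sample_path T X) (PiM T (\<lambda>_. borel))"] by simp

lemma process_events_subset: "process_events M T X \<subseteq> Pow (space M)"
  unfolding process_events_eq by auto

text \<open>\<open>Y\<close> and \<open>Z\<close> may take values in different types, so
  independence is phrased through families of events. After composition with \<open>f\<close> and
  \<open>g\<close> both variables live in one type and the product formula for
  \<open>indep_var\<close> applies.\<close>

lemma (in prob_space) indep_set_integral_mult:
  fixes f :: "'b::topological_space \<Rightarrow> 'e::{real_normed_field, banach, second_countable_topology}"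
    and g :: "'c::topological_space \<Rightarrow> 'e"
  assumes indep: "indep_set \<A> \<B>"
    and Y: "\<And>S. S \<in> sets borel \<Longrightarrow> Y -` S \<inter> space M \<in> \<A>"
    and Z: "\<And>S. S \<in> sets borel \<Longrightarrow> Z -` S \<inter> space M \<in> \<B>"
    and f [measurable]: "f \<in> borel_measurable borel" and g [measurable]: "g \<in> borel_measurable borel"
    and int: "integrable M (\<lambda>\<omega>. f (Y \<omega>))" "integrable M (\<lambda>\<omega>. g (Z \<omega>))"
  shows "(\<integral>\<omega>. f (Y \<omega>) * g (Z \<omega>) \<partial>M) = (\<integral>\<omega>. f (Y \<omega>) \<partial>M) * (\<integral>\<omega>. g (Z \<omega>) \<partial>M)"
proof -
  have ev: "\<A> \<subseteq> events" "\<B> \<subseteq> events"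
    using indep_setD_ev1[OF indep] indep_setD_ev2[OF indep] .
  have Y': "(\<lambda>\<omega>. f (Y \<omega>)) -` S \<inter> space M \<in> \<A>" if "S \<in> sets borel" for S
    using Y[OF measurable_sets_borel[OF f that]] by (simp add: vimage_def)
  have Z': "(\<lambda>\<omega>. g (Z \<omega>)) -` S \<inter> space M \<in> \<B>" if "S \<in> sets borel" for S
    using Z[OF measurable_sets_borel[OF g that]] by (simp add: vimage_def)
  have rv: "random_variable borel (\<lambda>\<omega>. f (Y \<omega>))" "random_variable borel (\<lambda>\<omega>. g (Z \<omega>))"
    using int by auto
  have "indep_set {(\<lambda>\<omega>. f (Y \<omega>)) -` S \<inter> space M | S. S \<in> sets borel} {(\<lambda>\<omega>. g (Z \<omega>)) -` S \<inter> space M | S. S \<in> sets borel}"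
    unfolding indep_sets2_eq
    using Y' Z' ev indep_setD[OF indep] by blast
  moreover have "Int_stable {h -` S \<inter> space M | S. S \<in> sets borel}" for h :: "'a \<Rightarrow> 'e"
    unfolding Int_stable_def
    by (safe, rule_tac x="S \<inter> Sa" in exI) auto
  ultimately have "indep_var borel (\<lambda>\<omega>. f (Y \<omega>)) borel (\<lambda>\<omega>. g (Z \<omega>))"
    unfolding indep_var_eq using rv by (intro conjI indep_set_sigma_sets)
  from indep_var_lebesgue_integral[OF this int] show ?thesis .
qed

text \<open>Independence factorises the expectation at each fixed time \<open>t\<close> into the
  probability that \<open>\<tau>\<close> lies in the set, times \<open>\<phi> t\<close>; this is the
  fixed-time identity that \<open>integral_at_random_time\<close> takes as input.\<close>

lemma (in prob_space) integral_at_independent_time: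
  fixes X :: "real \<Rightarrow> 'a \<Rightarrow> 'b::metric_space"
    and g :: "'b \<Rightarrow> 'c::{real_normed_field, banach, second_countable_topology}"
  assumes indep: "indep_set \<A> \<B>"
    and X: "\<And>t S. 0 < t \<Longrightarrow> S \<in> sets borel \<Longrightarrow> X t -` S \<inter> space M \<in> \<B>"
    and rc: "\<And>\<omega> t. \<omega> \<in> space M \<Longrightarrow> 0 \<le> t \<Longrightarrow> continuous (at_right t) (\<lambda>s. X s \<omega>)"
    and \<tau>: "\<And>S. S \<in> sets borel \<Longrightarrow> \<tau> -` S \<inter> space M \<in> \<A>" and \<tau>0: "\<And>\<omega>. \<omega> \<in> space M \<Longrightarrow> 0 \<le> \<tau> \<omega>"
    and g: "continuous_on UNIV g" "\<And>x. norm (g x) \<le> C"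
    and \<phi>: "\<And>t. 0 \<le> t \<Longrightarrow> continuous (at_right t) \<phi>"
    and eq: "\<And>t. 0 < t \<Longrightarrow> (\<integral>\<omega>. g (X t \<omega>) \<partial>M) = \<phi> t"
    and A [measurable]: "A \<in> sets borel"
  shows "(\<integral>\<omega>. indicator A (\<tau> \<omega>) *\<^sub>R g (X (\<tau> \<omega>) \<omega>) \<partial>M) = (\<integral>\<omega>. indicator A (\<tau> \<omega>) *\<^sub>R \<phi> (\<tau> \<omega>) \<partial>M)"
proof -
  have ev: "\<A> \<subseteq> events" "\<B> \<subseteq> events"
    using indep_setD_ev1[OF indep] indep_setD_ev2[OF indep] .
  have [measurable]: "g \<in> borel_measurable borel"
    using g(1) by (rule borel_measurable_continuous_onI)
  have meas_X: "X t \<in> borel_measurable M" if "0 < t" for t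
    using X[OF that] ev by (auto intro!: measurableI)
  have [measurable]: "\<tau> \<in> borel_measurable M"
    using \<tau> ev by (auto intro!: measurableI)
  have C: "0 \<le> C" using norm_ge_zero[of "g undefined"] g(2)[of undefined] by linarith
  have int_g: "integrable M (\<lambda>\<omega>. g (X t \<omega>))" if "0 < t" for t
    using meas_X[OF that] by (intro integrable_const_bound[where B=C]) (auto simp: g)
  show ?thesis
  proof (rule integral_at_random_time[OF meas_X rc _ \<tau>0 g \<phi>])
    fix t :: real assume t: "0 < t"
    have "norm (\<integral>\<omega>. g (X t \<omega>) \<partial>M) \<le> (\<integral>\<omega>. C \<partial>M)"
      using int_g[OF t] g(2) by (intro order_trans[OF integral_norm_bound] integral_mono) auto
    then show "norm (\<phi> t) \<le> C"
      by (simp add: eq[OF t] prob_space)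
  next
    fix t :: real and B :: "real set" assume t: "0 < t" and [measurable]: "B \<in> sets borel"
    have [measurable]: "X t \<in> borel_measurable M" by (rule meas_X[OF t])
    have ind_eq: "indicator B x *\<^sub>R z = of_real (indicator B x) * z" for x and z :: 'c
      by (simp add: indicator_def)
    have "(\<integral>\<omega>. of_real (indicator B (\<tau> \<omega>)) * g (X t \<omega>) \<partial>M)
        = (\<integral>\<omega>. of_real (indicator B (\<tau> \<omega>)) \<partial>M) * (\<integral>\<omega>. g (X t \<omega>) \<partial>M)"
    proof (rule indep_set_integral_mult[OF indep \<tau> X[OF t], where f="\<lambda>x. of_real (indicator B x)"])
      show "integrable M (\<lambda>\<omega>. of_real (indicator B (\<tau> \<omega>)) :: 'c)"
        by (rule integrable_const_bound[where B=1]) (auto simp: indicator_def)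
    qed (use int_g[OF t] in auto)
    also have "\<dots> = (\<integral>\<omega>. of_real (indicator B (\<tau> \<omega>)) * \<phi> t \<partial>M)"
      by (simp add: eq[OF t])
    finally show "(\<integral>\<omega>. indicator B (\<tau> \<omega>) *\<^sub>R g (X t \<omega>) \<partial>M) = (\<integral>\<omega>. indicator B (\<tau> \<omega>) *\<^sub>R \<phi> t \<partial>M)"
      by (simp only: ind_eq)
  qed auto
qed

text \<open>Induction from the outside in: the new innermost process supplies a random time
  independent of the composition of the others. Laplace exponents therefore compose, and raising
  \<open>\<mu> powr (\<nu> ^ r)\<close> to the power \<open>\<nu>\<close> adds one to the exponent
  of \<open>\<nu>\<close>.\<close>

lemma (in prob_space) iterated_laplace:
  assumes \<nu>: "0 < \<nu>"
    and X: "\<And>k. k \<in> {1..r} \<Longrightarrow> stable_subordinator M \<nu> (X k)"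
    and indep: "indep_sets (\<lambda>k. process_events M {0..} (X k)) {1..r}"
    and "0 \<le> t" "0 < \<mu>"
  shows "(\<integral>\<omega>. exp (- \<mu> * iterated_process X r t \<omega>) \<partial>M) = exp (- t * \<mu> powr (\<nu> ^ r))"
  using X indep \<open>0 \<le> t\<close> \<open>0 < \<mu>\<close>
proof (induction r arbitrary: t)
  case 0
  then show ?case by (simp add: prob_space mult.commute)
next
  case (Suc r)
  \<comment> \<open>The family is split into the innermost subordinator and all the others; grouping
    preserves independence of the generated sigma-algebras.\<close>
  let ?I = "case_bool {Suc r} {1..r}"
  let ?E = "\<lambda>k. process_events M {0..} (X k)"
  have "indep_sets (\<lambda>b. sigma_sets (space M) (\<Union>k\<in>?I b. ?E k)) UNIV"
  proof (rule indep_sets_collect_sigma)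
    have "(\<Union>b\<in>UNIV. ?I b) = {1..Suc r}"
      by (auto simp: UNIV_bool)
    then show "indep_sets ?E (\<Union>b\<in>UNIV. ?I b)"
      using Suc.prems(2) by simp
    show "disjoint_family_on ?I UNIV"
      by (auto simp: disjoint_family_on_def split: bool.splits)
  qed (rule Int_stable_process_events)
  then have indep2: "indep_set (?E (Suc r)) (sigma_sets (space M) (\<Union>k\<in>{1..r}. ?E k))"
    unfolding indep_set_def
    by (rule indep_sets_cong[THEN iffD1, rotated -1])
       (auto simp: sigma_sets_process_events split: bool.split)
  have tc: "time_change (\<lambda>t. X k t \<omega>)" if "k \<in> {1..Suc r}" "\<omega> \<in> space M" for k \<omega>
    by (rule stable_subordinator_time_change[OF Suc.prems(1)[OF that(1)] that(2)])
  have tc_iter: "time_change (\<lambda>t. iterated_process X r t \<omega>)" if "\<omega> \<in> space M" for \<omega>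
    using tc[OF _ that] by (intro time_change_iterated) auto
  define N where "N = sigma (space M) (\<Union>k\<in>{1..r}. ?E k)"
  have space_N: "space N = space M"
    unfolding N_def using process_events_subset by (intro space_measure_of) fast
  have sets_N: "sets N = sigma_sets (space M) (\<Union>k\<in>{1..r}. ?E k)"
    unfolding N_def using process_events_subset by (intro sets_measure_of) fast
  have iter_N: "iterated_process X r s \<in> borel_measurable N" if "0 \<le> s" for s
  proof (rule measurable_iterated)
    fix k and u :: real assume "k \<in> {1..r}" "0 \<le> u"
    then have "X k u -` S \<inter> space M \<in> sets N" if "S \<in> sets borel" for S
      unfolding sets_N using that by (intro sigma_sets.Basic UN_I[of k] process_event_at) auto
    then show "X k u \<in> borel_measurable N"
      by (intro measurableI) (auto simp: space_N)
  qed (use tc that in \<open>auto simp: space_N\<close>)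
  define \<mu>' where "\<mu>' = \<mu> powr (\<nu> ^ r)"
  have \<mu>': "\<mu>' > 0" using Suc.prems by (simp add: \<mu>'_def)
  have XSuc: "stable_subordinator M \<nu> (X (Suc r))"
    using Suc.prems(1) by simp
  have X_nonneg: "0 \<le> X (Suc r) t \<omega>" if "\<omega> \<in> space M" for \<omega>
    using time_change_nonneg[OF tc[OF _ that]] Suc.prems(3) by simp
  \<comment> \<open>The test function has to be bounded on the whole real line, hence
    \<open>max 0\<close>; on the nonnegative values of the process it changes nothing.\<close>
  have "(\<integral>\<omega>. indicator UNIV (X (Suc r) t \<omega>) *\<^sub>R exp (- \<mu> * max 0 (iterated_process X r (X (Suc r) t \<omega>) \<omega>)) \<partial>M)
      = (\<integral>\<omega>. indicator UNIV (X (Suc r) t \<omega>) *\<^sub>R exp (- X (Suc r) t \<omega> * \<mu>') \<partial>M)"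
  proof (rule integral_at_independent_time[where X="iterated_process X r" and \<tau>="X (Suc r) t"
        and g="\<lambda>x. exp (- \<mu> * max 0 x)" and \<phi>="\<lambda>s. exp (- s * \<mu>')" and C=1, OF indep2])
    fix s :: real and S :: "real set" assume "0 < s" "S \<in> sets borel"
    then show "iterated_process X r s -` S \<inter> space M \<in> sigma_sets (space M) (\<Union>k\<in>{1..r}. ?E k)"
      using measurable_sets[OF iter_N, of s S] by (simp add: sets_N space_N)
  next
    fix s :: real and \<omega> assume "\<omega> \<in> space M" "0 \<le> s"
    then show "continuous (at_right s) (\<lambda>s. iterated_process X r s \<omega>)"
      using time_change_right_continuous[OF tc_iter] by blast
  next
    fix s :: real assume s: "0 < s"
    have "(\<integral>\<omega>. exp (- \<mu> * max 0 (iterated_process X r s \<omega>)) \<partial>M) = (\<integral>\<omega>. exp (- \<mu> * iterated_process X r s \<omega>) \<partial>M)"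
      using time_change_nonneg[OF tc_iter] s
      by (intro Bochner_Integration.integral_cong) (auto simp: max_def)
    also have "\<dots> = exp (- s * \<mu>')"
      unfolding \<mu>'_def
    proof (rule Suc.IH)
      show "indep_sets (\<lambda>k. process_events M {0..} (X k)) {1..r}"
        using Suc.prems(2) by (rule indep_sets_mono_index[rotated]) auto
    qed (use Suc.prems s in auto)
    finally show "(\<integral>\<omega>. exp (- \<mu> * max 0 (iterated_process X r s \<omega>)) \<partial>M) = exp (- s * \<mu>')" .
  next
    show "continuous_on UNIV (\<lambda>x. exp (- \<mu> * max 0 x))"
      by (intro continuous_intros)
  qed (use Suc.prems X_nonneg in \<open>auto intro!: process_event_at continuous_intros\<close>)
  also have "\<dots> = (\<integral>\<omega>. exp (- \<mu>' * X (Suc r) t \<omega>) \<partial>M)"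
    by (simp add: mult.commute)
  also have "\<dots> = exp (- t * \<mu>' powr \<nu>)"
    by (rule stable_subordinator_laplace[OF XSuc Suc.prems(3) \<mu>'])
  also have "\<mu>' powr \<nu> = \<mu> powr (\<nu> ^ Suc r)"
    by (simp add: \<mu>'_def powr_powr mult.commute)
  also have "(\<integral>\<omega>. indicator UNIV (X (Suc r) t \<omega>) *\<^sub>R exp (- \<mu> * max 0 (iterated_process X r (X (Suc r) t \<omega>) \<omega>)) \<partial>M)
      = (\<integral>\<omega>. exp (- \<mu> * iterated_process X (Suc r) t \<omega>) \<partial>M)"
    using time_change_nonneg[OF tc_iter X_nonneg]
    by (intro Bochner_Integration.integral_cong) (auto simp: max_def)
  finally show ?case .
qed

section \<open>The mixture of iterated stable subordinators\<close>

locale stable_mixture = prob_space M for M :: "'a measure" +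
  fixes m r :: nat and \<nu> lam :: "nat \<Rightarrow> real" and H :: "nat \<Rightarrow> nat \<Rightarrow> real \<Rightarrow> 'a \<Rightarrow> real"
  assumes m_pos: "1 \<le> m"
    and \<nu>_pos: "\<And>j. j \<in> {1..m} \<Longrightarrow> 0 < \<nu> j"
    and lam_pos: "\<And>j. j \<in> {1..m} \<Longrightarrow> 0 < lam j"
    and subordinator: "\<And>k j. k \<in> {1..r} \<Longrightarrow> j \<in> {1..m} \<Longrightarrow> stable_subordinator M (\<nu> j) (H k j)"
    and indep_H: "indep_vars (\<lambda>_. PiM {0..} (\<lambda>_. borel))
           (\<lambda>(k, j). sample_path {0..} (H k j)) ({1..r} \<times> {1..m})"
begin

text \<open>The root of order \<open>\<nu> j ^ r\<close> is forced by the r-fold composition: it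
  makes the coefficient of the j-th term of the Laplace exponent exactly \<open>lam j\<close>. For
  \<open>r \<ge> 1\<close> the root of order \<open>\<nu> j\<close> would produce
  \<open>lam j powr (\<nu> j ^ (r - 1))\<close> instead.\<close>

definition scale :: "nat \<Rightarrow> real" where
  "scale j = lam j powr (1 / \<nu> j ^ r)"

definition Y :: "real \<Rightarrow> 'a \<Rightarrow> real" where
  "Y = mixed_subordinator scale m r H"

definition laplace_exponent :: "real \<Rightarrow> real" where
  "laplace_exponent \<mu> = (\<Sum>j=1..m. lam j * \<mu> powr (\<nu> j ^ r))"

lemma laplace_exponent_pos: "0 < \<mu> \<Longrightarrow> 0 < laplace_exponent \<mu>"
  unfolding laplace_exponent_def using m_pos lam_pos by (intro sum_pos) auto

lemma scale_pos: "j \<in> {1..m} \<Longrightarrow> 0 < scale j"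
  using lam_pos by (force simp: scale_def)

lemma time_change_summand:
  assumes "j \<in> {1..m}" "\<omega> \<in> space M"
  shows "time_change (\<lambda>t. iterated_process (\<lambda>k. H k j) r t \<omega>)"
  using assms by (intro time_change_iterated stable_subordinator_time_change[OF subordinator])

lemma time_change_Y: "\<omega> \<in> space M \<Longrightarrow> time_change (\<lambda>t. Y t \<omega>)"
  unfolding Y_def mixed_subordinator_def
  by (intro time_change_sum time_change_summand less_imp_le[OF scale_pos])

lemma measurable_summand:
  assumes "j \<in> {1..m}" "0 \<le> t"
  shows "iterated_process (\<lambda>k. H k j) r t \<in> borel_measurable M"
  using assms stable_subordinator_measurable[OF subordinator] stable_subordinator_time_change[OF subordinator]
  by (intro measurable_iterated) auto

lemma measurable_Y [measurable]: "0 \<le> t \<Longrightarrow> Y t \<in> borel_measurable M"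
  unfolding Y_def mixed_subordinator_def[abs_def]
  by (intro borel_measurable_sum borel_measurable_times measurable_summand) auto

lemma measurable_pair_Y [measurable]:
  "(\<lambda>(t, \<omega>). Y (max 0 t) \<omega>) \<in> borel_measurable (borel \<Otimes>\<^sub>M M)"
  by (rule measurable_right_continuous_process)
     (auto intro: time_change_right_continuous[OF time_change_Y])

lemma strict_mono_Y: "AE \<omega> in M. strict_mono_on {0..} (\<lambda>t. Y t \<omega>)"
proof -
  have "AE \<omega> in M. \<forall>p\<in>{1..r} \<times> {1..m}. strict_mono_on {0..} (\<lambda>t. H (fst p) (snd p) t \<omega>)"
    by (intro AE_finite_allI) (auto intro!: stable_subordinator_strict_mono[OF subordinator] \<nu>_pos)
  with AE_space show ?thesis
  proof eventually_elim
    case (elim \<omega>)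
    have iter: "strict_mono_on {0..} (\<lambda>t. iterated_process (\<lambda>k. H k j) r t \<omega>)" if "j \<in> {1..m}" for j
    proof (rule strict_mono_on_iterated)
      fix k assume k: "k \<in> {1..r}"
      then show "time_change (\<lambda>t. H k j t \<omega>)"
        using that elim(1) by (intro stable_subordinator_time_change[OF subordinator])
      have "(k, j) \<in> {1..r} \<times> {1..m}" using k that by simp
      from elim(2)[rule_format, OF this] show "strict_mono_on {0..} (\<lambda>t. H k j t \<omega>)" by simp
    qed
    show ?case
      unfolding strict_mono_on_def Y_def mixed_subordinator_def
      using iter scale_pos m_pos
      by (intro allI impI sum_strict_mono) (auto simp: strict_mono_on_def)
  qed
qed

lemma indep_process_events:
  "indep_sets (\<lambda>(k, j). process_events M {0..} (H k j)) ({1..r} \<times> {1..m})"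
proof -
  have "indep_sets (\<lambda>p. {(case p of (k, j) \<Rightarrow> sample_path {0..} (H k j)) -` A \<inter> space M | A. A \<in> sets (PiM {0..} (\<lambda>_. borel))})
      ({1..r} \<times> {1..m})"
    using indep_H unfolding indep_vars_def2 by blast
  then show ?thesis
    by (rule indep_sets_cong[THEN iffD1, rotated -1]) (auto simp: process_events_eq)
qed

lemma laplace_summand:
  assumes j: "j \<in> {1..m}" and "0 \<le> t" "0 < \<mu>"
  shows "(\<integral>\<omega>. exp (- \<mu> * iterated_process (\<lambda>k. H k j) r t \<omega>) \<partial>M) = exp (- t * \<mu> powr (\<nu> j ^ r))"
proof (rule iterated_laplace[OF \<nu>_pos[OF j] subordinator])
  \<comment> \<open>Groups consisting of one pair each serve to reindex the doubly indexed family by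
    \<open>k\<close> alone.\<close>
  have "indep_sets (\<lambda>k. sigma_sets (space M) (\<Union>p\<in>{(k, j)}. case p of (k, j) \<Rightarrow> process_events M {0..} (H k j))) {1..r}"
  proof (rule indep_sets_collect_sigma)
    show "indep_sets (\<lambda>(k, j). process_events M {0..} (H k j)) (\<Union>k\<in>{1..r}. {(k, j)})"
      by (rule indep_sets_mono_index[OF _ indep_process_events]) (use j in auto)
  qed (auto simp: disjoint_family_on_def Int_stable_process_events)
  then show "indep_sets (\<lambda>k. process_events M {0..} (H k j)) {1..r}"
    by (simp add: sigma_sets_process_events)
qed (use assms in auto)

text \<open>Grouping the pairs \<open>(k, j)\<close> by \<open>j\<close> gives independent
  sigma-algebras, and the j-th iterated process is measurable with respect to the one generated by
  its own column.\<close>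

lemma indep_summands:
  assumes "0 \<le> t"
  shows "indep_vars (\<lambda>_. borel) (\<lambda>j. iterated_process (\<lambda>k. H k j) r t) {1..m}"
  unfolding indep_vars_def2
proof (intro conjI ballI)
  fix j assume "j \<in> {1..m}"
  then show "random_variable borel (iterated_process (\<lambda>k. H k j) r t)"
    by (rule measurable_summand[OF _ assms])
next
  let ?E = "\<lambda>(k, j). process_events M {0..} (H k j)"
  let ?I = "\<lambda>j. {1..r} \<times> {j}"
  have "indep_sets (\<lambda>j. sigma_sets (space M) (\<Union>p\<in>?I j. ?E p)) {1..m}"
  proof (rule indep_sets_collect_sigma)
    show "indep_sets ?E (\<Union>j\<in>{1..m}. ?I j)"
      by (rule indep_sets_mono_index[OF _ indep_process_events]) auto
  qed (auto simp: disjoint_family_on_def Int_stable_process_events)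
  then show "indep_sets (\<lambda>j. {iterated_process (\<lambda>k. H k j) r t -` A \<inter> space M | A. A \<in> sets borel}) {1..m}"
  proof (rule indep_sets_mono_sets)
    fix j assume j: "j \<in> {1..m}"
    define N where "N = sigma (space M) (\<Union>p\<in>?I j. ?E p)"
    have sub: "(\<Union>p\<in>?I j. ?E p) \<subseteq> Pow (space M)"
      using process_events_subset by fast
    have space_N: "space N = space M"
      unfolding N_def by (rule space_measure_of[OF sub])
    have sets_N: "sets N = sigma_sets (space M) (\<Union>p\<in>?I j. ?E p)"
      unfolding N_def by (rule sets_measure_of[OF sub])
    have "iterated_process (\<lambda>k. H k j) r t \<in> borel_measurable N"
    proof (rule measurable_iterated[OF _ _ assms])
      fix k and u :: real assume k: "k \<in> {1..r}" and u: "0 \<le> u"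
      have "H k j u -` S \<inter> space M \<in> sets N" if "S \<in> sets borel" for S
        unfolding sets_N using that k u process_event_at[of u "{0..}" S "H k j" M]
        by (intro sigma_sets.Basic UN_I[of "(k, j)"]) auto
      then show "H k j u \<in> borel_measurable N"
        by (intro measurableI) (auto simp: space_N)
    next
      fix k \<omega> assume "k \<in> {1..r}" "\<omega> \<in> space N"
      then show "time_change (\<lambda>t. H k j t \<omega>)"
        using j by (intro stable_subordinator_time_change[OF subordinator]) (auto simp: space_N)
    qed
    then have "iterated_process (\<lambda>k. H k j) r t -` A \<inter> space M \<in> sets N" if "A \<in> sets borel" for A
      using measurable_sets[OF _ that] by (metis space_N)
    then show "{iterated_process (\<lambda>k. H k j) r t -` A \<inter> space M | A. A \<in> sets borel}
        \<subseteq> sigma_sets (space M) (\<Union>p\<in>?I j. ?E p)"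
      unfolding sets_N by blast
  qed
qed

lemma laplace_Y:
  assumes t: "0 \<le> t" and \<mu>: "0 < \<mu>"
  shows "(\<integral>\<omega>. exp (- \<mu> * Y t \<omega>) \<partial>M) = exp (- t * laplace_exponent \<mu>)"
proof -
  let ?Z = "\<lambda>j. iterated_process (\<lambda>k. H k j) r t"
  have indep: "indep_vars (\<lambda>_. borel) (\<lambda>j \<omega>. exp (- (\<mu> * scale j) * ?Z j \<omega>)) {1..m}"
    by (rule indep_vars_compose2[OF indep_summands[OF t]]) measurable
  have "(\<integral>\<omega>. exp (- \<mu> * Y t \<omega>) \<partial>M) = (\<integral>\<omega>. (\<Prod>j=1..m. exp (- (\<mu> * scale j) * ?Z j \<omega>)) \<partial>M)"
    by (simp add: Y_def mixed_subordinator_def exp_sum[symmetric] sum_distrib_left sum_negf mult.assoc)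
  also have "\<dots> = (\<Prod>j=1..m. \<integral>\<omega>. exp (- (\<mu> * scale j) * ?Z j \<omega>) \<partial>M)"
  proof (rule indep_vars_lebesgue_integral[OF _ indep])
    fix j assume j: "j \<in> {1..m}"
    have "0 \<le> \<mu> * scale j * ?Z j \<omega>" if "\<omega> \<in> space M" for \<omega>
      using time_change_nonneg[OF time_change_summand[OF j that] t] scale_pos[OF j] \<mu> by simp
    then show "integrable M (\<lambda>\<omega>. exp (- (\<mu> * scale j) * ?Z j \<omega>))"
      using measurable_summand[OF j t]
      by (intro integrable_const_bound[where B=1]) auto
  qed simp
  also have "\<dots> = (\<Prod>j=1..m. exp (- t * (lam j * \<mu> powr (\<nu> j ^ r))))"
  proof (intro prod.cong refl)
    fix j assume j: "j \<in> {1..m}"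
    have "(\<mu> * scale j) powr (\<nu> j ^ r) = lam j * \<mu> powr (\<nu> j ^ r)"
      using \<mu> \<nu>_pos[OF j] lam_pos[OF j] by (simp add: scale_def powr_mult powr_powr)
    then show "(\<integral>\<omega>. exp (- (\<mu> * scale j) * ?Z j \<omega>) \<partial>M) = exp (- t * (lam j * \<mu> powr (\<nu> j ^ r)))"
      using laplace_summand[OF j t, of "\<mu> * scale j"] scale_pos[OF j] \<mu> by simp
  qed
  also have "\<dots> = exp (- t * laplace_exponent \<mu>)"
    by (simp add: laplace_exponent_def exp_sum[symmetric] sum_distrib_left sum_negf)
  finally show ?thesis .
qed

text \<open>An exponential Markov bound: the probability that \<open>Y\<close> stays below
  \<open>n\<close> at all positive integer times is at most \<open>exp n\<close> times the Laplace
  transform at parameter 1 and time \<open>Suc k\<close>, which tends to 0. This makes the infimum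
  defining the inverse process run over a nonempty set almost surely.\<close>

lemma Y_unbounded: "AE \<omega> in M. \<forall>x. \<exists>s>0. x \<le> Y s \<omega>"
proof -
  have "AE \<omega> in M. \<exists>s>0. real n \<le> Y s \<omega>" for n :: nat
  proof -
    let ?A = "{\<omega> \<in> space M. \<forall>k::nat. Y (Suc k) \<omega> < real n}"
    have [measurable]: "?A \<in> sets M"
      by measurable
    have bound: "prob ?A \<le> exp (real n) * exp (- real (Suc k) * laplace_exponent 1)" for k
    proof -
      have "prob ?A = (\<integral>\<omega>. indicator ?A \<omega> \<partial>M)"
        by simp
      also have "\<dots> \<le> (\<integral>\<omega>. exp (real n) * exp (- 1 * Y (Suc k) \<omega>) \<partial>M)"
      proof (rule integral_mono)
        show "integrable M (indicator ?A :: 'a \<Rightarrow> real)"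
          by (rule integrable_real_indicator) (auto simp: less_top[symmetric])
        have "0 \<le> Y (Suc k) \<omega>" if "\<omega> \<in> space M" for \<omega>
          using time_change_nonneg[OF time_change_Y[OF that]] by simp
        then show "integrable M (\<lambda>\<omega>. exp (real n) * exp (- 1 * Y (Suc k) \<omega>))"
          by (intro integrable_mult_right integrable_const_bound[where B=1]) auto
        fix \<omega>
        show "indicator ?A \<omega> \<le> exp (real n) * exp (- 1 * Y (Suc k) \<omega>)"
          by (auto simp: indicator_def mult_exp_exp less_imp_le)
      qed
      also have "\<dots> = exp (real n) * exp (- real (Suc k) * laplace_exponent 1)"
        using laplace_Y[of "real (Suc k)" 1] by (simp del: of_nat_Suc)
      finally show ?thesis .
    qed
    have lim: "(\<lambda>k. exp (real n) * exp (- real (Suc k) * laplace_exponent 1)) \<longlonglongrightarrow> exp (real n) * 0"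
    proof (intro tendsto_intros)
      have "(\<lambda>k. exp (- laplace_exponent 1) ^ Suc k) \<longlonglongrightarrow> 0"
        using laplace_exponent_pos[of 1] by (intro LIMSEQ_Suc LIMSEQ_power_zero) simp
      then show "(\<lambda>k. exp (- real (Suc k) * laplace_exponent 1)) \<longlonglongrightarrow> 0"
        by (simp add: exp_of_nat_mult[symmetric] del: of_nat_Suc power_Suc)
    qed
    have "prob ?A \<le> exp (real n) * 0"
      by (rule LIMSEQ_le_const[OF lim]) (use bound in blast)
    then have "prob ?A = 0"
      by (simp add: measure_le_0_iff)
    then have "AE \<omega> in M. \<omega> \<notin> ?A"
      by (subst (asm) prob_eq_0) auto
    with AE_space show ?thesis
    proof eventually_elim
      case (elim \<omega>)
      then obtain k :: nat where "real n \<le> Y (Suc k) \<omega>" by (auto simp: not_less)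
      then show ?case by (intro exI[of _ "real (Suc k)"]) auto
    qed
  qed
  then have "AE \<omega> in M. \<forall>n::nat. \<exists>s>0. real n \<le> Y s \<omega>"
    by (simp add: AE_all_countable)
  then show ?thesis
  proof eventually_elim
    case (elim \<omega>)
    show ?case
    proof
      fix x :: real
      obtain n :: nat where "x \<le> real n" using real_arch_simple by blast
      then show "\<exists>s>0. x \<le> Y s \<omega>" using elim order_trans by blast
    qed
  qed
qed

end

section \<open>Inverse subordinators\<close>

lemma inverse_process_nonneg: "0 \<le> inverse_process Y t \<omega>"
  unfolding inverse_process_def by (auto intro: cInf_greatest)

lemma inverse_process_le:
  assumes "0 < s" "t \<le> Y s \<omega>"
  shows "inverse_process Y t \<omega> \<le> s"
  unfolding inverse_process_def using assms
  by (auto intro!: cInf_lower bdd_belowI[of _ 0])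

lemma less_inverse_process:
  assumes "0 < s" "s < inverse_process Y t \<omega>"
  shows "Y s \<omega> < t"
  using assms inverse_process_le[of s t Y \<omega>] by (auto simp: not_less[symmetric])

text \<open>Monotonicity of the path alone yields this weak converse of
  \<open>less_inverse_process\<close>. The case of equality concerns one value of \<open>s\<close>,
  which is negligible when integrating over \<open>s\<close>.\<close>

lemma le_inverse_process:
  assumes tc: "time_change (\<lambda>t. Y t \<omega>)" and ex: "\<exists>s>0. t \<le> Y s \<omega>" and s: "0 \<le> s" "Y s \<omega> < t"
  shows "s \<le> inverse_process Y t \<omega>"
proof -
  have "s \<le> u" if "0 < u" "t \<le> Y u \<omega>" for u
    using time_change_mono[OF tc, of u s] that s by force
  then show ?thesis
    unfolding inverse_process_def using ex by (auto intro!: cInf_greatest)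
qed

text \<open>The path starts at 0 and is right-continuous there, so it stays below \<open>t\<close>
  on an initial interval, which the first passage cannot precede.\<close>

lemma inverse_process_pos:
  assumes tc: "time_change (\<lambda>t. Y t \<omega>)" and ex: "\<exists>s>0. t \<le> Y s \<omega>" and t: "0 < t"
  shows "0 < inverse_process Y t \<omega>"
proof -
  have "((\<lambda>s. Y s \<omega>) \<longlongrightarrow> Y 0 \<omega>) (at_right 0)"
    using time_change_right_continuous[OF tc order.refl] by (simp add: continuous_within)
  moreover have "Y 0 \<omega> < t"
    using tc t by (simp add: time_change_def)
  ultimately have "\<forall>\<^sub>F s in at_right 0. Y s \<omega> < t"
    by (rule order_tendstoD(2))
  then obtain b where b: "0 < b" "\<And>s. 0 < s \<Longrightarrow> s < b \<Longrightarrow> Y s \<omega> < t"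
    unfolding eventually_at_right[OF zero_less_one] by auto
  have "b / 2 \<le> inverse_process Y t \<omega>"
    using b by (intro le_inverse_process[where Y=Y and \<omega>=\<omega>, OF tc ex]) auto
  then show ?thesis using b(1) by linarith
qed

lemma inverse_process_0:
  assumes tc: "time_change (\<lambda>t. Y t \<omega>)"
  shows "inverse_process Y 0 \<omega> = 0"
proof (rule antisym)
  show "inverse_process Y 0 \<omega> \<le> 0"
    by (rule field_le_epsilon) (auto intro!: inverse_process_le time_change_nonneg[OF tc])
qed (rule inverse_process_nonneg)

text \<open>A jump of the inverse would come from a flat stretch of the path, and strict
  monotonicity excludes these. Jumps of the path do no harm: they become flat stretches of the
  inverse.\<close>

lemma continuous_on_inverse_process:
  assumes tc: "time_change (\<lambda>t. Y t \<omega>)" and strict: "strict_mono_on {0..} (\<lambda>t. Y t \<omega>)"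
    and ex: "\<And>x. \<exists>s>0. x \<le> Y s \<omega>"
  shows "continuous_on {0..} (\<lambda>t. inverse_process Y t \<omega>)"
  unfolding continuous_on_def
proof
  fix t :: real assume t: "t \<in> {0..}"
  define l where "l = inverse_process Y t \<omega>"
  have l: "0 \<le> l" by (simp add: l_def inverse_process_nonneg)
  show "((\<lambda>t. inverse_process Y t \<omega>) \<longlongrightarrow> inverse_process Y t \<omega>) (at t within {0..})"
  proof (rule order_tendstoI)
    fix a assume a: "inverse_process Y t \<omega> < a"
    define u where "u = (l + a) / 2"
    have u: "l < u" "u < a" using a by (auto simp: u_def l_def)
    \<comment> \<open>At the midpoint, to the right of \<open>l\<close>, the path has already
      reached \<open>t\<close>; strict growth up to \<open>u\<close> then gives
      \<open>t < Y u \<omega>\<close>, a condition that persists for nearby times.\<close>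
    have "\<not> Y ((l + u) / 2) \<omega> < t"
      using le_inverse_process[where Y=Y and \<omega>=\<omega>, OF tc ex, of "(l + u) / 2" t] l u by (auto simp: l_def[symmetric])
    moreover have "Y ((l + u) / 2) \<omega> < Y u \<omega>"
      using strict l u by (auto simp: strict_mono_on_def)
    ultimately have "t < Y u \<omega>" by linarith
    then have "\<forall>\<^sub>F x in at t within {0..}. x < Y u \<omega>"
      using tendsto_ident_at by (rule order_tendstoD(2)[rotated])
    then show "\<forall>\<^sub>F x in at t within {0..}. inverse_process Y x \<omega> < a"
    proof eventually_elim
      case (elim x)
      then have "inverse_process Y x \<omega> \<le> u"
        using l u by (intro inverse_process_le) auto
      then show ?case using u by linarith
    qed
  next
    fix a assume a: "a < inverse_process Y t \<omega>"
    show "\<forall>\<^sub>F x in at t within {0..}. a < inverse_process Y x \<omega>"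
    proof (cases "a < 0")
      case True
      then show ?thesis
        using inverse_process_nonneg by (intro always_eventually allI) (rule less_le_trans)
    next
      case False
      define u where "u = (l + a) / 2"
      have u: "a < u" "u < l" using a by (auto simp: u_def l_def)
      then have "Y u \<omega> < t"
        using False by (intro less_inverse_process[where s=u and t=t and Y=Y and \<omega>=\<omega>]) (auto simp: l_def)
      then have "\<forall>\<^sub>F x in at t within {0..}. Y u \<omega> < x"
        using tendsto_ident_at by (rule order_tendstoD(1)[rotated])
      then show ?thesis
      proof eventually_elim
        case (elim x)
        then have "u \<le> inverse_process Y x \<omega>"
          using False u by (intro le_inverse_process[where Y=Y and \<omega>=\<omega>, OF tc ex]) auto
        then show ?case using u by linarith
      qed
    qed
  qed
qed

lemma nn_integral_exp_Ioi:
  assumes "0 < a"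
  shows "(\<integral>\<^sup>+t. ennreal (exp (- a * t)) * indicator {y<..} t \<partial>lborel) = ennreal (exp (- a * y) / a)"
proof -
  have "(\<integral>\<^sup>+t. ennreal (exp (- a * t)) * indicator {y<..} t \<partial>lborel)
      = (\<integral>\<^sup>+t. ennreal (exp (- a * t)) * indicator {y..} t \<partial>lborel)"
    using AE_lborel_singleton[of y]
    by (intro nn_integral_cong_AE) (auto elim!: eventually_mono simp: indicator_def)
  also have "\<dots> = ennreal (0 - (- exp (- a * y) / a))"
  proof (rule nn_integral_FTC_atLeast)
    show "DERIV (\<lambda>t. - exp (- a * t) / a) x :> exp (- a * x)" for x
      using assms by (auto intro!: derivative_eq_intros)
    have "filterlim (\<lambda>t. - a * t) at_bot at_top"
      by (rule filterlim_tendsto_neg_mult_at_bot[OF tendsto_const _ filterlim_ident]) (use assms in simp)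
    then have lim: "((\<lambda>t. exp (- a * t)) \<longlongrightarrow> 0) at_top"
      by (rule filterlim_compose[OF exp_at_bot])
    have "((\<lambda>t. - exp (- a * t) / a) \<longlongrightarrow> - 0 / a) at_top"
      using assms by (intro tendsto_divide tendsto_minus lim tendsto_const) simp
    then show "((\<lambda>t. - exp (- a * t) / a) \<longlongrightarrow> 0) at_top" by simp
  qed auto
  finally show ?thesis by simp
qed

lemma nn_integral_exp_Ioo:
  assumes "0 \<le> \<kappa>" "0 \<le> l"
  shows "(\<integral>\<^sup>+s. ennreal (\<kappa> * exp (- \<kappa> * s)) * indicator {0<..<l} s \<partial>lborel) = ennreal (1 - exp (- \<kappa> * l))"
proof -
  have "(\<integral>\<^sup>+s. ennreal (\<kappa> * exp (- \<kappa> * s)) * indicator {0<..<l} s \<partial>lborel)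
      = (\<integral>\<^sup>+s. ennreal (\<kappa> * exp (- \<kappa> * s)) * indicator {0..l} s \<partial>lborel)"
    using AE_lborel_singleton[of "0::real"] AE_lborel_singleton[of l]
    by (intro nn_integral_cong_AE) (auto elim!: eventually_elim2 simp: indicator_def)
  also have "\<dots> = ennreal (- exp (- \<kappa> * l) - (- exp (- \<kappa> * 0)))"
  proof (rule nn_integral_FTC_Icc)
    show "((\<lambda>s. - exp (- \<kappa> * s)) has_real_derivative \<kappa> * exp (- \<kappa> * x)) (at x)" for x
      by (auto intro!: derivative_eq_intros)
  qed (use assms in auto)
  finally show ?thesis by simp
qed

section \<open>The Laplace transform in time of the inverse subordinator\<close>

context stable_mixture
begin

definition L :: "real \<Rightarrow> 'a \<Rightarrow> real" where
  "L = inverse_process Y"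

lemma L_nonneg: "0 \<le> L t \<omega>"
  unfolding L_def by (rule inverse_process_nonneg)

lemma L_0: "\<omega> \<in> space M \<Longrightarrow> L 0 \<omega> = 0"
  unfolding L_def by (intro inverse_process_0 time_change_Y)

lemma L_pos: "0 < t \<Longrightarrow> AE \<omega> in M. 0 < L t \<omega>"
  using Y_unbounded AE_space
  by eventually_elim (auto simp: L_def intro!: inverse_process_pos time_change_Y)

lemma measurable_L [measurable]: "L t \<in> borel_measurable M"
proof (rule borel_measurableI_less)
  fix s
  \<comment> \<open>A description by countably many conditions, valid for every outcome and not only
    almost surely. \<open>?A\<close> says that the level is reached at some rational time before
    \<open>s\<close>; \<open>?B\<close> is the exceptional event on which it is never reached and
    the inverse takes its default value 0.\<close>
  have "L t \<omega> < s \<longleftrightarrow> 0 < s \<and>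
      ((\<exists>q::rat. 0 < real_of_rat q \<and> real_of_rat q < s \<and> t \<le> Y (max 0 (real_of_rat q)) \<omega>) \<or>
       (\<forall>n::nat. Y (real (Suc n)) \<omega> < t))" (is "_ \<longleftrightarrow> 0 < s \<and> (?A \<or> ?B)")
    if \<omega>: "\<omega> \<in> space M" for \<omega>
  proof (cases "\<exists>u>0. t \<le> Y u \<omega>")
    case True
    then obtain u where u: "0 < u" "t \<le> Y u \<omega>" by blast
    obtain n :: nat where "u \<le> real n" using real_arch_simple by blast
    then have "Y u \<omega> \<le> Y (real (Suc n)) \<omega>"
      using u by (intro time_change_mono[OF time_change_Y[OF \<omega>]]) auto
    then have not_B: "\<not> ?B" using u by (meson not_less order_trans)
    show ?thesis
    proof
      assume less: "L t \<omega> < s"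
      have L_eq: "L t \<omega> = Inf {u. 0 < u \<and> t \<le> Y u \<omega>}"
        using True by (auto simp: L_def inverse_process_def)
      obtain v where v: "0 < v" "t \<le> Y v \<omega>" "v < s"
        using less u unfolding L_eq by (subst (asm) cInf_less_iff) (auto intro!: bdd_belowI[of _ 0])
      obtain q where q: "v < real_of_rat q" "real_of_rat q < s"
        using of_rat_dense[OF v(3)] by blast
      have "Y v \<omega> \<le> Y (real_of_rat q) \<omega>"
        using v q by (intro time_change_mono[OF time_change_Y[OF \<omega>]]) auto
      then have ?A
        using v q order.strict_trans[OF v(1) q(1)] by (intro exI[of _ q]) (auto simp: max_def)
      then show "0 < s \<and> (?A \<or> ?B)" using v by auto
    next
      assume "0 < s \<and> (?A \<or> ?B)"
      then obtain q where q: "0 < real_of_rat q" "real_of_rat q < s" "t \<le> Y (max 0 (real_of_rat q)) \<omega>"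
        using not_B by blast
      have "L t \<omega> \<le> real_of_rat q"
        unfolding L_def using q by (intro inverse_process_le) (auto simp: max_def)
      then show "L t \<omega> < s" using q by linarith
    qed
  next
    case False
    then have "L t \<omega> = 0" by (simp only: L_def inverse_process_def if_False)
    moreover have ?B using False by (auto simp: not_le)
    ultimately show ?thesis by (simp del: of_nat_Suc)
  qed
  then have "{\<omega> \<in> space M. L t \<omega> < s} = {\<omega> \<in> space M. 0 < s \<and>
      ((\<exists>q::rat. 0 < real_of_rat q \<and> real_of_rat q < s \<and> t \<le> Y (max 0 (real_of_rat q)) \<omega>) \<or>
       (\<forall>n::nat. Y (real (Suc n)) \<omega> < t))}"
    by blast
  also have "\<dots> \<in> sets M" by measurable
  finally show "{\<omega> \<in> space M. L t \<omega> < s} \<in> sets M" .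
qed

lemma one_minus_exp_L:
  assumes \<kappa>: "0 \<le> \<kappa>"
  shows "AE \<omega> in M. ennreal (1 - exp (- \<kappa> * L t \<omega>)) =
    (\<integral>\<^sup>+s. ennreal (\<kappa> * exp (- \<kappa> * s)) * indicator {s. 0 < s \<and> Y (max 0 s) \<omega> < t} s \<partial>lborel)"
  using Y_unbounded AE_space
proof eventually_elim
  case (elim \<omega>)
  have "indicator {0<..<L t \<omega>} s = (indicator {s. 0 < s \<and> Y (max 0 s) \<omega> < t} s :: ennreal)" if "s \<noteq> L t \<omega>" for s
  proof (cases "0 < s")
    case True
    have "s < L t \<omega> \<longleftrightarrow> Y s \<omega> < t"
    proof
      assume "s < L t \<omega>"
      then show "Y s \<omega> < t"
        using True unfolding L_def by (rule less_inverse_process[rotated])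
    next
      assume "Y s \<omega> < t"
      then have "s \<le> L t \<omega>"
        unfolding L_def using elim True by (intro le_inverse_process time_change_Y) auto
      then show "s < L t \<omega>" using that by simp
    qed
    then show ?thesis using True by (auto simp: indicator_def max_def)
  qed (auto simp: indicator_def)
  then have "(\<integral>\<^sup>+s. ennreal (\<kappa> * exp (- \<kappa> * s)) * indicator {0<..<L t \<omega>} s \<partial>lborel)
    = (\<integral>\<^sup>+s. ennreal (\<kappa> * exp (- \<kappa> * s)) * indicator {s. 0 < s \<and> Y (max 0 s) \<omega> < t} s \<partial>lborel)"
    using AE_lborel_singleton[of "L t \<omega>"]
    by (intro nn_integral_cong_AE) (auto elim!: eventually_mono)
  then show ?case
    using nn_integral_exp_Ioo[OF \<kappa> L_nonneg, of t \<omega>] by simp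
qed

definition L_laplace :: "real \<Rightarrow> real \<Rightarrow> real" where
  "L_laplace \<kappa> t = (\<integral>\<omega>. exp (- \<kappa> * L t \<omega>) \<partial>M)"

text \<open>With the integral over \<open>t\<close> taken innermost everything is explicit:
  integrating \<open>exp (- \<mu> * t)\<close> above \<open>Y s\<close> gives
  \<open>exp (- \<mu> * Y s) / \<mu>\<close>, its expectation brings in
  \<open>exp (- s * \<Psi>)\<close>, and an exponential integral in \<open>s\<close>
  remains.\<close>

lemma nn_integral_L_laplace:
  assumes \<kappa>: "0 \<le> \<kappa>" and \<mu>: "0 < \<mu>"
  shows "(\<integral>\<^sup>+t. ennreal (exp (- \<mu> * t) * (1 - L_laplace \<kappa> t)) * indicator {0<..} t \<partial>lborel)
           = ennreal (\<kappa> / (\<mu> * (\<kappa> + laplace_exponent \<mu>)))"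
proof -
  interpret P: pair_sigma_finite lborel M ..
  define \<Psi> where "\<Psi> = laplace_exponent \<mu>"
  have \<Psi>: "0 < \<Psi>" using laplace_exponent_pos[OF \<mu>] by (simp add: \<Psi>_def)
  define K :: "real \<Rightarrow> real \<Rightarrow> 'a \<Rightarrow> ennreal" where
    "K t s \<omega> = (ennreal (exp (- \<mu> * t)) * indicator {0<..} t) *
       (ennreal (\<kappa> * exp (- \<kappa> * s)) * indicator {s. 0 < s \<and> Y (max 0 s) \<omega> < t} s)" for t s \<omega>
  have Y1 [measurable]: "(\<lambda>p. Y (max 0 (snd (fst p))) (snd p)) \<in> borel_measurable ((borel \<Otimes>\<^sub>M borel) \<Otimes>\<^sub>M M)"
    using measurable_compose[OF _ measurable_pair_Y, of "\<lambda>p. (snd (fst p), snd p)" "(borel \<Otimes>\<^sub>M borel) \<Otimes>\<^sub>M M"]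
    by simp
  have K_meas [measurable]: "(\<lambda>((t, s), \<omega>). K t s \<omega>) \<in> borel_measurable ((lborel \<Otimes>\<^sub>M lborel) \<Otimes>\<^sub>M M)"
    unfolding K_def indicator_def split_beta' by measurable
  have K_ts [measurable]: "(\<lambda>(s, \<omega>). K t s \<omega>) \<in> borel_measurable (lborel \<Otimes>\<^sub>M M)" for t
    using measurable_compose[OF _ K_meas, of "\<lambda>p. ((t, fst p), snd p)" "lborel \<Otimes>\<^sub>M M"] by (simp add: split_beta')
  have K_st [measurable]: "(\<lambda>(t, \<omega>). K t s \<omega>) \<in> borel_measurable (lborel \<Otimes>\<^sub>M M)" for s
    using measurable_compose[OF _ K_meas, of "\<lambda>p. ((fst p, s), snd p)" "lborel \<Otimes>\<^sub>M M"] by (simp add: split_beta')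
  have K_int [measurable]: "(\<lambda>(t, s). \<integral>\<^sup>+\<omega>. K t s \<omega> \<partial>M) \<in> borel_measurable (lborel \<Otimes>\<^sub>M lborel)"
    using borel_measurable_nn_integral_fst[OF K_meas] by (simp add: split_beta')
  have "(\<integral>\<^sup>+t. ennreal (exp (- \<mu> * t) * (1 - L_laplace \<kappa> t)) * indicator {0<..} t \<partial>lborel)
      = (\<integral>\<^sup>+t. (\<integral>\<^sup>+\<omega>. (\<integral>\<^sup>+s. K t s \<omega> \<partial>lborel) \<partial>M) \<partial>lborel)"
  proof (rule nn_integral_cong)
    fix t :: real
    show "ennreal (exp (- \<mu> * t) * (1 - L_laplace \<kappa> t)) * indicator {0<..} t = (\<integral>\<^sup>+\<omega>. (\<integral>\<^sup>+s. K t s \<omega> \<partial>lborel) \<partial>M)"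
    proof (cases "0 < t")
      case True
      have le1: "exp (- \<kappa> * L t \<omega>) \<le> 1" for \<omega>
        using L_nonneg[of t \<omega>] \<kappa> by simp
      have int: "integrable M (\<lambda>\<omega>. exp (- \<kappa> * L t \<omega>))"
        by (rule integrable_const_bound[where B=1]) (use le1 in auto)
      have "ennreal (1 - L_laplace \<kappa> t) = ennreal (\<integral>\<omega>. 1 - exp (- \<kappa> * L t \<omega>) \<partial>M)"
        using int by (simp add: L_laplace_def prob_space)
      also have "\<dots> = (\<integral>\<^sup>+\<omega>. ennreal (1 - exp (- \<kappa> * L t \<omega>)) \<partial>M)"
        by (rule nn_integral_eq_integral[symmetric]) (use int le1 in auto)
      also have "\<dots> = (\<integral>\<^sup>+\<omega>. (\<integral>\<^sup>+s. ennreal (\<kappa> * exp (- \<kappa> * s)) * indicator {s. 0 < s \<and> Y (max 0 s) \<omega> < t} s \<partial>lborel) \<partial>M)"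
        by (rule nn_integral_cong_AE) (rule one_minus_exp_L[OF \<kappa>])
      finally have eq: "ennreal (1 - L_laplace \<kappa> t) = (\<integral>\<^sup>+\<omega>. (\<integral>\<^sup>+s. ennreal (\<kappa> * exp (- \<kappa> * s)) * indicator {s. 0 < s \<and> Y (max 0 s) \<omega> < t} s \<partial>lborel) \<partial>M)" .
      have Yt: "(\<lambda>p. ennreal (\<kappa> * exp (- \<kappa> * fst p)) * indicator {s. 0 < s \<and> Y (max 0 s) (snd p) < t} (fst p)) \<in> borel_measurable (lborel \<Otimes>\<^sub>M M)"
        using measurable_pair_Y unfolding indicator_def split_beta' by measurable
      have Ys: "(\<lambda>s. ennreal (\<kappa> * exp (- \<kappa> * s)) * indicator {s. 0 < s \<and> Y (max 0 s) \<omega> < t} s) \<in> borel_measurable lborel" if "\<omega> \<in> space M" for \<omega>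
        using measurable_compose[OF measurable_Pair2'[OF that] Yt] by simp
      have Yi: "(\<lambda>\<omega>. \<integral>\<^sup>+s. ennreal (\<kappa> * exp (- \<kappa> * s)) * indicator {s. 0 < s \<and> Y (max 0 s) \<omega> < t} s \<partial>lborel) \<in> borel_measurable M"
        using lborel.borel_measurable_nn_integral[of "\<lambda>\<omega> s. ennreal (\<kappa> * exp (- \<kappa> * s)) * indicator {s. 0 < s \<and> Y (max 0 s) \<omega> < t} s" M]
          measurable_pair_swap[OF Yt] by (simp add: split_beta')
      have "(\<integral>\<^sup>+\<omega>. (\<integral>\<^sup>+s. K t s \<omega> \<partial>lborel) \<partial>M)
          = (\<integral>\<^sup>+\<omega>. ennreal (exp (- \<mu> * t)) * (\<integral>\<^sup>+s. ennreal (\<kappa> * exp (- \<kappa> * s)) * indicator {s. 0 < s \<and> Y (max 0 s) \<omega> < t} s \<partial>lborel) \<partial>M)"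
      proof (rule nn_integral_cong)
        fix \<omega> assume \<omega>: "\<omega> \<in> space M"
        have "K t s \<omega> = ennreal (exp (- \<mu> * t)) * (ennreal (\<kappa> * exp (- \<kappa> * s)) * indicator {s. 0 < s \<and> Y (max 0 s) \<omega> < t} s)" for s
          using True by (simp add: K_def)
        then show "(\<integral>\<^sup>+s. K t s \<omega> \<partial>lborel) = ennreal (exp (- \<mu> * t)) *
            (\<integral>\<^sup>+s. ennreal (\<kappa> * exp (- \<kappa> * s)) * indicator {s. 0 < s \<and> Y (max 0 s) \<omega> < t} s \<partial>lborel)"
          by (simp only: nn_integral_cmult[OF Ys[OF \<omega>]])
      qed
      also have "\<dots> = ennreal (exp (- \<mu> * t)) * ennreal (1 - L_laplace \<kappa> t)"
        by (simp only: nn_integral_cmult[OF Yi] eq)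
      finally show ?thesis
        using True by (simp add: ennreal_mult')
    qed (simp add: K_def)
  qed
  \<comment> \<open>Three interchanges of neighbouring integrals take the order \<open>t\<close>,
    \<open>\<omega>\<close>, \<open>s\<close> to the order \<open>s\<close>,
    \<open>\<omega>\<close>, \<open>t\<close>.\<close>
  also have "\<dots> = (\<integral>\<^sup>+t. (\<integral>\<^sup>+s. (\<integral>\<^sup>+\<omega>. K t s \<omega> \<partial>M) \<partial>lborel) \<partial>lborel)"
    by (intro nn_integral_cong P.Fubini'[OF K_ts])
  also have "\<dots> = (\<integral>\<^sup>+s. (\<integral>\<^sup>+t. (\<integral>\<^sup>+\<omega>. K t s \<omega> \<partial>M) \<partial>lborel) \<partial>lborel)"
    by (rule lborel_pair.Fubini'[OF K_int, symmetric])
  also have "\<dots> = (\<integral>\<^sup>+s. (\<integral>\<^sup>+\<omega>. (\<integral>\<^sup>+t. K t s \<omega> \<partial>lborel) \<partial>M) \<partial>lborel)"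
    by (intro nn_integral_cong P.Fubini'[OF K_st, symmetric])
  also have "\<dots> = (\<integral>\<^sup>+s. ennreal (\<kappa> / \<mu>) * (ennreal (exp (- (\<kappa> + \<Psi>) * s)) * indicator {0<..} s) \<partial>lborel)"
  proof (rule nn_integral_cong)
    fix s :: real
    show "(\<integral>\<^sup>+\<omega>. (\<integral>\<^sup>+t. K t s \<omega> \<partial>lborel) \<partial>M) = ennreal (\<kappa> / \<mu>) * (ennreal (exp (- (\<kappa> + \<Psi>) * s)) * indicator {0<..} s)"
    proof (cases "0 < s")
      case True
      have [measurable]: "Y s \<in> borel_measurable M" using True by simp
      have Y0: "0 \<le> Y s \<omega>" if "\<omega> \<in> space M" for \<omega>
        using time_change_nonneg[OF time_change_Y[OF that]] True by simp
      have int: "integrable M (\<lambda>\<omega>. exp (- \<mu> * Y s \<omega>))"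
        by (rule integrable_const_bound[where B=1]) (use Y0 \<mu> in auto)
      have "(\<integral>\<^sup>+t. K t s \<omega> \<partial>lborel) = ennreal (\<kappa> * exp (- \<kappa> * s) / \<mu>) * ennreal (exp (- \<mu> * Y s \<omega>))" if "\<omega> \<in> space M" for \<omega>
      proof -
        have "K t s \<omega> = ennreal (\<kappa> * exp (- \<kappa> * s)) * (ennreal (exp (- \<mu> * t)) * indicator {Y s \<omega><..} t)" for t
          using True Y0[OF that] by (auto simp: K_def indicator_def mult_ac)
        then have "(\<integral>\<^sup>+t. K t s \<omega> \<partial>lborel) = ennreal (\<kappa> * exp (- \<kappa> * s)) * ennreal (exp (- \<mu> * Y s \<omega>) / \<mu>)"
          by (simp only:) (subst nn_integral_cmult, use nn_integral_exp_Ioi[OF \<mu>] in auto)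
        also have "\<dots> = ennreal (\<kappa> * exp (- \<kappa> * s) / \<mu>) * ennreal (exp (- \<mu> * Y s \<omega>))"
          using \<kappa> \<mu> by (simp flip: ennreal_mult)
        finally show ?thesis .
      qed
      then have "(\<integral>\<^sup>+\<omega>. (\<integral>\<^sup>+t. K t s \<omega> \<partial>lborel) \<partial>M)
          = (\<integral>\<^sup>+\<omega>. ennreal (\<kappa> * exp (- \<kappa> * s) / \<mu>) * ennreal (exp (- \<mu> * Y s \<omega>)) \<partial>M)"
        by (rule nn_integral_cong)
      also have "\<dots> = ennreal (\<kappa> * exp (- \<kappa> * s) / \<mu>) * ennreal (\<integral>\<omega>. exp (- \<mu> * Y s \<omega>) \<partial>M)"
        by (subst nn_integral_cmult) (use int in \<open>auto simp: nn_integral_eq_integral\<close>)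
      also have "\<dots> = ennreal (\<kappa> * exp (- \<kappa> * s) / \<mu>) * ennreal (exp (- s * \<Psi>))"
        using laplace_Y[of s \<mu>] True \<mu> by (simp add: \<Psi>_def)
      also have "\<dots> = ennreal (\<kappa> / \<mu>) * ennreal (exp (- (\<kappa> + \<Psi>) * s))"
        using \<kappa> \<mu> by (simp add: exp_add[symmetric] algebra_simps flip: ennreal_mult)
      finally show ?thesis using True by simp
    qed (simp add: K_def)
  qed
  also have "\<dots> = ennreal (\<kappa> / \<mu>) * ennreal (1 / (\<kappa> + \<Psi>))"
    using nn_integral_exp_Ioi[of "\<kappa> + \<Psi>" 0] \<kappa> \<Psi> by (subst nn_integral_cmult) auto
  also have "\<dots> = ennreal (\<kappa> / (\<mu> * (\<kappa> + \<Psi>)))"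
    using \<kappa> \<mu> \<Psi> by (simp flip: ennreal_mult)
  finally show ?thesis by (simp add: \<Psi>_def)
qed

lemma L_laplace_0: "L_laplace \<kappa> 0 = 1"
proof -
  have "L_laplace \<kappa> 0 = (\<integral>\<omega>. 1 \<partial>M)"
    unfolding L_laplace_def by (intro Bochner_Integration.integral_cong) (auto simp: L_0)
  then show ?thesis by (simp add: prob_space)
qed

lemma exp_L_le_1: "0 \<le> \<kappa> \<Longrightarrow> exp (- \<kappa> * L t \<omega>) \<le> 1"
  using L_nonneg[of t \<omega>] by simp

lemma L_laplace_le_1:
  assumes "0 \<le> \<kappa>"
  shows "L_laplace \<kappa> t \<le> 1"
proof -
  have "L_laplace \<kappa> t \<le> (\<integral>\<omega>. 1 \<partial>M)"
    unfolding L_laplace_def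
  proof (rule integral_mono)
    show "integrable M (\<lambda>\<omega>. exp (- \<kappa> * L t \<omega>))"
      by (rule integrable_const_bound[where B=1]) (use exp_L_le_1[OF assms] in auto)
  qed (use exp_L_le_1[OF assms] in auto)
  then show ?thesis by (simp add: prob_space)
qed

text \<open>Almost every path of \<open>L\<close> is continuous, and the exponentials are bounded by
  1.\<close>

lemma continuous_on_L_laplace:
  assumes \<kappa>: "0 \<le> \<kappa>"
  shows "continuous_on {0..} (L_laplace \<kappa>)"
  unfolding continuous_on_sequentially
proof (intro allI ballI impI, elim conjE)
  fix x :: "nat \<Rightarrow> real" and a :: real
  assume a: "a \<in> {0..}" and x: "\<forall>n. x n \<in> {0..}" "x \<longlonglongrightarrow> a"
  show "(L_laplace \<kappa> \<circ> x) \<longlonglongrightarrow> L_laplace \<kappa> a"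
    unfolding comp_def L_laplace_def
  proof (rule integral_dominated_convergence[where w="\<lambda>_. 1"])
    show "AE \<omega> in M. (\<lambda>n. exp (- \<kappa> * L (x n) \<omega>)) \<longlonglongrightarrow> exp (- \<kappa> * L a \<omega>)"
      using strict_mono_Y Y_unbounded AE_space
    proof eventually_elim
      case (elim \<omega>)
      have "continuous_on {0..} (\<lambda>t. L t \<omega>)"
        unfolding L_def using elim by (intro continuous_on_inverse_process time_change_Y) auto
      then have "(\<lambda>n. L (x n) \<omega>) \<longlonglongrightarrow> L a \<omega>"
        using a x unfolding continuous_on_sequentially comp_def by blast
      then show ?case by (intro tendsto_intros)
    qed
  qed (use exp_L_le_1[OF \<kappa>] in auto)
qed

text \<open>The difference of the integral \<open>1 / \<mu>\<close> of the exponential and of the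
  value in \<open>nn_integral_L_laplace\<close>. Both integrands are nonnegative, so finiteness of
  these values already gives integrability.\<close>

lemma
  assumes \<kappa>: "0 \<le> \<kappa>" and \<mu>: "0 < \<mu>"
  shows integrable_L_laplace: "set_integrable lborel {0<..} (\<lambda>t. exp (- \<mu> * t) * L_laplace \<kappa> t)"
    and laplace_L_laplace: "(LINT t:{0<..}|lborel. exp (- \<mu> * t) * L_laplace \<kappa> t)
      = laplace_exponent \<mu> / (\<mu> * (\<kappa> + laplace_exponent \<mu>))"
proof -
  define \<Psi> where "\<Psi> = laplace_exponent \<mu>"
  have \<Psi>: "0 < \<Psi>" using laplace_exponent_pos[OF \<mu>] by (simp add: \<Psi>_def)
  let ?e = "\<lambda>t. indicator {0<..} t * exp (- \<mu> * t) :: real"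
  let ?d = "\<lambda>t. indicator {0<..} t * (exp (- \<mu> * t) * (1 - L_laplace \<kappa> t)) :: real"
  have cont: "continuous_on {0<..} (L_laplace \<kappa>)"
    by (rule continuous_on_subset[OF continuous_on_L_laplace[OF \<kappa>]]) auto
  have "(\<lambda>t. indicator {0<..} t *\<^sub>R (exp (- \<mu> * t) * (1 - L_laplace \<kappa> t))) \<in> borel_measurable borel"
    by (rule borel_measurable_continuous_on_indicator) (auto intro!: continuous_intros cont)
  then have d_meas [measurable]: "?d \<in> borel_measurable borel" by simp
  have nn_e: "(\<integral>\<^sup>+t. ennreal (?e t) \<partial>lborel) = ennreal (1 / \<mu>)"
    using nn_integral_exp_Ioi[OF \<mu>, of 0]
    by (simp add: indicator_mult_ennreal mult.commute)
  have nn_d: "(\<integral>\<^sup>+t. ennreal (?d t) \<partial>lborel) = ennreal (\<kappa> / (\<mu> * (\<kappa> + \<Psi>)))"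
    using nn_integral_L_laplace[OF \<kappa> \<mu>]
    by (simp add: indicator_mult_ennreal mult.commute \<Psi>_def)
  have d_nonneg: "0 \<le> ?d t" for t
    using L_laplace_le_1[OF \<kappa>, of t] by (auto simp: indicator_def)
  have int_e: "integrable lborel ?e"
  proof (rule integrableI_nonneg)
    show "(\<integral>\<^sup>+t. ennreal (?e t) \<partial>lborel) < \<infinity>"
      by (simp only: nn_e infinity_ennreal_def ennreal_less_top)
  qed auto
  have int_d: "integrable lborel ?d"
  proof (rule integrableI_nonneg)
    show "(\<integral>\<^sup>+t. ennreal (?d t) \<partial>lborel) < \<infinity>"
      by (simp only: nn_d infinity_ennreal_def ennreal_less_top)
    show "?d \<in> borel_measurable lborel"
      by (simp only: measurable_lborel2 d_meas)
  qed (use d_nonneg in simp)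
  have "(\<integral>t. ?e t \<partial>lborel) = 1 / \<mu>"
  proof -
    have "(\<integral>t. ?e t \<partial>lborel) = enn2real (\<integral>\<^sup>+t. ennreal (?e t) \<partial>lborel)"
      by (rule integral_eq_nn_integral) auto
    then show ?thesis
      using \<mu> by (simp only: nn_e) simp
  qed
  moreover have "(\<integral>t. ?d t \<partial>lborel) = \<kappa> / (\<mu> * (\<kappa> + \<Psi>))"
  proof -
    have "(\<integral>t. ?d t \<partial>lborel) = enn2real (\<integral>\<^sup>+t. ennreal (?d t) \<partial>lborel)"
      by (rule integral_eq_nn_integral) (simp_all only: measurable_lborel2 d_meas d_nonneg AE_I2)
    then show ?thesis
      using \<kappa> \<mu> \<Psi> by (simp only: nn_d) simp
  qed
  moreover have eq: "indicator {0<..} t *\<^sub>R (exp (- \<mu> * t) * L_laplace \<kappa> t) = ?e t - ?d t" for t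
    by (simp add: indicator_def algebra_simps)
  ultimately show "(LINT t:{0<..}|lborel. exp (- \<mu> * t) * L_laplace \<kappa> t)
      = laplace_exponent \<mu> / (\<mu> * (\<kappa> + laplace_exponent \<mu>))"
    unfolding set_lebesgue_integral_def eq \<Psi>_def[symmetric]
    using int_e int_d \<kappa> \<mu> \<Psi> by (simp add: divide_simps) (simp add: algebra_simps)
  show "set_integrable lborel {0<..} (\<lambda>t. exp (- \<mu> * t) * L_laplace \<kappa> t)"
    unfolding set_integrable_def eq using int_e int_d by (rule Bochner_Integration.integrable_diff)
qed

end

section \<open>The time-changed stable process\<close>

locale time_changed_stable = stable_mixture M m r \<nu> lam H
  for M :: "'a measure" and m r \<nu> lam H +
  fixes S :: "real \<Rightarrow> 'a \<Rightarrow> real ^ 'n" and \<beta> c :: real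
  assumes stable_S: "isotropic_stable_process M (2 * \<beta>) S"
    and indep_SL: "independent_processes M S L"
    and \<beta>_pos: "0 < \<beta>" and c_pos: "0 < c"
begin

definition W :: "real \<Rightarrow> 'a \<Rightarrow> real ^ 'n" where
  "W t \<omega> = S (c\<^sup>2 * L t \<omega>) \<omega>"

definition symbol :: "real ^ 'n \<Rightarrow> real" where
  "symbol \<xi> = c\<^sup>2 * norm \<xi> powr (2 * \<beta>)"

lemma symbol_nonneg: "0 \<le> symbol \<xi>"
  by (simp add: symbol_def)

lemma indep_LS: "indep_set (process_events M {0<..} L) (process_events M {0<..} S)"
  using indep_SL unfolding independent_processes_def indep_sets2_eq
  by (metis Int_commute mult.commute)

lemma L_event:
  assumes "0 < t" "A \<in> sets borel"
  shows "L t -` A \<inter> space M \<in> process_events M {0<..} L"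
  using assms by (intro process_event_at) auto

lemma measurable_S: "0 \<le> t \<Longrightarrow> S t \<in> borel_measurable M"
  using stable_S by (simp add: isotropic_stable_process_def levy_process_def)

lemma right_continuous_S: "\<omega> \<in> space M \<Longrightarrow> 0 \<le> t \<Longrightarrow> continuous (at_right t) (\<lambda>s. S s \<omega>)"
  using stable_S by (simp add: isotropic_stable_process_def levy_process_def)

lemma measurable_W [measurable]: "W t \<in> borel_measurable M"
  unfolding W_def[abs_def]
  by (rule measurable_at_random_time[where X=S])
     (simp_all add: measurable_S right_continuous_S L_nonneg)

text \<open>Conditioning on the independent time \<open>c\<^sup>2 * L t\<close>, with an event of
  that time kept. \<open>A = UNIV\<close> gives the characteristic function of \<open>W t\<close>,
  and \<open>A = {d<..}\<close> that of its restricted law.\<close>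

lemma char_W_on:
  assumes t: "0 < t" and A: "A \<in> sets borel"
  shows "(\<integral>\<omega>. indicator A (c\<^sup>2 * L t \<omega>) *\<^sub>R iexp (\<xi> \<bullet> W t \<omega>) \<partial>M)
    = (\<integral>\<omega>. indicator A (c\<^sup>2 * L t \<omega>) *\<^sub>R of_real (exp (- symbol \<xi> * L t \<omega>)) \<partial>M)"
proof -
  have "(\<integral>\<omega>. indicator A (c\<^sup>2 * L t \<omega>) *\<^sub>R iexp (\<xi> \<bullet> S (c\<^sup>2 * L t \<omega>) \<omega>) \<partial>M)
    = (\<integral>\<omega>. indicator A (c\<^sup>2 * L t \<omega>) *\<^sub>R (of_real (exp (- (c\<^sup>2 * L t \<omega>) * norm \<xi> powr (2 * \<beta>))) :: complex) \<partial>M)"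
  proof (rule integral_at_independent_time[where X=S and \<tau>="\<lambda>\<omega>. c\<^sup>2 * L t \<omega>" and g="\<lambda>x. iexp (\<xi> \<bullet> x)"
        and \<phi>="\<lambda>s. of_real (exp (- s * norm \<xi> powr (2 * \<beta>)))" and C=1, OF indep_LS])
    fix s :: real and B :: "(real ^ 'n) set" assume "0 < s" "B \<in> sets borel"
    then show "S s -` B \<inter> space M \<in> process_events M {0<..} S"
      by (intro process_event_at) auto
  next
    fix B :: "real set" assume B: "B \<in> sets borel"
    have "(\<lambda>x. c\<^sup>2 * x) -` B \<in> sets (borel :: real measure)"
      by (rule measurable_sets_borel[OF _ B]) measurable
    from L_event[OF t this] show "(\<lambda>\<omega>. c\<^sup>2 * L t \<omega>) -` B \<inter> space M \<in> process_events M {0<..} L"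
      by (simp add: vimage_def)
  next
    fix s :: real assume "0 < s"
    then show "(\<integral>\<omega>. iexp (\<xi> \<bullet> S s \<omega>) \<partial>M) = of_real (exp (- s * norm \<xi> powr (2 * \<beta>)))"
      using stable_S by (simp add: isotropic_stable_process_def)
  qed (auto intro!: continuous_intros right_continuous_S A simp: L_nonneg)
  then show ?thesis
    by (simp add: W_def symbol_def mult_ac)
qed

lemma char_W:
  assumes "0 < t"
  shows "(\<integral>\<omega>. iexp (\<xi> \<bullet> W t \<omega>) \<partial>M) = of_real (L_laplace (symbol \<xi>) t)"
  using char_W_on[OF assms, of UNIV \<xi>] by (simp add: L_laplace_def)

section \<open>The problem after Fourier and Laplace transformation\<close>

lemma fourier_delta_eq: "fourier_delta (\<xi> :: real ^ 'n) = 1"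
  unfolding fourier_delta_def by (subst integral_return) auto

lemma
  assumes w: "density_of_process M W w" and t: "0 < t"
  shows integrable_density: "integrable lborel (\<lambda>x. w x t)"
    and fourier_density: "fourier (\<lambda>x. w x t) \<xi> = of_real (L_laplace (symbol \<xi>) t)"
proof -
  have nonneg: "0 \<le> w x t" for x
    using w t by (simp add: density_of_process_def)
  have D: "distributed M lborel (W t) (\<lambda>x. ennreal (w x t))"
    using w t by (simp add: density_of_process_def)
  have "(\<lambda>x. ennreal (w x t)) \<in> borel_measurable borel"
    using D by (simp add: distributed_def)
  then have "(\<lambda>x. enn2real (ennreal (w x t))) \<in> borel_measurable borel"
    by (rule borel_measurable_enn2real)
  then have w_meas [measurable]: "(\<lambda>x. w x t) \<in> borel_measurable borel"
    using nonneg by simp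
  have distr: "distr M lborel (W t) = density lborel (\<lambda>x. ennreal (w x t))"
    using D by (simp add: distributed_def)
  have "(\<integral>\<^sup>+x. ennreal (w x t) \<partial>lborel) = emeasure (density lborel (\<lambda>x. ennreal (w x t))) UNIV"
    by (simp add: emeasure_density)
  also have "\<dots> = 1"
    unfolding distr[symmetric] by (simp add: emeasure_distr emeasure_space_1)
  finally show "integrable lborel (\<lambda>x. w x t)"
    by (intro integrableI_nonneg) (auto simp: nonneg)
  have "fourier (\<lambda>x. w x t) \<xi> = (\<integral>x. iexp (\<xi> \<bullet> x) \<partial>density lborel (\<lambda>x. ennreal (w x t)))"
    unfolding fourier_def using nonneg
    by (subst integral_density) (auto simp: scaleR_conv_of_real mult.commute)
  also have "\<dots> = (\<integral>\<omega>. iexp (\<xi> \<bullet> W t \<omega>) \<partial>M)"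
    unfolding distr[symmetric] by (subst integral_distr) auto
  finally show "fourier (\<lambda>x. w x t) \<xi> = of_real (L_laplace (symbol \<xi>) t)"
    using char_W[OF t] by simp
qed

lemma fourier_delta_initial_density:
  assumes "density_of_process M W w" "0 \<le> t"
  shows "fourier_delta_initial w \<xi> t = of_real (L_laplace (symbol \<xi>) t)"
  using assms fourier_density[OF assms(1), of t]
  by (auto simp: fourier_delta_initial_def fourier_delta_eq L_laplace_0)

lemma laplace_density:
  assumes w: "density_of_process M W w" and \<mu>: "0 < \<mu>"
  shows "set_integrable lborel {0<..} (\<lambda>t. of_real (exp (- \<mu> * t)) * fourier_delta_initial w \<xi> t)"
    and "laplace (fourier_delta_initial w \<xi>) \<mu>
      = of_real (laplace_exponent \<mu> / (\<mu> * (symbol \<xi> + laplace_exponent \<mu>)))"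
proof -
  have eq: "indicator {0<..} t *\<^sub>R (of_real (exp (- \<mu> * t)) * fourier_delta_initial w \<xi> t)
      = complex_of_real (indicator {0<..} t *\<^sub>R (exp (- \<mu> * t) * L_laplace (symbol \<xi>) t))" for t
    using fourier_delta_initial_density[OF w, of t] by (auto simp: indicator_def)
  show "set_integrable lborel {0<..} (\<lambda>t. of_real (exp (- \<mu> * t)) * fourier_delta_initial w \<xi> t)"
    using integrable_L_laplace[OF symbol_nonneg \<mu>]
    unfolding set_integrable_def eq by (rule integrable_of_real)
  show "laplace (fourier_delta_initial w \<xi>) \<mu>
      = of_real (laplace_exponent \<mu> / (\<mu> * (symbol \<xi> + laplace_exponent \<mu>)))"
    using laplace_L_laplace[OF symbol_nonneg \<mu>]
    unfolding laplace_def set_lebesgue_integral_def eq integral_complex_of_real by (simp only:)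
qed

text \<open>With initial value 1 every Caputo term is
  \<open>lam j * \<mu> powr (\<nu> j ^ r)\<close> times the same difference
  \<open>laplace F \<mu> - 1 / \<mu>\<close>. What remains is a linear equation for
  \<open>laplace F \<mu>\<close> with the positive coefficient
  \<open>symbol \<xi> + laplace_exponent \<mu>\<close>. One direction shows that the density solves
  the problem, the other serves uniqueness.\<close>

lemma fractional_equation_iff:
  assumes \<mu>: "0 < \<mu>" and F0: "F 0 = 1"
  shows "(\<Sum>j=1..m. of_real (lam j) * laplace_caputo (\<nu> j ^ r) F \<mu>)
      = of_real (c\<^sup>2 * frac_laplacian_symbol \<beta> \<xi>) * laplace F \<mu>
    \<longleftrightarrow> laplace F \<mu> = of_real (laplace_exponent \<mu> / (\<mu> * (symbol \<xi> + laplace_exponent \<mu>)))"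
proof -
  define \<Psi> where "\<Psi> = laplace_exponent \<mu>"
  have pos: "0 < \<Psi>" "0 < symbol \<xi> + \<Psi>"
    using laplace_exponent_pos[OF \<mu>] symbol_nonneg[of \<xi>] by (auto simp: \<Psi>_def)
  have "of_real (lam j) * laplace_caputo (\<nu> j ^ r) F \<mu>
      = of_real (lam j * \<mu> powr (\<nu> j ^ r)) * (laplace F \<mu> - of_real (1 / \<mu>))" for j
    using \<mu> by (simp add: laplace_caputo_def F0 powr_diff algebra_simps)
  then have lhs: "(\<Sum>j=1..m. of_real (lam j) * laplace_caputo (\<nu> j ^ r) F \<mu>) = of_real \<Psi> * (laplace F \<mu> - of_real (1 / \<mu>))"
    by (simp only: \<Psi>_def laplace_exponent_def of_real_sum sum_distrib_right)
  have rhs: "c\<^sup>2 * frac_laplacian_symbol \<beta> \<xi> = - symbol \<xi>"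
    by (simp add: frac_laplacian_symbol_def symbol_def)
  have nz: "complex_of_real (symbol \<xi> + \<Psi>) \<noteq> 0" "complex_of_real \<mu> \<noteq> 0"
    using pos \<mu> by (auto simp del: of_real_add)
  have "of_real \<Psi> * (laplace F \<mu> - of_real (1 / \<mu>)) = of_real (- symbol \<xi>) * laplace F \<mu>
    \<longleftrightarrow> of_real (symbol \<xi> + \<Psi>) * laplace F \<mu> = of_real (\<Psi> / \<mu>)"
    by (auto simp: algebra_simps add_eq_0_iff)
  also have "\<dots> \<longleftrightarrow> laplace F \<mu> = of_real (\<Psi> / (\<mu> * (symbol \<xi> + \<Psi>)))"
    using nz by (simp only: of_real_divide of_real_mult) (auto simp: field_simps simp del: of_real_add)
  finally show ?thesis
    unfolding lhs rhs \<Psi>_def .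
qed

lemma fourier_delta_initial_0: "fourier_delta_initial (u :: real ^ 'n \<Rightarrow> real \<Rightarrow> real) \<xi> 0 = 1"
  by (simp add: fourier_delta_initial_def fourier_delta_eq)

theorem density_solves:
  assumes w: "density_of_process M W w"
  shows "solves_fractional_problem m lam (\<lambda>j. \<nu> j ^ r) \<beta> c w"
  unfolding solves_fractional_problem_def
proof (intro conjI allI impI)
  fix t :: real assume "0 < t"
  then show "integrable lborel (\<lambda>x. w x t)" by (rule integrable_density[OF w])
next
  fix \<xi>
  have "continuous_on {0..} (\<lambda>t. complex_of_real (L_laplace (symbol \<xi>) t))"
    by (intro continuous_on_of_real continuous_on_L_laplace symbol_nonneg)
  then show "continuous_on {0..} (fourier_delta_initial w \<xi>)"
    by (rule continuous_on_eq) (simp add: fourier_delta_initial_density[OF w])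
next
  fix \<xi> and \<mu> :: real assume \<mu>: "0 < \<mu>"
  show "set_integrable lborel {0<..} (\<lambda>t. of_real (exp (- \<mu> * t)) * fourier_delta_initial w \<xi> t)"
    by (rule laplace_density(1)[OF w \<mu>])
  show "(\<Sum>j=1..m. of_real (lam j) * laplace_caputo (\<nu> j ^ r) (fourier_delta_initial w \<xi>) \<mu>)
      = of_real (c\<^sup>2 * frac_laplacian_symbol \<beta> \<xi>) * laplace (fourier_delta_initial w \<xi>) \<mu>"
    unfolding fractional_equation_iff[OF \<mu>, of "fourier_delta_initial w \<xi>", OF fourier_delta_initial_0]
    by (rule laplace_density(2)[OF w \<mu>])
qed

lemma laplace_solution:
  fixes u :: "real ^ 'n \<Rightarrow> real \<Rightarrow> real"
  assumes u: "solves_fractional_problem m lam (\<lambda>j. \<nu> j ^ r) \<beta> c u" and \<mu>: "0 < \<mu>"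
  shows "laplace (fourier_delta_initial u \<xi>) \<mu>
    = of_real (laplace_exponent \<mu> / (\<mu> * (symbol \<xi> + laplace_exponent \<mu>)))"
proof -
  have "(\<Sum>j=1..m. of_real (lam j) * laplace_caputo (\<nu> j ^ r) (fourier_delta_initial u \<xi>) \<mu>)
      = of_real (c\<^sup>2 * frac_laplacian_symbol \<beta> \<xi>) * laplace (fourier_delta_initial u \<xi>) \<mu>"
    using u \<mu> unfolding solves_fractional_problem_def by blast
  then show ?thesis
    by (rule fractional_equation_iff[OF \<mu>, of "fourier_delta_initial u \<xi>", OF fourier_delta_initial_0, THEN iffD1])
qed

text \<open>Because Fourier modes of solutions are continuous in time, Lerch's theorem gives
  equality at each \<open>t\<close> and not only at almost every \<open>t\<close>; an exceptional
  null set remains in \<open>x\<close> alone.\<close>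

theorem solution_unique:
  fixes u w :: "real ^ 'n \<Rightarrow> real \<Rightarrow> real"
  assumes u: "solves_fractional_problem m lam (\<lambda>j. \<nu> j ^ r) \<beta> c u"
    and w: "solves_fractional_problem m lam (\<lambda>j. \<nu> j ^ r) \<beta> c w"
    and t: "0 < t"
  shows "AE x in lborel. u x t = w x t"
proof (rule fourier_inject)
  show "integrable lborel (\<lambda>x. u x t)" "integrable lborel (\<lambda>x. w x t)"
    using u w t by (auto simp: solves_fractional_problem_def)
  fix \<xi>
  let ?U = "fourier_delta_initial u \<xi>" and ?W = "fourier_delta_initial w \<xi>"
  have int: "set_integrable lborel {0<..} (\<lambda>t. of_real (exp (- \<mu> * t)) * ?U t)"
    "set_integrable lborel {0<..} (\<lambda>t. of_real (exp (- \<mu> * t)) * ?W t)" if "0 < \<mu>" for \<mu>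
    using u w that by (auto simp: solves_fractional_problem_def)
  have lap: "laplace ?U \<mu> = laplace ?W \<mu>" if "0 < \<mu>" for \<mu>
    using laplace_solution[OF u that] laplace_solution[OF w that] by simp
  have "?U t - ?W t = 0"
  proof (rule lerch)
    show "continuous_on {0..} (\<lambda>t. ?U t - ?W t)"
      using u w by (intro continuous_on_diff) (auto simp: solves_fractional_problem_def)
    fix \<mu> :: real assume \<mu>: "0 < \<mu>"
    show "set_integrable lborel {0<..} (\<lambda>t. of_real (exp (- \<mu> * t)) * (?U t - ?W t))"
      using int[OF \<mu>] unfolding right_diff_distrib by (rule set_integral_diff)
    show "laplace (\<lambda>t. ?U t - ?W t) \<mu> = 0"
      using set_integral_diff(2)[OF int[OF \<mu>]] lap[OF \<mu>]
      by (simp add: laplace_def right_diff_distrib)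
  qed (use t in auto)
  then show "fourier (\<lambda>x. u x t) \<xi> = fourier (\<lambda>x. w x t) \<xi>"
    using t by (simp add: fourier_delta_initial_def)
qed

section \<open>Existence of the density\<close>

lemma absolutely_continuous_W:
  assumes t: "0 < t"
  shows "absolutely_continuous lborel (distr M lborel (W t))"
  unfolding absolutely_continuous_def
proof
  fix A :: "(real ^ 'n) set" assume A: "A \<in> null_sets lborel"
  then have [measurable]: "A \<in> sets borel" by auto
  have "AE \<omega> in M. \<not> (d < c\<^sup>2 * L t \<omega> \<and> W t \<omega> \<in> A)" if d: "0 < d" for d
  proof -
    \<comment> \<open>The law of \<open>W t\<close> restricted to
      \<open>d < c\<^sup>2 * L t\<close>. Weighting \<open>M\<close> before pushing forward turns
      its transform into the integral computed in \<open>char_W_on\<close>.\<close>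
    define N where "N = distr (density M (\<lambda>\<omega>. ennreal (indicator {d<..} (c\<^sup>2 * L t \<omega>)))) borel (W t)"
    have sets_N: "sets N = sets borel" by (simp add: N_def)
    have emeasure_N: "emeasure N E = emeasure M {\<omega> \<in> space M. d < c\<^sup>2 * L t \<omega> \<and> W t \<omega> \<in> E}"
      if [measurable]: "E \<in> sets borel" for E
    proof -
      have "emeasure N E = (\<integral>\<^sup>+\<omega>. ennreal (indicator {d<..} (c\<^sup>2 * L t \<omega>)) * indicator (W t -` E \<inter> space M) \<omega> \<partial>M)"
        unfolding N_def by (subst emeasure_distr) (auto simp: emeasure_density)
      also have "\<dots> = (\<integral>\<^sup>+\<omega>. indicator {\<omega> \<in> space M. d < c\<^sup>2 * L t \<omega> \<and> W t \<omega> \<in> E} \<omega> \<partial>M)"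
        by (intro nn_integral_cong) (auto simp: indicator_def)
      also have "\<dots> = emeasure M {\<omega> \<in> space M. d < c\<^sup>2 * L t \<omega> \<and> W t \<omega> \<in> E}"
        by (rule nn_integral_indicator) measurable
      finally show ?thesis .
    qed
    have fin: "finite_measure N"
      by (rule finite_measureI) (simp add: N_def[THEN arg_cong[where f=space]] emeasure_N)
    have char_N: "fourier_measure N \<xi> = (\<integral>\<omega>. indicator {d<..} (c\<^sup>2 * L t \<omega>) *\<^sub>R of_real (exp (- symbol \<xi> * L t \<omega>)) \<partial>M)" for \<xi>
    proof -
      have "fourier_measure N \<xi> = (\<integral>\<omega>. indicator {d<..} (c\<^sup>2 * L t \<omega>) *\<^sub>R iexp (\<xi> \<bullet> W t \<omega>) \<partial>M)"
        unfolding fourier_measure_def N_def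
        by (subst integral_distr, simp, simp, subst integral_density) auto
      also have "\<dots> = (\<integral>\<omega>. indicator {d<..} (c\<^sup>2 * L t \<omega>) *\<^sub>R of_real (exp (- symbol \<xi> * L t \<omega>)) \<partial>M)"
        by (rule char_W_on[OF t]) simp
      finally show ?thesis .
    qed
    have "norm (fourier_measure N \<xi>) \<le> exp (- d * norm \<xi> powr (2 * \<beta>))" for \<xi>
    proof -
      \<comment> \<open>Where the indicator is nonzero, \<open>symbol \<xi> * L t\<close> equals
        \<open>c\<^sup>2 * L t\<close> times the power of the norm, and
        \<open>c\<^sup>2 * L t\<close> exceeds \<open>d\<close>.\<close>
      have le: "indicator {d<..} (c\<^sup>2 * L t \<omega>) * exp (- symbol \<xi> * L t \<omega>) \<le> exp (- d * norm \<xi> powr (2 * \<beta>))" for \<omega>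
      proof (cases "d < c\<^sup>2 * L t \<omega>")
        case True
        then have "d * norm \<xi> powr (2 * \<beta>) \<le> c\<^sup>2 * L t \<omega> * norm \<xi> powr (2 * \<beta>)"
          by (intro mult_right_mono) auto
        then show ?thesis
          using True by (simp add: symbol_def mult_ac)
      qed simp
      have "norm (fourier_measure N \<xi>) \<le> (\<integral>\<omega>. norm (indicator {d<..} (c\<^sup>2 * L t \<omega>) *\<^sub>R complex_of_real (exp (- symbol \<xi> * L t \<omega>))) \<partial>M)"
        unfolding char_N by (rule integral_norm_bound)
      also have "\<dots> \<le> (\<integral>\<omega>. exp (- d * norm \<xi> powr (2 * \<beta>)) \<partial>M)"
      proof (rule integral_mono)
        show "integrable M (\<lambda>\<omega>. norm (indicator {d<..} (c\<^sup>2 * L t \<omega>) *\<^sub>R complex_of_real (exp (- symbol \<xi> * L t \<omega>))))"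
          by (rule integrable_const_bound[where B="exp (- d * norm \<xi> powr (2 * \<beta>))"]) (use le in auto)
      qed (use le in auto)
      finally show ?thesis by (simp add: prob_space)
    qed
    then have "integrable lborel (fourier_measure N)"
      using fourier_measure_measurable[OF fin sets_N] d \<beta>_pos
      by (intro Bochner_Integration.integrable_bound[OF integrable_exp_norm_powr[of d "2 * \<beta>"]]) auto
    then have "absolutely_continuous lborel N"
      by (rule absolutely_continuous_fourier[OF fin sets_N])
    then have "emeasure N A = 0"
      using A unfolding absolutely_continuous_def by (blast dest: null_setsD1)
    then have "emeasure M {\<omega> \<in> space M. d < c\<^sup>2 * L t \<omega> \<and> W t \<omega> \<in> A} = 0"
      by (simp add: emeasure_N)
    then show ?thesis
      by (subst AE_iff_measurable[OF _ refl]) auto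
  qed
  \<comment> \<open>The thresholds \<open>1 / Suc k\<close> exhaust the event that
    \<open>L t\<close> is positive, which has full probability.\<close>
  then have "AE \<omega> in M. \<forall>k::nat. \<not> (1 / real (Suc k) < c\<^sup>2 * L t \<omega> \<and> W t \<omega> \<in> A)"
    by (subst AE_all_countable) (simp del: of_nat_Suc)
  with L_pos[OF t] have "AE \<omega> in M. W t \<omega> \<notin> A"
  proof eventually_elim
    case (elim \<omega>)
    have "0 < c\<^sup>2 * L t \<omega>" using elim(1) c_pos by simp
    then obtain k :: nat where "inverse (real (Suc k)) < c\<^sup>2 * L t \<omega>"
      using reals_Archimedean by blast
    then show ?case using elim(2) by (auto simp: inverse_eq_divide)
  qed
  then have "emeasure M {\<omega> \<in> space M. W t \<omega> \<in> A} = 0"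
    by (rule emeasure_eq_0_AE)
  moreover have "W t -` A \<inter> space M = {\<omega> \<in> space M. W t \<omega> \<in> A}"
    by auto
  ultimately have "emeasure M (W t -` A \<inter> space M) = 0"
    by (simp only:)
  then show "A \<in> null_sets (distr M lborel (W t))"
    by (auto simp: null_sets_def emeasure_distr)
qed

text \<open>A real-valued Radon-Nikodym derivative at each time separately, followed by a choice
  over all \<open>t\<close>; the notion of density of a process links no two times.\<close>

theorem density_exists: "\<exists>w. density_of_process M W w"
proof -
  have "\<exists>D. (\<forall>x. 0 \<le> D x) \<and> distributed M lborel (W t) (\<lambda>x. ennreal (D x))" if t: "0 < t" for t
  proof -
      have fin: "finite_measure (distr M lborel (W t))"
      by (intro prob_space.finite_measure prob_space_distr) simp
    obtain D where D: "D \<in> borel_measurable lborel"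
      "AE x in lborel. RN_deriv lborel (distr M lborel (W t)) x = ennreal (D x)" "\<And>x. 0 \<le> D x"
      by (rule sigma_finite_measure.real_RN_deriv[OF sigma_finite_lborel fin absolutely_continuous_W[OF t] sets_distr]) blast
    have "density lborel (\<lambda>x. ennreal (D x)) = density lborel (RN_deriv lborel (distr M lborel (W t)))"
      using D(1,2) by (intro density_cong) (auto elim: eventually_mono)
    also have "\<dots> = distr M lborel (W t)"
      by (rule sigma_finite_measure.density_RN_deriv[OF sigma_finite_lborel absolutely_continuous_W[OF t]]) simp
    finally show ?thesis
      using D by (intro exI[of _ D]) (auto simp: distributed_def)
  qed
  then obtain D where D: "\<And>t. 0 < t \<Longrightarrow> (\<forall>x. 0 \<le> D t x) \<and> distributed M lborel (W t) (\<lambda>x. ennreal (D t x))"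
    by metis
  then show ?thesis
    by (intro exI[of _ "\<lambda>x t. D t x"]) (auto simp: density_of_process_def)
qed

end

lemma brownian_motion_eq_isotropic_stable: "brownian_motion M B \<longleftrightarrow> isotropic_stable_process M 2 B"
  by (simp add: brownian_motion_def isotropic_stable_process_def)

theorem theorem3p2:
  fixes M :: "'a measure"
    and m r :: nat
    and \<nu> lam :: "nat \<Rightarrow> real"
    and \<beta> c :: real
    and H :: "nat \<Rightarrow> nat \<Rightarrow> real \<Rightarrow> 'a \<Rightarrow> real"
    and S :: "real \<Rightarrow> 'a \<Rightarrow> real ^ 'n"
    and L :: "real \<Rightarrow> 'a \<Rightarrow> real"
    and W :: "real \<Rightarrow> 'a \<Rightarrow> real ^ 'n"
  assumes "prob_space M"
    and "m \<ge> 1" and "r \<ge> 1"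
    and "\<And>j. j \<in> {1..m} \<Longrightarrow> 0 < \<nu> j \<and> \<nu> j \<le> 1"
    and "\<And>j. j \<in> {1..m} \<Longrightarrow> lam j > 0"
    and "0 < \<beta>" and "\<beta> \<le> 1" and "c > 0"
    and "\<And>k j. k \<in> {1..r} \<Longrightarrow> j \<in> {1..m} \<Longrightarrow> stable_subordinator M (\<nu> j) (H k j)"
    and "prob_space.indep_vars M (\<lambda>_. PiM {0..} (\<lambda>_. borel))
           (\<lambda>(k, j). sample_path {0..} (H k j)) ({1..r} \<times> {1..m})"
    and L_def: "L = inverse_process (mixed_subordinator (\<lambda>j. lam j powr (1 / \<nu> j ^ r)) m r H)"
    and "isotropic_stable_process M (2 * \<beta>) S"
    and "independent_processes M S L"
    and W_def: "W = (\<lambda>t \<omega>. S (c\<^sup>2 * L t \<omega>) \<omega>)"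
  shows "(\<exists>w. density_of_process M W w) \<and>
         (\<forall>w. density_of_process M W w \<longrightarrow>
            solves_fractional_problem m lam (\<lambda>j. \<nu> j ^ r) \<beta> c w \<and>
            (\<forall>u. solves_fractional_problem m lam (\<lambda>j. \<nu> j ^ r) \<beta> c u \<longrightarrow>
               (\<forall>t>0. AE x in lborel. u x t = w x t))) \<and>
         (\<beta> = 1 \<longrightarrow>
            (\<exists>B. brownian_motion M B \<and>
               independent_processes M B L \<and>
               (\<forall>t>0. \<forall>\<omega>\<in>space M. W t \<omega> = B (c\<^sup>2 * L t \<omega>) \<omega>)))"
proof -
  interpret prob_space M by fact
  interpret mix: stable_mixture M m r \<nu> lam H
    by unfold_locales (use assms in auto)
  have L_eq: "L = mix.L"
    unfolding L_def mix.L_def mix.Y_def mix.scale_def[abs_def] ..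
  interpret tc: time_changed_stable M m r \<nu> lam H S \<beta> c
    by unfold_locales (use assms in \<open>auto simp: L_eq[symmetric]\<close>)
  have W_eq: "W = tc.W"
    unfolding W_def tc.W_def[abs_def] L_eq ..
  show ?thesis
  proof (intro conjI allI impI)
    show "\<exists>w. density_of_process M W w"
      unfolding W_eq by (rule tc.density_exists)
  next
    fix w assume w: "density_of_process M W w"
    then show solves: "solves_fractional_problem m lam (\<lambda>j. \<nu> j ^ r) \<beta> c w"
      unfolding W_eq by (rule tc.density_solves)
    show "AE x in lborel. u x t = w x t"
      if "solves_fractional_problem m lam (\<lambda>j. \<nu> j ^ r) \<beta> c u" "0 < t" for u t
      by (rule tc.solution_unique[OF that(1) solves that(2)])
  next
    assume "\<beta> = 1"
    \<comment> \<open>For \<open>\<beta> = 1\<close> the stable index is 2 and the normalisations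
      agree, so \<open>S\<close> itself is the required Brownian motion.\<close>
    then have "brownian_motion M S"
      using tc.stable_S by (simp add: brownian_motion_eq_isotropic_stable)
    then show "\<exists>B. brownian_motion M B \<and> independent_processes M B L \<and>
        (\<forall>t>0. \<forall>\<omega>\<in>space M. W t \<omega> = B (c\<^sup>2 * L t \<omega>) \<omega>)"
      using assms(13) by (intro exI[of _ S]) (simp add: W_def)
  qed
qed

end
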